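(* Let $\rho(x,t),\kappa(x,t)$ be the coefficients of an instantly changing material, equal to $\rho^-(x),\kappa^-(x)$ for $t<0$ and $\rho^+(x),\kappa^+(x)$ for $t\ge0$. Assume that there exists a non-zero quasi-harmonic solution $u(x,t)=v(x)\exp(-i\omega(t)t)$, with $\omega(t)=\omega^-$ for $t<0$ and $\omega(t)=\omega^+$ for $t>0$ and $\omega^-,\omega^+\in\mathbb{C}\setminus\{0\}$, of the wave equation $$\left(\frac{\partial}{\partial t}\frac{1}{\kappa(x,t)}\frac{\partial}{\partial t}-\operatorname{div}_x\frac{1}{\rho(x,t)}\nabla_x\right)u(x,t)=0,\quad x\in\mathbb{R}^3,\ t\in\mathbb{R}.$$ Then for all $x\in\mathbb{R}^3$ $$\frac{\omega^+}{\omega^-}=\frac{\kappa^+(x)}{\kappa^-(x)}=\frac{\rho^-(x)}{\rho^+(x)}.$$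
   Context: Setting. $D_1,D_2\subset[0,1)\times\mathbb{R}^2$ are disjoint bounded smooth simply connected domains, $D_i^m:=D_i+(m,0,0)^T$ for $m\in\mathbb{Z}$, $\mathcal{D}:=\bigcup_m(D_1^m\cup D_2^m)$. The functions $\rho^\pm,\kappa^\pm:\mathbb{R}^3\to\mathbb{C}\setminus\{0\}$ are constant on each $D_i^m$ and constant on $\mathbb{R}^3\setminus\mathcal{D}$. The wave equation is understood in the weak (distributional) sense with $v\in H^1_{loc}(\mathbb{R}^3)$; in particular $u$ and $\kappa^{-1}\partial_tu$ are continuous across $t=0$, and $v$ and $\rho^{-1}\partial_\nu v$ are continuous across $\partial\mathcal{D}$. A quasi-harmonic solution is a non-zero solution of the wave equation of the form $u(x,t)=v(x)\exp(-i\omega(t)t)$ with $v:\mathbb{R}^3\to\mathbb{C}$ independent of $t$ and $\omega(t)=\omega^-$ for $t<0$, $\omega(t)=\omega^+$ for $t>0$, where $\omega^\pm\in\mathbb{C}$. *)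

theory Defs
  imports "HOL-Analysis.Analysis"
begin

primrec Ck :: "nat \<Rightarrow> ('a::euclidean_space \<Rightarrow> 'b::real_normed_vector) \<Rightarrow> bool" where
  "Ck 0 f \<longleftrightarrow> continuous_on UNIV f"
| "Ck (Suc k) f \<longleftrightarrow> (\<forall>x. f differentiable (at x)) \<and>
     (\<forall>b\<in>Basis. Ck k (\<lambda>x. frechet_derivative f (at x) b))"

definition Cinf :: "('a::euclidean_space \<Rightarrow> 'b::real_normed_vector) \<Rightarrow> bool" where
  "Cinf f \<longleftrightarrow> (\<forall>k. Ck k f)"

definition test_function :: "('a::euclidean_space \<Rightarrow> complex) \<Rightarrow> bool" where
  "test_function \<phi> \<longleftrightarrow> Cinf \<phi> \<and> compact (closure {x. \<phi> x \<noteq> 0})"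

abbreviation partial :: "'a::euclidean_space \<Rightarrow> ('a \<Rightarrow> complex) \<Rightarrow> 'a \<Rightarrow> complex" where
  "partial b \<phi> x \<equiv> frechet_derivative \<phi> (at x) b"

definition L2_loc :: "('a::euclidean_space \<Rightarrow> complex) \<Rightarrow> bool" where
  "L2_loc f \<longleftrightarrow> f \<in> borel_measurable lebesgue \<and>
     (\<forall>K. compact K \<longrightarrow> set_integrable lebesgue K (\<lambda>x. (cmod (f x))\<^sup>2))"

text \<open>The partial derivative in direction \<open>b \<in> Basis\<close> is \<open>g b\<close>.\<close>

definition has_weak_gradient ::
  "('a::euclidean_space \<Rightarrow> complex) \<Rightarrow> ('a \<Rightarrow> 'a \<Rightarrow> complex) \<Rightarrow> bool" where
  "has_weak_gradient f g \<longleftrightarrow>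
     (\<forall>b\<in>Basis. \<forall>\<phi>. test_function \<phi> \<longrightarrow>
        (LINT x|lebesgue. f x * partial b \<phi> x) = - (LINT x|lebesgue. g b x * \<phi> x))"

definition H1_loc :: "('a::euclidean_space \<Rightarrow> complex) \<Rightarrow> bool" where
  "H1_loc f \<longleftrightarrow> L2_loc f \<and> (\<exists>g. (\<forall>b\<in>Basis. L2_loc (g b)) \<and> has_weak_gradient f g)"

type_synonym spacetime = "(real^3) \<times> real"

text \<open>
  The equation \<open>\<partial>\<^sub>t (\<kappa>\<inverse> \<partial>\<^sub>t u) - div\<^sub>x (\<rho>\<inverse> \<nabla>\<^sub>x u) = 0\<close>, tested against smooth compactly supported
  functions on space-time after one integration by parts.  The weak gradient of \<open>u\<close> is unique
  up to null sets, so the choice of \<open>g\<close> is immaterial.  The notion is meant for measurable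
  coefficients with \<open>\<rho>\<inverse>\<close>, \<open>\<kappa>\<inverse>\<close> locally bounded, for which the integrand is integrable; the
  coefficients below have this property.
\<close>

definition weak_wave_solution ::
  "(spacetime \<Rightarrow> complex) \<Rightarrow> (spacetime \<Rightarrow> complex) \<Rightarrow> (spacetime \<Rightarrow> complex) \<Rightarrow> bool" where
  "weak_wave_solution \<rho> \<kappa> u \<longleftrightarrow> L2_loc u \<and>
     (\<exists>g. (\<forall>b\<in>Basis. L2_loc (g b)) \<and> has_weak_gradient u g \<and>
        (\<forall>\<phi>. test_function \<phi> \<longrightarrow>
           (LINT z|lebesgue.
              - (1 / \<kappa> z) * g (0, 1) z * partial (0, 1) \<phi> z
              + (\<Sum>i\<in>UNIV. (1 / \<rho> z) * g (axis i 1, 0) z * partial (axis i 1, 0) \<phi> z)) = 0))"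

definition instantly_changing ::
  "(real^3 \<Rightarrow> complex) \<Rightarrow> (real^3 \<Rightarrow> complex) \<Rightarrow> spacetime \<Rightarrow> complex" where
  "instantly_changing cm cp = (\<lambda>(x, t). if t < 0 then cm x else cp x)"

text \<open>
  Elements of the Sobolev spaces are classes modulo null sets, so \<open>u\<close> being non-zero means that it
  does not vanish almost everywhere.
\<close>

definition quasi_harmonic_solution ::
  "(spacetime \<Rightarrow> complex) \<Rightarrow> (spacetime \<Rightarrow> complex) \<Rightarrow> complex \<Rightarrow> complex \<Rightarrow>
     (spacetime \<Rightarrow> complex) \<Rightarrow> bool" where
  "quasi_harmonic_solution \<rho> \<kappa> \<omega>m \<omega>p u \<longleftrightarrow>
     weak_wave_solution \<rho> \<kappa> u \<and> \<not> (AE z in lebesgue. u z = 0) \<and>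
     (\<exists>v \<omega>. H1_loc v \<and> (\<forall>t<0. \<omega> t = \<omega>m) \<and> (\<forall>t>0. \<omega> t = \<omega>p) \<and>
        (\<forall>x t. u (x, t) = v x * exp (- \<i> * \<omega> t * complex_of_real t)))"

text \<open>
  Near each boundary point the domain is, after an orthogonal change of coordinates, the region
  strictly above the graph of a smooth function.
\<close>

definition smooth_boundary :: "(real^3) set \<Rightarrow> bool" where
  "smooth_boundary D \<longleftrightarrow>
     (\<forall>p\<in>frontier D. \<exists>r>0. \<exists>T \<gamma>. orthogonal_transformation (T :: real^3 \<Rightarrow> real^3) \<and>
        Cinf (\<gamma> :: real^2 \<Rightarrow> real) \<and>
        D \<inter> ball p r = {x \<in> ball p r. \<gamma> (vector [T x $ 1, T x $ 2]) < T x $ 3})"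

definition smooth_domain :: "(real^3) set \<Rightarrow> bool" where
  "smooth_domain D \<longleftrightarrow> D \<noteq> {} \<and> open D \<and> connected D \<and> smooth_boundary D"

definition translate :: "int \<Rightarrow> (real^3) set \<Rightarrow> (real^3) set" where
  "translate m D = (\<lambda>x. x + vector [of_int m, 0, 0]) ` D"

definition resonators :: "(real^3) set \<Rightarrow> (real^3) set \<Rightarrow> (real^3) set" where
  "resonators D1 D2 = (\<Union>m. translate m D1 \<union> translate m D2)"

text \<open>The constants on the individual translates may all be different.\<close>

definition material_coefficient ::
  "(real^3) set \<Rightarrow> (real^3) set \<Rightarrow> (real^3 \<Rightarrow> complex) \<Rightarrow> bool" where
  "material_coefficient D1 D2 c \<longleftrightarrow> (\<forall>x. c x \<noteq> 0) \<and>
     (\<forall>m. c constant_on translate m D1 \<and> c constant_on translate m D2) \<and>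
     c constant_on (- resonators D1 D2)"

end

theory Submission
  imports Defs
begin

text \<open>
  Write \<open>u(x,t) = v(x) e(t)\<close> with \<open>e(t) = exp(-i \<omega>\<^sup>\<plusminus> t)\<close>.  Testing the wave equation with products
  \<open>\<psi>(x) \<eta>(t)\<close> separates the variables.  For \<open>\<eta>\<close> supported on one side of \<open>t = 0\<close> this gives the two
  stationary equations \<open>- div (1/\<rho>\<^sup>\<plusminus> \<nabla>v) = (\<omega>\<^sup>\<plusminus>)\<^sup>2/\<kappa>\<^sup>\<plusminus> v\<close>; for \<open>\<eta>(0) \<noteq> 0\<close> the boundary terms at \<open>t = 0\<close>
  give the transmission condition \<open>\<omega>\<^sup>-/\<kappa>\<^sup>- v = \<omega>\<^sup>+/\<kappa>\<^sup>+ v\<close> (\<open>separated_equations\<close>).  On an open piece of one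
  material where \<open>v\<close> does not vanish, the transmission condition is the first identity of the theorem.
  There both stationary equations are Helmholtz equations \<open>\<Delta>v = - \<rho>\<^sup>\<plusminus> (\<omega>\<^sup>\<plusminus>)\<^sup>2/\<kappa>\<^sup>\<plusminus> v\<close>, so their constants
  agree, and together with the first identity this is the second one.

  What remains is that \<open>v\<close> vanishes on no open set, whichever material that set lies in.  Two facts
  give this.

  The first is unique continuation for the Helmholtz equation with constant coefficients: a weak
  solution in a ball that vanishes near the centre vanishes in the whole ball
  (\<open>unique_continuation_ball\<close>).  One tests with \<open>h(|x|\<^sup>2) (x\<cdot>\<xi>)\<^sup>d\<close>, whose
  Laplacian is \<open>(4 s h'' + (6 + 4 d) h') (x\<cdot>\<xi>)\<^sup>d\<close> at \<open>s = |x|\<^sup>2\<close> plus a term of degree \<open>d - 2\<close>.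
  Since \<open>v\<close> vanishes near the centre, the radial equation
  \<open>4 s h'' + (6 + 4 d) h' + \<lambda> h = g\<close> only has to be solved away from \<open>s = 0\<close>, where it is regular
  (\<open>radial_ode\<close>); induction on \<open>d\<close> then shows that \<open>v g(|x|\<^sup>2)\<close> is orthogonal to all powers
  \<open>(x\<cdot>\<xi>)\<^sup>d\<close>, hence to all exponentials, and Stone-Weierstrass gives \<open>v = 0\<close>.

  The second is that zeros pass through material interfaces.  If \<open>v\<close> vanishes on one side of an
  interface, so does its gradient, and the coefficients on that side may be replaced by those of the
  other side without changing the equation: near the interface \<open>v\<close> solves an equation with constant
  coefficients, and the first fact applies.  Resonators may touch each other, and the exterior may be
  disconnected, so several materials can meet at a point; \<open>zero_set_spreads\<close> gets around this by
  picking a boundary point of the zero set that lies on the fewest resonator boundaries.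
\<close>

section \<open>Calculus of smooth functions\<close>

lemma Ck_continuous: "Ck k f \<Longrightarrow> continuous_on UNIV f"
  by (cases k) (auto simp: continuous_at_imp_continuous_on differentiable_imp_continuous_within)

lemma Ck_Suc_imp: "Ck (Suc k) f \<Longrightarrow> Ck k f"
proof (induction k arbitrary: f)
  case 0 then show ?case using Ck_continuous by fastforce
next
  case (Suc k) then show ?case by (metis Ck.simps(2))
qed

text \<open>
  The definition speaks of \<open>frechet_derivative\<close>; this rule lets the inductions below work with any
  explicitly given derivative.
\<close>

lemma Ck_SucI:
  assumes "\<And>x. (f has_derivative f' x) (at x)" "\<And>b. b \<in> Basis \<Longrightarrow> Ck k (\<lambda>x. f' x b)"
  shows "Ck (Suc k) f"
proof -
  have "frechet_derivative f (at x) = f' x" for x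
    using frechet_derivative_at[OF assms(1)] by metis
  with assms show ?thesis by (auto simp: differentiable_def)
qed

lemma Ck_SucE:
  assumes "Ck (Suc k) f"
  shows "(f has_derivative frechet_derivative f (at x)) (at x)"
    "b \<in> Basis \<Longrightarrow> Ck k (\<lambda>x. frechet_derivative f (at x) b)"
  using assms by (auto simp: frechet_derivative_works)

lemma Ck_const: "Ck k (\<lambda>x. c)"
proof (induction k arbitrary: c)
  case (Suc k) show ?case by (rule Ck_SucI[where f' = "\<lambda>x h. 0"]) (use Suc in auto)
qed auto

lemma Ck_add:
  assumes "Ck k f" "Ck k g" shows "Ck k (\<lambda>x. f x + g x)"
  using assms
proof (induction k arbitrary: f g)
  case 0 then show ?case by (auto intro: continuous_intros)
next
  case (Suc k)
  show ?case
    by (rule Ck_SucI[OF has_derivative_add[OF Ck_SucE(1)[OF Suc.prems(1)] Ck_SucE(1)[OF Suc.prems(2)]]])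
       (intro Suc.IH Ck_SucE(2) Suc.prems)
qed

lemma Ck_bilinear:
  assumes B: "bounded_bilinear B" and "Ck k f" "Ck k g" shows "Ck k (\<lambda>x. B (f x) (g x))"
  using assms(2,3)
proof (induction k arbitrary: f g)
  case 0 then show ?case using bounded_bilinear.continuous_on[OF B] by auto
next
  case (Suc k)
  show ?case
    by (rule Ck_SucI[OF bounded_bilinear.FDERIV[OF B Ck_SucE(1)[OF Suc.prems(1)] Ck_SucE(1)[OF Suc.prems(2)]]])
       (intro Ck_add Suc.IH Ck_SucE(2) Suc.prems Ck_Suc_imp; assumption)
qed

lemmas Ck_mult = Ck_bilinear[OF bounded_bilinear_mult]
lemmas Ck_scaleR = Ck_bilinear[OF bounded_bilinear_scaleR]

lemma Ck_bounded_linear: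
  assumes "bounded_linear l" "Ck k f" shows "Ck k (\<lambda>x. l (f x))"
  using assms(2)
proof (induction k arbitrary: f)
  case 0 then show ?case
    using assms(1) by (auto intro: bounded_linear.continuous_on)
next
  case (Suc k)
  show ?case
    by (rule Ck_SucI[OF bounded_linear.has_derivative[OF assms(1) Ck_SucE(1)[OF Suc.prems]]])
       (intro Suc.IH Ck_SucE(2) Suc.prems)
qed

lemma Ck_linear:
  assumes "bounded_linear l" shows "Ck k l"
proof (cases k)
  case 0 then show ?thesis using assms linear_continuous_on by auto
next
  case (Suc n) 
  show ?thesis unfolding Suc
    by (rule Ck_SucI[where f'="\<lambda>_. l"]) (auto intro: bounded_linear_imp_has_derivative assms Ck_const)
qed

lemma Ck_compose:
  fixes h :: "real \<Rightarrow> 'b::real_normed_vector" and s :: "'a::euclidean_space \<Rightarrow> real"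
  assumes "Ck k h" "Ck k s" shows "Ck k (\<lambda>x. h (s x))"
  using assms
proof (induction k arbitrary: h)
  case 0 then show ?case by (auto intro: continuous_on_compose2)
next
  case (Suc k)
  have lin: "frechet_derivative h (at y) d = d *\<^sub>R frechet_derivative h (at y) 1" for y d
    using linear_scale[OF bounded_linear.linear[OF has_derivative_bounded_linear[OF Ck_SucE(1)[OF Suc.prems(1)]]], of y d 1]
    by simp
  show ?case
  proof (rule Ck_SucI[OF has_derivative_compose[OF Ck_SucE(1)[OF Suc.prems(2)] Ck_SucE(1)[OF Suc.prems(1)]]])
    fix b :: 'a assume b: "b \<in> Basis"
    have "Ck k (\<lambda>x. frechet_derivative s (at x) b *\<^sub>R frechet_derivative h (at (s x)) 1)"
      by (intro Ck_scaleR Suc.IH Ck_SucE(2) Ck_Suc_imp[OF Suc.prems(2)] Suc.prems b) simp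
    then show "Ck k (\<lambda>x. frechet_derivative h (at (s x)) (frechet_derivative s (at x) b))"
      by (subst lin)
  qed
qed

text \<open>
  Coordinate projections map basis vectors to basis vectors or to zero.  For such a map the partial
  derivatives of the composite are again composites of this form, which makes the induction on the
  order of differentiability immediate.
\<close>

lemma Ck_precompose_Basis:
  fixes f :: "'b::euclidean_space \<Rightarrow> 'c::real_normed_vector" and l :: "'a::euclidean_space \<Rightarrow> 'b"
  assumes l: "bounded_linear l" and B: "\<And>b. b \<in> Basis \<Longrightarrow> l b \<in> Basis \<or> l b = 0" and "Ck k f"
  shows "Ck k (\<lambda>x. f (l x))"
  using assms(3)
proof (induction k arbitrary: f)
  case 0 then show ?case
    using linear_continuous_on[OF l] by (auto intro: continuous_on_compose2)
next
  case (Suc k)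
  have 1: "((\<lambda>x. f (l x)) has_derivative (\<lambda>h. frechet_derivative f (at (l x)) (l h))) (at x)" for x
    using has_derivative_compose[OF bounded_linear_imp_has_derivative[OF l] Ck_SucE(1)[OF Suc.prems]] .
  show ?case
  proof (rule Ck_SucI[OF 1])
    fix b :: 'a assume "b \<in> Basis"
    then consider "l b \<in> Basis" | "l b = 0" using B by blast
    then show "Ck k (\<lambda>x. frechet_derivative f (at (l x)) (l b))"
    proof cases
      case 1 show ?thesis
        using Suc.IH[OF Ck_SucE(2)[OF Suc.prems 1]] .
    next
      case 2
      have "frechet_derivative f (at y) 0 = 0" for y
        using Ck_SucE(1)[OF Suc.prems] by (meson has_derivative_bounded_linear bounded_linear.linear linear_0)
      then show ?thesis using 2 by (simp add: Ck_const)
    qed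
  qed
qed

lemma CinfI: "(\<And>k. Ck k f) \<Longrightarrow> Cinf f" by (simp add: Cinf_def)
lemma CinfD: "Cinf f \<Longrightarrow> Ck k f" by (simp add: Cinf_def)

lemma Cinf_const: "Cinf (\<lambda>x. c)" by (simp add: Cinf_def Ck_const)
lemma Cinf_add: "Cinf f \<Longrightarrow> Cinf g \<Longrightarrow> Cinf (\<lambda>x. f x + g x)" by (simp add: Cinf_def Ck_add)
lemma Cinf_mult: "Cinf f \<Longrightarrow> Cinf g \<Longrightarrow> Cinf (\<lambda>x. f x * g x)"
  for f g :: "'a::euclidean_space \<Rightarrow> 'b::real_normed_algebra" by (simp add: Cinf_def Ck_mult)
lemma Cinf_bounded_linear: "bounded_linear l \<Longrightarrow> Cinf f \<Longrightarrow> Cinf (\<lambda>x. l (f x))"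
  by (simp add: Cinf_def Ck_bounded_linear)
lemma Cinf_linear: "bounded_linear l \<Longrightarrow> Cinf l" by (simp add: Cinf_def Ck_linear)
lemma Cinf_compose: "Cinf h \<Longrightarrow> Cinf s \<Longrightarrow> Cinf (\<lambda>x. h (s x))"
  for h :: "real \<Rightarrow> 'b::real_normed_vector" by (simp add: Cinf_def Ck_compose)
lemma Cinf_diff: "Cinf f \<Longrightarrow> Cinf g \<Longrightarrow> Cinf (\<lambda>x. f x - g x)"
  using Cinf_add[OF _ Cinf_bounded_linear[OF bounded_linear_minus[OF bounded_linear_ident]]] by simp
lemma Cinf_cmult: "Cinf f \<Longrightarrow> Cinf (\<lambda>x. c * f x)"
  for f :: "'a::euclidean_space \<Rightarrow> 'b::real_normed_algebra" by (intro Cinf_mult Cinf_const)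
lemma Cinf_of_real: "Cinf f \<Longrightarrow> Cinf (\<lambda>x. complex_of_real (f x))"
  by (rule Cinf_bounded_linear[OF bounded_linear_of_real])
lemma Cinf_power: "Cinf f \<Longrightarrow> Cinf (\<lambda>x. f x ^ n)"
  for f :: "'a::euclidean_space \<Rightarrow> 'b::real_normed_algebra_1"
  by (induction n) (auto intro: Cinf_const Cinf_mult)
lemma Cinf_prod: "(\<And>i. i \<in> I \<Longrightarrow> Cinf (f i)) \<Longrightarrow> Cinf (\<lambda>x. \<Prod>i\<in>I. f i x)"
  for f :: "'i \<Rightarrow> 'a::euclidean_space \<Rightarrow> real"
  by (induction I rule: infinite_finite_induct) (auto intro: Cinf_const Cinf_mult)
lemma Cinf_inner: "Cinf (\<lambda>x. x \<bullet> b)" by (intro Cinf_linear bounded_linear_inner_left)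
lemma Cinf_continuous: "Cinf f \<Longrightarrow> continuous_on S f"
  using Ck_continuous[OF CinfD[of f 0]] continuous_on_subset by blast
lemma Cinf_has_derivative: "Cinf f \<Longrightarrow> (f has_derivative frechet_derivative f (at x)) (at x)"
  using Ck_SucE(1)[OF CinfD] by blast
lemma Cinf_partial: "Cinf f \<Longrightarrow> b \<in> Basis \<Longrightarrow> Cinf (\<lambda>x. frechet_derivative f (at x) b)"
  using Ck_SucE(2)[OF CinfD[of f]] CinfI[of "\<lambda>x. frechet_derivative f (at x) b"] by blast
lemma partialI: "(f has_derivative f') (at x) \<Longrightarrow> frechet_derivative f (at x) b = f' b"
  using frechet_derivative_at by metis

lemma Cinf_real_deriv:
  fixes f :: "real \<Rightarrow> 'b::real_normed_vector"
  assumes "Cinf f"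
  obtains f' where "Cinf f'" "\<And>x. (f has_vector_derivative f' x) (at x)"
proof
  show "Cinf (\<lambda>x. frechet_derivative f (at x) 1)" using Cinf_partial[OF assms, of 1] by simp
  show "(f has_vector_derivative frechet_derivative f (at x) 1) (at x)" for x
  proof -
    have D: "(f has_derivative frechet_derivative f (at x)) (at x)" by (rule Cinf_has_derivative[OF assms])
    have "frechet_derivative f (at x) d = d *\<^sub>R frechet_derivative f (at x) 1" for d
      using linear_scale[OF bounded_linear.linear[OF has_derivative_bounded_linear[OF D]], of d 1] by simp
    then have "frechet_derivative f (at x) = (\<lambda>d. d *\<^sub>R frechet_derivative f (at x) 1)" by (rule ext)
    with D show ?thesis unfolding has_vector_derivative_def by metis
  qed
qed

lemma Ck_realI:
  fixes f :: "real \<Rightarrow> 'b::real_normed_vector"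
  assumes "\<And>x. (f has_vector_derivative f' x) (at x)" "Ck k f'"
  shows "Ck (Suc k) f"
  by (rule Ck_SucI[OF assms(1)[unfolded has_vector_derivative_def]]) (use assms(2) in simp)

lemma Cinf_realI:
  fixes f :: "real \<Rightarrow> 'b::real_normed_vector"
  assumes "\<And>x. (f has_vector_derivative f' x) (at x)" "Cinf f'"
  shows "Cinf f"
  using Ck_Suc_imp[OF Ck_realI[OF assms(1) CinfD[OF assms(2)]]] by (rule CinfI)

lemma exp_has_vector_derivative:
  "((\<lambda>t::real. exp (c * complex_of_real t)) has_vector_derivative c * exp (c * complex_of_real t)) (at t)"
  using has_vector_derivative_real_field[of "\<lambda>z. exp (c * z)" "c * exp (c * complex_of_real t)" t UNIV]
  by (force intro!: derivative_eq_intros)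

lemma Cinf_exp: "Cinf (\<lambda>t::real. exp (c * complex_of_real t))"
proof (rule CinfI)
  fix k show "Ck k (\<lambda>t::real. exp (c * complex_of_real t))"
  proof (induction k)
    case (Suc k)
    from Ck_realI[OF exp_has_vector_derivative Ck_mult[OF Ck_const Suc]] show ?case .
  qed (auto intro!: continuous_intros)
qed

lemma Cinf_powr:
  fixes f :: "real \<Rightarrow> real"
  assumes "Cinf f" "\<And>x. f x > 0"
  shows "Cinf (\<lambda>x. f x powr p)"
proof -
  obtain f' where f': "Cinf f'" "\<And>x. (f has_vector_derivative f' x) (at x)" using Cinf_real_deriv assms(1) by blast
  have "Ck k (\<lambda>x. f x powr p)" for k
  proof (induction k arbitrary: p)
    case 0
    have "f x \<noteq> 0" for x using assms(2)[of x] by linarith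
    then show ?case using Cinf_continuous[OF assms(1), of UNIV] by (simp add: continuous_on_powr)
  next
    case (Suc k)
    have "((\<lambda>x. f x powr p) has_vector_derivative (p * f' x) * f x powr (p - 1)) (at x)" for x
      using has_real_derivative_powr[OF assms(2)[of x], of p] f'(2)[of x]
      unfolding has_real_derivative_iff_has_vector_derivative[symmetric]
      by (auto dest: DERIV_chain2 simp: mult_ac)
    from Ck_realI[OF this Ck_mult[OF Ck_mult[OF Ck_const CinfD[OF f'(1)]] Suc]] show ?case .
  qed
  then show ?thesis by (rule CinfI)
qed

text \<open>
  The standard smooth function that is flat at zero; its dilated products over the coordinates
  serve as bump functions adapted to boxes.
\<close>

definition flat :: "real \<Rightarrow> real" where "flat x = (if x > 0 then exp (- (1 / x)) else 0)"

lemma flat_bounds: "0 \<le> flat x" "flat x \<le> 1" "flat x > 0 \<longleftrightarrow> x > 0" "x \<le> 0 \<Longrightarrow> flat x = 0"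
  unfolding flat_def by simp_all

lemma Cinf_flat: "Cinf flat"
proof -
  \<comment> \<open>This family is closed under differentiation up to linear combinations.\<close>
  define F where "F m x = (if x > 0 then (1 / x) ^ m * exp (- (1 / x)) else 0)" for m and x :: real
  have der: "(F m has_vector_derivative (F (m + 2) x + (- real m) * F (m + 1) x)) (at x)" for m x
  proof -
    consider "x > 0" | "x < 0" | "x = 0" by linarith
    then show ?thesis
    proof cases
      case 1
      have inv: "((\<lambda>x. 1 / x) has_real_derivative - ((1/x)^2)) (at x)"
        using 1 by (auto intro!: derivative_eq_intros simp: power2_eq_square)
      have D: "((\<lambda>x. (1 / x) ^ m * exp (- (1 / x))) has_real_derivative
          (1/x)^m * (exp (- (1/x)) * - (- ((1/x)^2))) + (real m * (- ((1/x)^2) * (1/x)^(m - Suc 0))) * exp (- (1/x))) (at x)"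
        by (intro DERIV_mult'[OF DERIV_power[OF inv]] DERIV_chain2[OF DERIV_exp DERIV_minus[OF inv]])
      have pw: "real m * (- (y^2) * y^(m - Suc 0)) = - real m * y^(m+1)" for y :: real
        by (cases m) (simp_all add: power2_eq_square algebra_simps)
      have "(1/x)^m * (exp (- (1/x)) * - (- ((1/x)^2))) + - real m * (1/x)^(m+1) * exp (- (1/x))
          = F (m + 2) x + (- real m) * F (m + 1) x"
        using 1 by (simp add: F_def power_add power2_eq_square)
      from D[unfolded pw this] have "(F m has_real_derivative (F (m + 2) x + (- real m) * F (m + 1) x)) (at x)"
        by (rule has_field_derivative_transform_within[where d=x]) (use 1 in \<open>simp_all add: F_def dist_real_def\<close>)
      then show ?thesis by (simp add: has_real_derivative_iff_has_vector_derivative)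
    next
      case 2
      have "((\<lambda>x. 0) has_real_derivative (F (m + 2) x + (- real m) * F (m + 1) x)) (at x)"
        using 2 by (simp add: F_def)
      then have "(F m has_real_derivative (F (m + 2) x + (- real m) * F (m + 1) x)) (at x)"
        by (rule has_field_derivative_transform_within[where d="-x"]) (use 2 in \<open>simp_all add: F_def dist_real_def\<close>)
      then show ?thesis by (simp add: has_real_derivative_iff_has_vector_derivative)
    next
      case 3
      have "((\<lambda>h. F m h / h) \<longlongrightarrow> 0) (at_right 0)"
      proof (rule Lim_transform_eventually)
        show "((\<lambda>h::real. inverse h ^ (m+1) / exp (inverse h)) \<longlongrightarrow> 0) (at_right 0)"
          by (rule filterlim_compose[OF tendsto_power_div_exp_0 filterlim_inverse_at_top_right])
        show "\<forall>\<^sub>F h in at_right 0. inverse h ^ (m+1) / exp (inverse h) = F m h / h"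
          unfolding eventually_at_right_field
          by (intro exI[of _ 1]) (simp add: F_def exp_minus divide_inverse)
      qed
      moreover have "((\<lambda>h. F m h / h) \<longlongrightarrow> 0) (at_left 0)"
        by (rule Lim_transform_eventually[of "\<lambda>_. 0"]) (simp_all add: F_def eventually_at_filter)
      ultimately have "((\<lambda>h. F m h / h) \<longlongrightarrow> 0) (at 0)"
        using filterlim_split_at by blast
      then have "(F m has_real_derivative (F (m + 2) x + (- real m) * F (m + 1) x)) (at x)"
        by (simp add: 3 F_def DERIV_def)
      then show ?thesis by (simp add: has_real_derivative_iff_has_vector_derivative)
    qed
  qed
  have "Ck k (F m)" for k m
  proof (induction k arbitrary: m)
    case 0
    have "isCont (F m) x" for x by (rule has_vector_derivative_continuous[OF der])
    then show ?case by (simp add: continuous_at_imp_continuous_on)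
  next
    case (Suc k)
    show ?case by (rule Ck_realI[OF der]) (intro Ck_add Ck_mult Ck_const Suc)
  qed
  moreover have "flat = F 0" by (auto simp: flat_def F_def)
  ultimately show ?thesis using CinfI[of "F 0"] by metis
qed

section \<open>Bump functions and the fundamental lemma\<close>

lemma test_functionI:
  assumes "Cinf \<phi>" "bounded {x. \<phi> x \<noteq> 0}" shows "test_function \<phi>"
  using assms by (simp add: test_function_def)

lemma test_function_Cinf: "test_function \<phi> \<Longrightarrow> Cinf \<phi>"
  by (simp add: test_function_def)

lemma test_function_bounded_support: "test_function \<phi> \<Longrightarrow> bounded {x. \<phi> x \<noteq> 0}"
  by (simp add: test_function_def)

abbreviation supp :: "('a::euclidean_space \<Rightarrow> complex) \<Rightarrow> 'a set" where
  "supp f \<equiv> closure {x. f x \<noteq> 0}"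

lemma partial_zero_outside:
  assumes "x \<notin> supp \<phi>" shows "frechet_derivative \<phi> (at x) b = 0"
proof -
  have "((\<lambda>x. 0) has_derivative (\<lambda>h. 0)) (at x)" by simp
  then have "(\<phi> has_derivative (\<lambda>h. 0)) (at x)"
    by (rule has_derivative_transform_within_open[of _ _ _ _ "- supp \<phi>"])
       (use assms closure_subset[of "{x. \<phi> x \<noteq> 0}"] in auto)
  then show ?thesis by (rule partialI)
qed

lemma supp_partial: "supp (\<lambda>x. frechet_derivative \<phi> (at x) b) \<subseteq> supp \<phi>"
  by (rule closure_minimal) (use partial_zero_outside in blast, simp)

lemma test_function_partial:
  assumes "test_function \<phi>" "b \<in> Basis"
  shows "test_function (\<lambda>x. frechet_derivative \<phi> (at x) b)"
proof (rule test_functionI)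
  show "Cinf (\<lambda>x. frechet_derivative \<phi> (at x) b)"
    using Cinf_partial assms test_function_Cinf by blast
  show "bounded {x. frechet_derivative \<phi> (at x) b \<noteq> 0}"
    using partial_zero_outside test_function_bounded_support[OF assms(1)]
    by (intro bounded_subset[of "supp \<phi>" "{x. frechet_derivative \<phi> (at x) b \<noteq> 0}"] bounded_closure) blast+
qed

lemma zero_outside_supp: "x \<notin> supp \<phi> \<Longrightarrow> \<phi> x = 0"
  using closure_subset[of "{x. \<phi> x \<noteq> 0}"] by blast

definition boxbump :: "'a::euclidean_space \<Rightarrow> 'a \<Rightarrow> nat \<Rightarrow> 'a \<Rightarrow> real" where
  "boxbump a b n x = (\<Prod>i\<in>Basis. flat (real n * ((x - a) \<bullet> i)) * flat (real n * ((b - x) \<bullet> i)))"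

lemma Cinf_boxbump: "Cinf (boxbump a b n)"
proof -
  have 1: "Cinf (\<lambda>x. real n * ((x - a) \<bullet> i))" "Cinf (\<lambda>x. real n * ((b - x) \<bullet> i))" for i
    unfolding inner_diff_left by (intro Cinf_cmult Cinf_diff Cinf_inner Cinf_const)+
  have "Cinf (\<lambda>x. \<Prod>i\<in>Basis. flat (real n * ((x - a) \<bullet> i)) * flat (real n * ((b - x) \<bullet> i)))"
    by (intro Cinf_prod Cinf_mult Cinf_compose[OF Cinf_flat] 1)
  then show ?thesis by (simp add: boxbump_def[abs_def])
qed

lemma boxbump_nonzero: "boxbump a b n x \<noteq> 0 \<Longrightarrow> x \<in> box a b"
proof -
  assume "boxbump a b n x \<noteq> 0"
  then have "flat (real n * ((x - a) \<bullet> i)) \<noteq> 0 \<and> flat (real n * ((b - x) \<bullet> i)) \<noteq> 0" if "i \<in> Basis" for i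
    using that by (auto simp: boxbump_def)
  then have "real n * ((x - a) \<bullet> i) > 0 \<and> real n * ((b - x) \<bullet> i) > 0" if "i \<in> Basis" for i
    using that flat_bounds(4) by (meson not_le)
  then show ?thesis by (auto simp: mem_box zero_less_mult_iff inner_diff_left)
qed

lemma boxbump_bounds: "0 \<le> boxbump a b n x" "boxbump a b n x \<le> 1"
proof -
  have "0 \<le> flat s * flat t \<and> flat s * flat t \<le> 1" for s t
    by (simp add: mult_le_one flat_bounds(1,2))
  then show "0 \<le> boxbump a b n x" "boxbump a b n x \<le> 1"
    unfolding boxbump_def by (simp_all add: prod_nonneg prod_le_1)
qed

lemma flat_tendsto: "c > 0 \<Longrightarrow> (\<lambda>n. flat (real n * c)) \<longlonglongrightarrow> 1"
proof -
  assume c: "c > 0"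
  have "(\<lambda>n. 1 / c * inverse (real n)) \<longlonglongrightarrow> 1 / c * 0"
    by (intro tendsto_mult tendsto_const lim_inverse_n)
  then have "(\<lambda>n. exp (- (1 / c * inverse (real n)))) \<longlonglongrightarrow> exp (- (1 / c * 0))"
    by (intro tendsto_exp tendsto_minus)
  moreover have "\<forall>\<^sub>F n in sequentially. exp (- (1 / c * inverse (real n))) = flat (real n * c)"
    using eventually_gt_at_top[of 0]
    by eventually_elim (use c in \<open>simp add: flat_def field_simps\<close>)
  ultimately show ?thesis by (auto intro: Lim_transform_eventually)
qed

text \<open>
  Together with the uniform bound this recovers integrals over boxes by dominated convergence.
\<close>

lemma boxbump_tendsto: "(\<lambda>n. boxbump a b n x) \<longlonglongrightarrow> indicator (box a b) x"
proof (cases "x \<in> box a b")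
  case True
  then have "(x - a) \<bullet> i > 0" "(b - x) \<bullet> i > 0" if "i \<in> Basis" for i
    using that by (auto simp: mem_box inner_diff_left)
  then have "(\<lambda>n. \<Prod>i\<in>Basis. flat (real n * ((x - a) \<bullet> i)) * flat (real n * ((b - x) \<bullet> i))) \<longlonglongrightarrow> (\<Prod>i\<in>(Basis::'a set). 1 * 1)"
    by (intro tendsto_prod tendsto_mult flat_tendsto)
  then show ?thesis using True by (simp add: boxbump_def[abs_def])
next
  case False
  then have "boxbump a b n x = 0" for n using boxbump_nonzero by blast
  then show ?thesis using False by simp
qed

abbreviation cboxbump where "cboxbump a b n x \<equiv> complex_of_real (boxbump a b n x)"

lemma supp_cboxbump: "supp (cboxbump a b n) \<subseteq> cbox a b"
proof (rule closure_minimal[OF _ closed_cbox])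
  show "{x. cboxbump a b n x \<noteq> 0} \<subseteq> cbox a b"
    using boxbump_nonzero[of a b n] box_subset_cbox[of a b] by auto
qed

lemma test_function_cboxbump: "test_function (cboxbump a b n)"
proof (rule test_functionI[OF Cinf_of_real[OF Cinf_boxbump]])
  show "bounded {x. cboxbump a b n x \<noteq> 0}"
    by (rule bounded_subset[OF bounded_box[of a b]]) (use boxbump_nonzero[of a b n] in auto)
qed

definition L1_loc :: "('a::euclidean_space \<Rightarrow> complex) \<Rightarrow> bool" where
  "L1_loc f \<longleftrightarrow> f \<in> borel_measurable lebesgue \<and> (\<forall>K. compact K \<longrightarrow> set_integrable lebesgue K f)"

lemma L2_loc_imp_L1_loc:
  assumes "L2_loc f" shows "L1_loc f"
  unfolding L1_loc_def
proof (intro conjI allI impI)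
  show m: "f \<in> borel_measurable lebesgue" using assms by (simp add: L2_loc_def)
  fix K :: "'a set" assume K: "compact K"
  then have Km: "K \<in> lmeasurable" by (rule lmeasurable_compact)
  have "set_integrable lebesgue K (\<lambda>x. 1 + (cmod (f x))\<^sup>2)"
    using assms K Km by (intro set_integral_add(1)) (auto simp: L2_loc_def set_integrable_def fmeasurable_def intro!: integrable_real_indicator)
  then show "set_integrable lebesgue K f"
    unfolding set_integrable_def
  proof (rule Bochner_Integration.integrable_bound)
    show "(\<lambda>x. indicat_real K x *\<^sub>R f x) \<in> borel_measurable lebesgue"
      using m Km by (intro borel_measurable_scaleR borel_measurable_indicator) auto
    have "t \<le> 1 + t\<^sup>2" for t :: real
      using zero_le_power2[of "t - 1"] by (simp add: power2_eq_square algebra_simps) (smt (verit) zero_le_square)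
    then show "AE x in lebesgue. norm (indicat_real K x *\<^sub>R f x) \<le> norm (indicat_real K x *\<^sub>R (1 + (cmod (f x))\<^sup>2))"
      by (intro AE_I2) (auto simp: indicator_def intro: order_trans[OF _ abs_ge_self])
  qed
qed

lemma L1_loc_mult_integrable:
  assumes "L1_loc f" "g \<in> borel_measurable lebesgue" "bounded S" "\<And>x. x \<notin> S \<Longrightarrow> g x = 0"
    "\<And>x. x \<in> S \<Longrightarrow> norm (g x) \<le> C"
  shows "integrable lebesgue (\<lambda>x. f x * g x)"
proof -
  have K: "compact (closure S)" using assms(3) by simp
  have "integrable lebesgue (\<lambda>x. C *\<^sub>R (indicat_real (closure S) x *\<^sub>R f x))"
    using assms(1) K by (intro integrable_scaleR_right) (auto simp: L1_loc_def set_integrable_def)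
  then show ?thesis
  proof (rule Bochner_Integration.integrable_bound)
    show "(\<lambda>x. f x * g x) \<in> borel_measurable lebesgue"
      using assms(1,2) by (intro borel_measurable_times) (auto simp: L1_loc_def)
    show "AE x in lebesgue. norm (f x * g x) \<le> norm (C *\<^sub>R (indicat_real (closure S) x *\<^sub>R f x))"
    proof (intro AE_I2)
      fix x show "norm (f x * g x) \<le> norm (C *\<^sub>R (indicat_real (closure S) x *\<^sub>R f x))"
      proof (cases "x \<in> S")
        case True
        then have "norm (f x) * norm (g x) \<le> norm (f x) * \<bar>C\<bar>"
          using assms(5)[of x] by (intro mult_left_mono) auto
        then show ?thesis using True closure_subset[of S] by (auto simp: norm_mult mult.commute indicator_def)
      qed (simp add: assms(4))
    qed
  qed
qed

lemma continuous_lebesgue_measurable: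
  "continuous_on UNIV f \<Longrightarrow> f \<in> borel_measurable lebesgue" for f :: "'a::euclidean_space \<Rightarrow> 'b::real_normed_vector"
  using measurable_completion[of f lborel borel] borel_measurable_continuous_onI[of f]
    by simp

lemma L1_loc_mult_test:
  assumes "L1_loc f" "test_function \<phi>" shows "integrable lebesgue (\<lambda>x. f x * \<phi> x)"
proof -
  have c: "continuous_on S \<phi>" for S using assms(2) Cinf_continuous test_function_Cinf by blast
  have "compact (\<phi> ` supp \<phi>)" using assms(2) by (intro compact_continuous_image c) (simp add: test_function_def)
  then obtain C where "\<forall>y\<in>\<phi> ` supp \<phi>. norm y \<le> C" using compact_imp_bounded bounded_iff by blast
  then have C: "\<And>x. x \<in> supp \<phi> \<Longrightarrow> norm (\<phi> x) \<le> C" by blast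
  show ?thesis
  proof (rule L1_loc_mult_integrable[OF assms(1)])
    show "\<phi> \<in> borel_measurable lebesgue" by (rule continuous_lebesgue_measurable[OF c])
    show "bounded (supp \<phi>)" using assms(2) compact_imp_bounded by (auto simp: test_function_def)
    show "norm (\<phi> x) \<le> C" if "x \<in> supp \<phi>" for x using C that .
  qed (rule zero_outside_supp)
qed

lemma sigma_finite_lebesgue: "sigma_finite_measure (lebesgue :: 'a::euclidean_space measure)"
proof
  let ?A = "range (\<lambda>n::nat. cball (0::'a) (real n))"
  have "(\<Union>?A) = UNIV"
  proof -
    have "\<exists>n. x \<in> cball 0 (real n)" for x :: 'a using real_arch_simple[of "norm x"] by simp
    then show ?thesis by blast
  qed
  moreover have "emeasure lebesgue a \<noteq> \<infinity>" if "a \<in> ?A" for a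
  proof -
    have "emeasure lebesgue (cball (0::'a) r) \<noteq> \<infinity>" for r
      using fmeasurableD2[OF lmeasurable_cball] unfolding infinity_ennreal_def .
    then show ?thesis using that by blast
  qed
  moreover have "?A \<subseteq> sets lebesgue" using fmeasurableD[OF lmeasurable_cball] by blast
  ultimately show "\<exists>A. countable A \<and> A \<subseteq> sets lebesgue \<and> \<Union>A = space (lebesgue :: 'a measure) \<and> (\<forall>a\<in>A. emeasure lebesgue a \<noteq> \<infinity>)"
    using countable_image[of "UNIV :: nat set" "\<lambda>n. cball (0::'a) (real n)"]
    by (intro exI[of _ ?A] conjI ballI) (simp_all only: space_completion space_lborel space_borel countableI_type not_False_eq_True)
qed

text \<open>
  Boxes generate the Borel sets and are stable under intersection, so a function with vanishing box
  integrals has vanishing integral over every measurable set.  The support in a box is what makes the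
  total integral one of the box integrals, as the passage to complements requires.
\<close>

lemma integrable_zero_box_integrals:
  fixes F :: "'a::euclidean_space \<Rightarrow> complex"
  assumes F: "integrable lebesgue F" and zero: "\<And>x. x \<notin> box a b \<Longrightarrow> F x = 0"
    and box: "\<And>c d. (LINT x:box c d|lebesgue. F x) = 0"
  shows "AE x in lebesgue. F x = 0"
proof -
  interpret L: sigma_finite_measure "lebesgue :: 'a measure" by (rule sigma_finite_lebesgue)
  show ?thesis
  proof (rule L.density_zero[OF F])
  have int: "set_integrable lebesgue A F" if "A \<in> sets lebesgue" for A
    unfolding set_integrable_def using integrable_mult_indicator[OF that F] .
  have all: "(LINT x|lebesgue. F x) = 0"
  proof -
    have "(LINT x|lebesgue. F x) = (LINT x:box a b|lebesgue. F x)"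
      unfolding set_lebesgue_integral_def by (intro Bochner_Integration.integral_cong) (use zero in \<open>simp add: indicator_def\<close>)+
    then show ?thesis using box by metis
  qed
  have borel: "(LINT x:A|lebesgue. F x) = 0" if "A \<in> sets borel" for A
  proof -
    let ?G = "range (\<lambda>(c, d). box c d) :: 'a set set"
    have stab: "Int_stable ?G"
    proof (rule Int_stableI)
      have boxin: "box p q \<in> ?G" for p q by (rule range_eqI[of _ _ "(p, q)"]) simp
      fix X Y assume "X \<in> ?G" "Y \<in> ?G"
      then obtain p q p' q' where "X = box p q" "Y = box p' q'" by fast
      then show "X \<inter> Y \<in> ?G" using boxin by (simp only: box_Int_box)
    qed
    have sub: "?G \<subseteq> Pow UNIV" by simp
    have sig: "sigma_sets UNIV ?G = sets borel" unfolding borel_eq_box by simp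
    have "A \<in> sigma_sets UNIV ?G" using that sig by simp
    from stab sub this show ?thesis
    proof (induction rule: sigma_sets_induct_disjoint)
      case (basic A) then show ?case using box by auto
    next
      case empty show ?case by (simp add: set_lebesgue_integral_def)
    next
      case (compl A)
      then have "A \<in> sets lebesgue" using sig by auto
      have "(LINT x:UNIV - A|lebesgue. F x) = (LINT x|lebesgue. F x - indicat_real A x *\<^sub>R F x)"
        unfolding set_lebesgue_integral_def by (intro Bochner_Integration.integral_cong) (auto simp: indicator_def)
      also have "\<dots> = (LINT x|lebesgue. F x) - (LINT x:A|lebesgue. F x)"
        unfolding set_lebesgue_integral_def
        by (intro Bochner_Integration.integral_diff F int[unfolded set_integrable_def] \<open>A \<in> sets lebesgue\<close>)
      finally show ?case using all compl by simp
    next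
      case (union A)
      have "A i \<in> sets lebesgue" for i using union(2) sig by auto
      then have "(LINT x:(\<Union>i. A i)|lebesgue. F x) = (\<Sum>i. (LINT x:A i|lebesgue. F x))"
        using union(1) by (intro lebesgue_integral_countable_add int) (auto simp: disjoint_family_on_def)
      then show ?case using union(3) by simp
    qed
  qed
  fix A :: "'a set" assume "A \<in> sets lebesgue"
  then obtain S N N' where A: "A = S \<union> N" "N \<subseteq> N'" "N' \<in> null_sets lborel" "S \<in> sets lborel"
    by (elim sets_completionE)
  then have "AE x in lebesgue. x \<notin> N'" using AE_completion[OF AE_not_in] by blast
  then have "(LINT x:A|lebesgue. F x) = (LINT x:S|lebesgue. F x)"
    unfolding set_lebesgue_integral_def
    using F \<open>A \<in> sets lebesgue\<close> A
    by (intro integral_cong_AE borel_measurable_scaleR borel_measurable_indicator) (auto simp: indicator_def)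
  then show "(LINT x:A|lebesgue. F x) = 0" using borel A(4) by simp
  qed
qed

text \<open>
  The fundamental lemma of the calculus of variations.  Only box bumps are used as test functions;
  on a product space these are products of bumps in the factors.
\<close>

lemma fundamental_lemma_bump:
  fixes f :: "'a::euclidean_space \<Rightarrow> complex"
  assumes f: "L1_loc f" and W: "open W"
    and zero: "\<And>a b n. cbox a b \<subseteq> W \<Longrightarrow> (LINT x|lebesgue. f x * cboxbump a b n x) = 0"
  shows "AE x in lebesgue. x \<in> W \<longrightarrow> f x = 0"
proof -
  have fm: "f \<in> borel_measurable lebesgue" using f by (simp add: L1_loc_def)
  have fi: "integrable lebesgue (\<lambda>x. indicat_real (cbox a b) x *\<^sub>R f x)" for a b
    using f by (auto simp: L1_loc_def set_integrable_def)
  have fib: "integrable lebesgue (\<lambda>x. indicat_real (box a b) x *\<^sub>R f x)" for a b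
  proof (rule Bochner_Integration.integrable_bound[OF fi[of a b]])
    show "(\<lambda>x. indicat_real (box a b) x *\<^sub>R f x) \<in> borel_measurable lebesgue"
      by (intro borel_measurable_scaleR borel_measurable_indicator fm) simp
    show "AE x in lebesgue. norm (indicat_real (box a b) x *\<^sub>R f x) \<le> norm (indicat_real (cbox a b) x *\<^sub>R f x)"
      using box_subset_cbox[of a b] by (intro AE_I2) (auto simp: indicator_def)
  qed
  have step1: "(LINT x:box a b|lebesgue. f x) = 0" if "cbox a b \<subseteq> W" for a b
  proof -
    have "(\<lambda>n. LINT x|lebesgue. f x * cboxbump a b n x) \<longlonglongrightarrow> (LINT x:box a b|lebesgue. f x)"
      unfolding set_lebesgue_integral_def
    proof (rule integral_dominated_convergence)
      show "(\<lambda>x. indicat_real (box a b) x *\<^sub>R f x) \<in> borel_measurable lebesgue" using fib by auto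
      show "(\<lambda>x. f x * cboxbump a b n x) \<in> borel_measurable lebesgue" for n
        using L1_loc_mult_test[OF f test_function_cboxbump] by auto
      show "integrable lebesgue (\<lambda>x. norm (indicat_real (box a b) x *\<^sub>R f x))" using fib by (rule integrable_norm)
      have "(\<lambda>n. f x * cboxbump a b n x) \<longlonglongrightarrow> f x * complex_of_real (indicator (box a b) x)" for x
        by (intro tendsto_mult tendsto_const tendsto_of_real boxbump_tendsto)
      moreover have "f x * complex_of_real (indicator (box a b) x) = indicat_real (box a b) x *\<^sub>R f x" for x
        by (simp add: indicator_def)
      ultimately show "AE x in lebesgue. (\<lambda>n. f x * cboxbump a b n x) \<longlonglongrightarrow> indicat_real (box a b) x *\<^sub>R f x" by simp
      have "norm (f x * cboxbump a b n x) \<le> norm (indicat_real (box a b) x *\<^sub>R f x)" for n x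
        using boxbump_bounds[of a b n x] boxbump_nonzero[of a b n x]
        by (cases "boxbump a b n x = 0") (simp_all add: norm_mult mult_left_le)
      then show "AE x in lebesgue. norm (f x * cboxbump a b n x) \<le> norm (indicat_real (box a b) x *\<^sub>R f x)" for n by simp
    qed
    then show ?thesis using zero[OF that] by (simp add: LIMSEQ_const_iff)
  qed
  have step2: "AE x in lebesgue. indicat_real (box a b) x *\<^sub>R f x = 0" if ab: "cbox a b \<subseteq> W" for a b
  proof (rule integrable_zero_box_integrals[where a=a and b=b, OF fib])
    show "(LINT x:box c d|lebesgue. indicat_real (box a b) x *\<^sub>R f x) = 0" for c d
    proof -
      obtain p q where pq: "box p q = box a b \<inter> box c d" "cbox p q = cbox a b \<inter> cbox c d"
        using box_Int_box[of a b c d] Int_interval[of a b c d] by blast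
      have "(LINT x:box c d|lebesgue. indicat_real (box a b) x *\<^sub>R f x) = (LINT x:box p q|lebesgue. f x)"
        unfolding set_lebesgue_integral_def pq
        by (intro Bochner_Integration.integral_cong) (auto simp: indicator_def)
      then show ?thesis using step1[of p q] pq(2) ab by auto
    qed
  qed (simp add: indicator_def)
  obtain D where D: "countable D" "W = \<Union>D" "\<And>X. X \<in> D \<Longrightarrow> \<exists>a b. X = box a b \<and> cbox a b \<subseteq> W"
  proof -
    let ?F = "{box a b | a b. cbox a b \<subseteq> W}"
    obtain D where D: "D \<subseteq> ?F" "countable D" "\<Union>D = \<Union>?F"
    proof (rule Lindelof[of ?F])
      show "open S" if "S \<in> ?F" for S using that open_box by fast
    qed
    have "x \<in> \<Union>?F" if x: "x \<in> W" for x
    proof -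
      obtain a b where "cbox a b \<subseteq> W" "x \<in> box a b" using W x open_contains_cbox by metis
      then show ?thesis by blast
    qed
    moreover have "\<Union>?F \<subseteq> W" using box_subset_cbox by fast
    ultimately have "W = \<Union>D" using D(3) by auto
    then show ?thesis using D(1,2) that by blast
  qed
  have "AE x in lebesgue. \<forall>X\<in>D. x \<in> X \<longrightarrow> f x = 0"
  proof (subst AE_ball_countable[OF D(1)], intro ballI)
    fix X assume "X \<in> D"
    then obtain a b where "X = box a b" "cbox a b \<subseteq> W" using D(3) by blast
    with step2[of a b] show "AE x in lebesgue. x \<in> X \<longrightarrow> f x = 0"
      by (auto elim!: eventually_mono simp: indicator_def split: if_splits)
  qed
  then show ?thesis by (rule eventually_mono) (use D(2) in blast)
qed

section \<open>The radial equation\<close>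

lemma Cinf_antiderivative:
  fixes f :: "real \<Rightarrow> complex"
  assumes f: "Cinf f" and zero: "\<And>s. s \<ge> R \<Longrightarrow> f s = 0"
  obtains F where "Cinf F" "\<And>s. (F has_vector_derivative f s) (at s)" "\<And>s. s \<ge> R \<Longrightarrow> F s = 0"
proof -
  have "isCont f x" for x using Cinf_continuous[OF f, of UNIV] by (simp add: continuous_on_eq_continuous_at)
  then obtain F0 where F0: "\<And>x. (F0 has_vector_derivative f x) (at x)"
    using einterval_antiderivative[of "-\<infinity>" "\<infinity>" f] by auto
  define F where "F s = F0 s - F0 R" for s
  have F: "(F has_vector_derivative f s) (at s)" for s
    unfolding F_def using has_vector_derivative_diff[OF F0 has_vector_derivative_const] by simp
  have "F s = 0" if "s \<ge> R" for s
  proof -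
    have "(F has_vector_derivative 0) (at x within {R..})" if "x \<in> {R..}" for x
      using F[of x] zero[of x] that by (auto intro: has_vector_derivative_at_within)
    then obtain c where "\<And>x. x \<in> {R..} \<Longrightarrow> F x = c"
      using has_vector_derivative_zero_constant[of "{R..}" F] by blast
    then show ?thesis using that F_def by (metis atLeast_iff diff_self order_refl)
  qed
  then show ?thesis using that Cinf_realI[OF F f] F by blast
qed

lemma first_order_ode:
  fixes f :: "real \<Rightarrow> complex"
  assumes f: "Cinf f" and zero: "\<And>s. s \<ge> R \<Longrightarrow> f s = 0"
  obtains y where "Cinf y" "\<And>s. (y has_vector_derivative (c * y s + f s)) (at s)" "\<And>s. s \<ge> R \<Longrightarrow> y s = 0"
proof -
  obtain A where A: "Cinf A" "\<And>s. (A has_vector_derivative exp (- c * complex_of_real s) * f s) (at s)" "\<And>s. s \<ge> R \<Longrightarrow> A s = 0"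
    by (rule Cinf_antiderivative[OF Cinf_mult[OF Cinf_exp[of "- c"] f], of R]) (use zero in auto)
  define y where "y s = exp (c * complex_of_real s) * A s" for s
  note e = exp_has_vector_derivative[of c]
  have "(y has_vector_derivative (c * y s + f s)) (at s)" for s
    using has_vector_derivative_mult[OF e A(2), of s]
    by (simp add: y_def[abs_def] exp_minus field_simps)
  moreover have "Cinf y" unfolding y_def[abs_def] by (rule Cinf_mult[OF Cinf_exp A(1)])
  ultimately show ?thesis using that[of y] A(3) by (simp add: y_def)
qed

text \<open>
  Factor \<open>D\<^sup>2 + \<lambda> = (D - c) (D + c)\<close> with \<open>c\<^sup>2 = - \<lambda>\<close> and solve two first-order equations, always
  choosing the solution that vanishes to the right of the support of the right-hand side.
\<close>

lemma second_order_ode: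
  fixes f :: "real \<Rightarrow> complex"
  assumes f: "Cinf f" and zero: "\<And>s. s \<ge> R \<Longrightarrow> f s = 0"
  obtains y y' where "Cinf y" "Cinf y'" "\<And>s. (y has_vector_derivative y' s) (at s)"
    "\<And>s. (y' has_vector_derivative (f s - lam * y s)) (at s)" "\<And>s. s \<ge> R \<Longrightarrow> y s = 0"
proof -
  define c where "c = csqrt (- lam)"
  have c2: "c * c = - lam" using power2_csqrt[of "- lam"] by (simp add: c_def power2_eq_square)
  obtain z where z: "Cinf z" "\<And>s. (z has_vector_derivative (c * z s + f s)) (at s)" "\<And>s. s \<ge> R \<Longrightarrow> z s = 0"
    using first_order_ode[where c=c and R=R, OF f zero] by blast
  obtain y where y: "Cinf y" "\<And>s. (y has_vector_derivative (- c * y s + z s)) (at s)" "\<And>s. s \<ge> R \<Longrightarrow> y s = 0"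
    using first_order_ode[where c="- c" and R=R, OF z(1) z(3)] by blast
  have "((\<lambda>s. - c * y s + z s) has_vector_derivative (- c * (- c * y s + z s) + (c * z s + f s))) (at s)" for s
    by (intro has_vector_derivative_add has_vector_derivative_mult_right y(2) z(2))
  moreover have "- c * (- c * y s + z s) + (c * z s + f s) = f s - lam * y s" for s
  proof -
    have "lam = - (c * c)" using c2 by simp
    then show ?thesis by (simp add: algebra_simps)
  qed
  ultimately have "((\<lambda>s. - c * y s + z s) has_vector_derivative (f s - lam * y s)) (at s)" for s by (simp only:)
  then show ?thesis using that[OF y(1) Cinf_add[OF Cinf_cmult[OF y(1)] z(1)] y(2) _ y(3)] by blast
qed

text \<open>
  A globally smooth function that agrees with the square root away from zero allows changing between
  \<open>s = r\<^sup>2\<close> and \<open>r\<close> without leaving the class of functions that are smooth on the whole line.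
\<close>

lemma smooth_sqrt:
  assumes "a > 0"
  obtains \<sigma> :: "real \<Rightarrow> real" where "Cinf \<sigma>" "\<And>s. s \<ge> a \<Longrightarrow> \<sigma> s = sqrt s"
proof -
  \<comment> \<open>A smooth positive function equal to \<open>s\<close> for \<open>s \<ge> a\<close>: the correction vanishes there, and for
    \<open>s \<le> 0\<close> it is at least \<open>1 + s\<^sup>2\<close>.\<close>
  define \<tau> where "\<tau> s = s + (1 + s^2) * (flat (1 * a - 1 * s) * (1 / flat a))" for s :: real
  have "Cinf \<tau>"
    unfolding \<tau>_def[abs_def]
    by (intro Cinf_add Cinf_mult Cinf_const Cinf_power Cinf_compose[OF Cinf_flat] Cinf_diff Cinf_linear bounded_linear_ident)
  have "flat a > 0" using assms flat_bounds(3) by simp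
  have pos: "\<tau> s > 0" for s
  proof (cases "s > 0")
    case True
    then show ?thesis unfolding \<tau>_def using flat_bounds(1) \<open>flat a > 0\<close>
      by (intro add_pos_nonneg mult_nonneg_nonneg) (auto simp: less_imp_le)
  next
    case False
    have "flat (a - s) \<ge> flat a"
      using False assms by (simp add: flat_def frac_le)
    then have "flat (a - s) * (1 / flat a) \<ge> 1" using \<open>flat a > 0\<close> by (simp add: field_simps)
    then have "(1 + s^2) * 1 \<le> (1 + s^2) * (flat (a - s) * (1 / flat a))"
      by (intro mult_left_mono) auto
    moreover have "s + (1 + s^2) > 0"
      using zero_le_power2[of "s + 1/2"] by (simp add: power2_eq_square algebra_simps)
    ultimately show ?thesis unfolding \<tau>_def by simp
  qed
  have "Cinf (\<lambda>s. \<tau> s powr (1/2))" by (rule Cinf_powr[OF \<open>Cinf \<tau>\<close> pos])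
  moreover have "\<tau> s powr (1/2) = sqrt s" if "s \<ge> a" for s
    using that assms flat_bounds(4)[of "a - s"] by (simp add: \<tau>_def powr_half_sqrt)
  ultimately show ?thesis using that by blast
qed

text \<open>
  With \<open>s = r\<^sup>2\<close> the operator \<open>4 s d\<^sup>2/ds\<^sup>2 + 2 d/ds\<close> becomes \<open>d\<^sup>2/dr\<^sup>2\<close>.
\<close>

lemma radial_ode_base:
  fixes g :: "real \<Rightarrow> complex"
  assumes a: "0 < a" "a \<le> S" and g: "Cinf g" and zero: "\<And>s. s \<ge> S \<Longrightarrow> g s = 0"
  obtains h h' h'' where "Cinf h" "Cinf h'" "Cinf h''" "\<And>s. (h has_vector_derivative h' s) (at s)"
    "\<And>s. (h' has_vector_derivative h'' s) (at s)" "\<And>s. s \<ge> S \<Longrightarrow> h s = 0"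
    "\<And>s. s > a \<Longrightarrow> complex_of_real (4 * s) * h'' s + 2 * h' s + lam * h s = g s"
proof -
  obtain \<sigma> where \<sigma>: "Cinf \<sigma>" "\<And>s. s \<ge> a \<Longrightarrow> \<sigma> s = sqrt s" using smooth_sqrt a(1) by blast
  have g2: "Cinf (\<lambda>r. g (r^2))"
    by (intro Cinf_compose[OF g] Cinf_power Cinf_linear bounded_linear_ident)
  have "g (r^2) = 0" if "r \<ge> sqrt S" for r
    using that a zero real_le_lsqrt by (smt (verit) real_sqrt_ge_zero real_sqrt_le_iff real_sqrt_unique)
  then obtain y y' where y: "Cinf y" "Cinf y'" "\<And>s. (y has_vector_derivative y' s) (at s)"
    "\<And>s. (y' has_vector_derivative (g (s^2) - lam * y s)) (at s)" "\<And>s. s \<ge> sqrt S \<Longrightarrow> y s = 0"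
    using second_order_ode[OF g2, of "sqrt S"] by metis
  define h where "h s = y (\<sigma> s)" for s
  have h: "Cinf h" unfolding h_def[abs_def] by (rule Cinf_compose[OF y(1) \<sigma>(1)])
  obtain h' where h': "Cinf h'" "\<And>s. (h has_vector_derivative h' s) (at s)" using Cinf_real_deriv[OF h] by blast
  obtain h'' where h'': "Cinf h''" "\<And>s. (h' has_vector_derivative h'' s) (at s)" using Cinf_real_deriv[OF h'(1)] by blast
  have sq: "(sqrt has_real_derivative inverse (sqrt s) / 2) (at s)" if "s > a" for s
    using DERIV_real_sqrt[of s] that a by simp
  have e1: "h' s = (inverse (sqrt s) / 2) *\<^sub>R y' (sqrt s)" if s: "s > a" for s
  proof -
    have "((y \<circ> sqrt) has_vector_derivative (inverse (sqrt s) / 2) *\<^sub>R y' (sqrt s)) (at s)"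
      using vector_diff_chain_at[OF _ y(3)] sq[OF s] unfolding has_real_derivative_iff_has_vector_derivative by blast
    then have "(h has_vector_derivative (inverse (sqrt s) / 2) *\<^sub>R y' (sqrt s)) (at s)"
      by (rule has_vector_derivative_transform_within_open[of _ _ _ "{a<..}"]) (use s \<sigma>(2) in \<open>auto simp: h_def\<close>)
    then show ?thesis using h'(2) vector_derivative_unique_at by blast
  qed
  have e2: "h'' s = (inverse (sqrt s) / 2) *\<^sub>R ((inverse (sqrt s) / 2) *\<^sub>R (g s - lam * h s))
       + (- (inverse (sqrt s) / (4 * s))) *\<^sub>R y' (sqrt s)" if s: "s > a" for s
  proof -
    have "((y' \<circ> sqrt) has_vector_derivative (inverse (sqrt s) / 2) *\<^sub>R (g ((sqrt s)^2) - lam * y (sqrt s))) (at s)"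
      using vector_diff_chain_at[OF _ y(4)] sq[OF s] unfolding has_real_derivative_iff_has_vector_derivative by blast
    moreover have "g ((sqrt s)^2) - lam * y (sqrt s) = g s - lam * h s"
      using s a \<sigma>(2)[of s] by (simp add: h_def)
    ultimately have 1: "((\<lambda>x. y' (sqrt x)) has_vector_derivative (inverse (sqrt s) / 2) *\<^sub>R (g s - lam * h s)) (at s)"
      by (simp add: o_def)
    have "((\<lambda>s. inverse (sqrt s) / 2) has_real_derivative - (inverse (sqrt s) * (inverse (sqrt s) / 2) * inverse (sqrt s)) / 2) (at s)"
      by (intro DERIV_cdivide DERIV_inverse' sq s) (use s a in auto)
    also have "- (inverse (sqrt s) * (inverse (sqrt s) / 2) * inverse (sqrt s)) / 2 = - (inverse (sqrt s) / (4 * s))"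
      using s a real_sqrt_mult_self[of s] by (simp add: field_simps)
    finally have 2: "((\<lambda>s. inverse (sqrt s) / 2) has_real_derivative - (inverse (sqrt s) / (4 * s))) (at s)" .
    from has_vector_derivative_scaleR[OF 2 1]
    have "(h' has_vector_derivative (inverse (sqrt s) / 2) *\<^sub>R ((inverse (sqrt s) / 2) *\<^sub>R (g s - lam * h s))
       + (- (inverse (sqrt s) / (4 * s))) *\<^sub>R y' (sqrt s)) (at s)"
      by (rule has_vector_derivative_transform_within_open[of _ _ _ "{a<..}"]) (use s e1 in auto)
    then show ?thesis using h''(2) vector_derivative_unique_at by blast
  qed
  show ?thesis
  proof (rule that[OF h h'(1) h''(1) h'(2) h''(2)])
    show "h s = 0" if "s \<ge> S" for s
      using that y(5) \<sigma>(2)[of s] a by (simp add: h_def)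
    show "complex_of_real (4 * s) * h'' s + 2 * h' s + lam * h s = g s" if s: "s > a" for s
    proof -
      define q where "q = complex_of_real (sqrt s)"
      have q: "q \<noteq> 0" "complex_of_real s = q * q"
        using s a by (simp_all add: q_def flip: of_real_mult)
      show ?thesis
        unfolding e1[OF s] e2[OF s] scaleR_conv_of_real using q
        by (simp add: q_def[symmetric] field_simps) 
    qed
  qed
qed

text \<open>
  Differentiating \<open>4 s H'' + (2 + 4 j) H' + \<lambda> H = G\<close> gives the same equation for \<open>H'\<close> with
  \<open>j + 1\<close> in place of \<open>j\<close> and \<open>G'\<close> in place of \<open>G\<close>.  So the case \<open>j + 1\<close> with right-hand side
  \<open>g\<close> reduces to the case \<open>j\<close> with an antiderivative of \<open>g\<close>.
\<close>

lemma radial_ode: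
  fixes g :: "real \<Rightarrow> complex"
  assumes a: "0 < a" "a \<le> S" and g: "Cinf g" and zero: "\<And>s. s \<ge> S \<Longrightarrow> g s = 0"
  shows "\<exists>h h' h''. Cinf h \<and> Cinf h' \<and> Cinf h'' \<and> (\<forall>s. (h has_vector_derivative h' s) (at s)) \<and>
    (\<forall>s. (h' has_vector_derivative h'' s) (at s)) \<and> (\<forall>s\<ge>S. h s = 0) \<and>
    (\<forall>s>a. complex_of_real (4 * s) * h'' s + complex_of_real (2 + 4 * real j) * h' s + lam * h s = g s)"
  using g zero
proof (induction j arbitrary: g)
  case 0
  obtain h h' h'' where "Cinf h" "Cinf h'" "Cinf h''" "\<And>s. (h has_vector_derivative h' s) (at s)"
    "\<And>s. (h' has_vector_derivative h'' s) (at s)" "\<And>s. s \<ge> S \<Longrightarrow> h s = 0"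
    "\<And>s. s > a \<Longrightarrow> complex_of_real (4 * s) * h'' s + 2 * h' s + lam * h s = g s"
    using radial_ode_base[where lam=lam, OF a 0(1) 0(2)] by blast
  then show ?case by (intro exI[of _ h] exI[of _ h'] exI[of _ h'']) simp
next
  case (Suc j)
  obtain G where G: "Cinf G" "\<And>s. (G has_vector_derivative g s) (at s)" "\<And>s. s \<ge> S \<Longrightarrow> G s = 0"
    using Cinf_antiderivative[OF Suc.prems] by blast
  from Suc.IH[OF G(1,3)] obtain H h h' where H: "Cinf H" "Cinf h" "Cinf h'" 
    "\<And>s. (H has_vector_derivative h s) (at s)" "\<And>s. (h has_vector_derivative h' s) (at s)" "\<And>s. s \<ge> S \<Longrightarrow> H s = 0"
    "\<And>s. s > a \<Longrightarrow> complex_of_real (4 * s) * h' s + complex_of_real (2 + 4 * real j) * h s + lam * H s = G s"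
    by blast
  obtain h'' where h'': "Cinf h''" "\<And>s. (h' has_vector_derivative h'' s) (at s)" using Cinf_real_deriv[OF H(3)] by blast
  have hpos: "h s = 0" if s: "s > S" for s
  proof -
    have "((\<lambda>_. 0) has_vector_derivative 0) (at s)" by simp
    then have "(H has_vector_derivative 0) (at s)"
      by (rule has_vector_derivative_transform_within_open[of _ _ _ "{S<..}"]) (use s H(6) in auto)
    then show ?thesis using H(4) vector_derivative_unique_at by blast
  qed
  have "h S = 0"
  proof -
    have "(h \<longlongrightarrow> h S) (at_right S)" using Cinf_continuous[OF H(2), of UNIV]
      by (simp add: continuous_on_def) (metis UNIV_I filterlim_at_split tendsto_within_subset top_greatest)
    moreover have "(h \<longlongrightarrow> 0) (at_right S)"
      by (rule tendsto_eventually) (simp add: eventually_at_filter hpos)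
    ultimately show ?thesis using tendsto_unique[OF trivial_limit_at_right_real] by blast
  qed
  then have hz: "h s = 0" if "s \<ge> S" for s using that hpos by (cases "s = S") auto
  have eq: "complex_of_real (4 * s) * h'' s + complex_of_real (2 + 4 * real (Suc j)) * h' s + lam * h s = g s" if s: "s > a" for s
  proof -
    have l: "((\<lambda>s. complex_of_real (4 * s)) has_vector_derivative 4) (at s)"
      using has_vector_derivative_of_real[of "\<lambda>s. 4 * s" 4 "at s"] by (auto intro!: derivative_eq_intros)
    have "((\<lambda>s. complex_of_real (4 * s) * h' s + complex_of_real (2 + 4 * real j) * h s + lam * H s) has_vector_derivative
        (complex_of_real (4 * s) * h'' s + 4 * h' s) + complex_of_real (2 + 4 * real j) * h' s + lam * h s) (at s)"
      by (intro has_vector_derivative_add has_vector_derivative_mult has_vector_derivative_mult_right l h''(2) H(4,5))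
    then have "(G has_vector_derivative
        (complex_of_real (4 * s) * h'' s + 4 * h' s) + complex_of_real (2 + 4 * real j) * h' s + lam * h s) (at s)"
      by (rule has_vector_derivative_transform_within_open[of _ _ _ "{a<..}"]) (use s H(7) in auto)
    from vector_derivative_unique_at[OF this G(2)] show ?thesis by (simp add: algebra_simps)
  qed
  then show ?case using H(2,3,5) h'' hz by blast
qed

section \<open>Unique continuation in a ball\<close>

definition laplacian :: "('a::euclidean_space \<Rightarrow> complex) \<Rightarrow> 'a \<Rightarrow> complex" where
  "laplacian \<psi> x = (\<Sum>b\<in>Basis. partial b (\<lambda>y. partial b \<psi> y) x)"

lemma Cinf_scaleR: "Cinf f \<Longrightarrow> Cinf g \<Longrightarrow> Cinf (\<lambda>x. f x *\<^sub>R g x)"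
  by (simp add: Cinf_def Ck_scaleR)

lemma Cinf_sum: "(\<And>i. i \<in> I \<Longrightarrow> Cinf (f i)) \<Longrightarrow> Cinf (\<lambda>x. \<Sum>i\<in>I. f i x)"
  by (induction I rule: infinite_finite_induct) (auto intro: Cinf_const Cinf_add)

context
  fixes x0 \<xi> :: "'a::euclidean_space"
begin

definition radial :: "nat \<Rightarrow> (real \<Rightarrow> complex) \<Rightarrow> 'a \<Rightarrow> complex" where
  "radial d h x = (((x - x0) \<bullet> \<xi>) ^ d) *\<^sub>R h ((x - x0) \<bullet> (x - x0))"

lemma Cinf_dist_sq: "Cinf (\<lambda>x::'a. (x - x0) \<bullet> (x - x0))"
proof -
  have "(\<lambda>x. (x - x0) \<bullet> (x - x0)) = (\<lambda>x. \<Sum>b\<in>Basis. (x \<bullet> b - x0 \<bullet> b) * (x \<bullet> b - x0 \<bullet> b))"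
    by (subst euclidean_inner) (simp add: inner_diff_left)
  then show ?thesis
    by (simp only:) (intro Cinf_sum Cinf_mult Cinf_diff Cinf_inner Cinf_const)
qed

lemma Cinf_linear_form: "Cinf (\<lambda>x::'a. (x - x0) \<bullet> \<xi>)"
  unfolding inner_diff_left by (intro Cinf_diff Cinf_inner Cinf_const)

lemma Cinf_radial: "Cinf h \<Longrightarrow> Cinf (radial d h)"
  unfolding radial_def[abs_def] by (intro Cinf_scaleR Cinf_power Cinf_linear_form Cinf_compose[OF _ Cinf_dist_sq])

lemma radial_support:
  assumes "\<And>s. s \<ge> S \<Longrightarrow> h s = 0" "S > 0"
  shows "{x. radial d h x \<noteq> 0} \<subseteq> cball x0 (sqrt S)" "supp (radial d h) \<subseteq> cball x0 (sqrt S)"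
proof -
  show 1: "{x. radial d h x \<noteq> 0} \<subseteq> cball x0 (sqrt S)"
  proof
    fix x assume "x \<in> {x. radial d h x \<noteq> 0}"
    then have "h ((x - x0) \<bullet> (x - x0)) \<noteq> 0" by (auto simp: radial_def)
    then have "(x - x0) \<bullet> (x - x0) < S" using assms(1) not_le by blast
    then have "(norm (x - x0))\<^sup>2 < S" by (simp add: power2_norm_eq_inner)
    then have "norm (x - x0) \<le> sqrt S" by (intro real_le_rsqrt) simp
    then show "x \<in> cball x0 (sqrt S)" by (simp add: dist_norm norm_minus_commute)
  qed
  show "supp (radial d h) \<subseteq> cball x0 (sqrt S)" by (rule closure_minimal[OF 1 closed_cball])
qed

lemma test_function_radial:
  assumes "Cinf h" "\<And>s. s \<ge> S \<Longrightarrow> h s = 0" "S > 0" shows "test_function (radial d h)"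
  by (rule test_functionI[OF Cinf_radial[OF assms(1)] bounded_subset[OF bounded_cball radial_support(1)[OF assms(2,3)]]])

lemma dist_sq_has_derivative: "((\<lambda>x. (x - x0) \<bullet> (x - x0)) has_derivative (\<lambda>k. 2 * ((x - x0) \<bullet> k))) (at x)"
  by (auto intro!: derivative_eq_intros simp: inner_commute)

lemma radial_profile_has_derivative:
  assumes "\<And>s. (h has_vector_derivative h' s) (at s)"
  shows "((\<lambda>x. h ((x - x0) \<bullet> (x - x0))) has_derivative (\<lambda>k. (2 * ((x - x0) \<bullet> k)) *\<^sub>R h' ((x - x0) \<bullet> (x - x0)))) (at x)"
  using has_derivative_compose[OF dist_sq_has_derivative assms[unfolded has_vector_derivative_def]] .

lemma linear_form_power_has_derivative: "((\<lambda>x. ((x - x0) \<bullet> \<xi>) ^ d) has_derivative (\<lambda>k. real d * (k \<bullet> \<xi>) * ((x - x0) \<bullet> \<xi>) ^ (d - 1))) (at x)"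
proof -
  have "((\<lambda>x. (x - x0) \<bullet> \<xi>) has_derivative (\<lambda>k. k \<bullet> \<xi>)) (at x)"
    by (auto intro!: derivative_eq_intros)
  from has_derivative_power[OF this, of d] show ?thesis by (simp add: mult_ac)
qed

text \<open>
  The Laplacian of \<open>h(|x|\<^sup>2) (x\<cdot>\<xi>)\<^sup>d\<close>.  Its leading part has the same form, with \<open>h\<close> replaced by its
  image under the radial operator; the remainder has degree \<open>d - 2\<close>.
\<close>

lemma laplacian_radial:
  assumes h: "\<And>s. (h has_vector_derivative h' s) (at s)" and h': "\<And>s. (h' has_vector_derivative h'' s) (at s)"
  defines "N \<equiv> \<lambda>x. (x - x0) \<bullet> (x - x0)" and "L \<equiv> \<lambda>x. (x - x0) \<bullet> \<xi>"
  shows "laplacian (radial d h) x =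
    (L x ^ d) *\<^sub>R (complex_of_real (4 * N x) * h'' (N x) + complex_of_real (2 * DIM('a) + 4 * real d) * h' (N x))
    + (real d * real (d - 1) * (\<xi> \<bullet> \<xi>) * L x ^ (d - 2)) *\<^sub>R h (N x)"
proof -
  have p1: "partial b (radial d h) y = ((2 * ((y - x0) \<bullet> b)) * L y ^ d) *\<^sub>R h' (N y)
      + ((real d * (b \<bullet> \<xi>)) * L y ^ (d - 1)) *\<^sub>R h (N y)" for b y
    using partialI[OF has_derivative_scaleR[OF linear_form_power_has_derivative radial_profile_has_derivative[OF h]], of d y b]
    by (simp add: radial_def[abs_def] N_def L_def mult_ac)
  have p2: "partial b (\<lambda>y. partial b (radial d h) y) x =
      ((4 * ((x - x0) \<bullet> b)^2) * L x ^ d) *\<^sub>R h'' (N x) + (2 * (b \<bullet> b) * L x ^ d) *\<^sub>R h' (N x)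
      + (4 * real d * (((x - x0) \<bullet> b) * (\<xi> \<bullet> b)) * L x ^ (d - 1)) *\<^sub>R h' (N x)
      + (real d * real (d - 1) * (\<xi> \<bullet> b)^2 * L x ^ (d - 2)) *\<^sub>R h (N x)" for b
  proof -
    have lin: "((\<lambda>y. 2 * ((y - x0) \<bullet> b)) has_derivative (\<lambda>k. 2 * (k \<bullet> b))) (at x)"
      by (auto intro!: derivative_eq_intros)
    have Ld: "((\<lambda>x. L x ^ e) has_derivative (\<lambda>k. real e * (k \<bullet> \<xi>) * L x ^ (e - 1))) (at x)" for e
      unfolding L_def by (rule linear_form_power_has_derivative)
    have A: "((\<lambda>y. ((2 * ((y - x0) \<bullet> b)) * L y ^ d) *\<^sub>R h' (N y)) has_derivative
       (\<lambda>k. ((2 * ((x - x0) \<bullet> b)) * L x ^ d) *\<^sub>R ((2 * ((x - x0) \<bullet> k)) *\<^sub>R h'' (N x))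
          + ((2 * ((x - x0) \<bullet> b)) * (real d * (k \<bullet> \<xi>) * L x ^ (d - 1)) + (2 * (k \<bullet> b)) * L x ^ d) *\<^sub>R h' (N x))) (at x)"
      unfolding N_def by (intro has_derivative_scaleR has_derivative_mult lin Ld radial_profile_has_derivative h')
    have B: "((\<lambda>y. ((real d * (b \<bullet> \<xi>)) * L y ^ (d - 1)) *\<^sub>R h (N y)) has_derivative
       (\<lambda>k. ((real d * (b \<bullet> \<xi>)) * L x ^ (d - 1)) *\<^sub>R ((2 * ((x - x0) \<bullet> k)) *\<^sub>R h' (N x))
          + ((real d * (b \<bullet> \<xi>)) * (real (d - 1) * (k \<bullet> \<xi>) * L x ^ (d - 1 - 1))) *\<^sub>R h (N x))) (at x)"
      unfolding N_def by (intro has_derivative_scaleR has_derivative_mult_right Ld radial_profile_has_derivative h)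
    show ?thesis
      unfolding p1 partialI[OF has_derivative_add[OF A B]]
      by (simp add: scaleR_conv_of_real inner_commute power2_eq_square algebra_simps numeral_2_eq_2)
  qed
  have s1: "(\<Sum>b\<in>Basis. ((x - x0) \<bullet> b)^2) = N x"
    unfolding N_def by (subst euclidean_inner) (simp add: power2_eq_square)
  have s2: "(\<Sum>b\<in>Basis. (((x - x0) \<bullet> b) * (\<xi> \<bullet> b))) = L x"
    unfolding L_def by (subst (3) euclidean_inner) simp
  have s3: "(\<Sum>b\<in>Basis. (\<xi> \<bullet> b)^2) = \<xi> \<bullet> \<xi>"
    by (subst (2) euclidean_inner) (simp add: power2_eq_square)
  have s4: "(\<Sum>b\<in>(Basis::'a set). b \<bullet> b) = real DIM('a)"
    by (simp add: inner_Basis)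
  have "laplacian (radial d h) x =
      ((4 * (\<Sum>b\<in>Basis. ((x - x0) \<bullet> b)^2)) * L x ^ d) *\<^sub>R h'' (N x) + (2 * (\<Sum>b\<in>(Basis::'a set). b \<bullet> b) * L x ^ d) *\<^sub>R h' (N x)
      + (4 * real d * (\<Sum>b\<in>Basis. (((x - x0) \<bullet> b) * (\<xi> \<bullet> b))) * L x ^ (d - 1)) *\<^sub>R h' (N x)
      + (real d * real (d - 1) * (\<Sum>b\<in>Basis. (\<xi> \<bullet> b)^2) * L x ^ (d - 2)) *\<^sub>R h (N x)"
    unfolding laplacian_def p2 sum.distrib
    by (simp only: sum_distrib_left sum_distrib_right scaleR_sum_left)
  moreover have "real d * L x * L x ^ (d - 1) = real d * L x ^ d"
    by (cases d) simp_all
  ultimately show ?thesis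
    unfolding s1 s2 s3 s4
    by (simp add: scaleR_conv_of_real algebra_simps flip: of_real_mult of_real_power)
qed

end

lemma test_function_laplacian:
  assumes "test_function \<psi>" shows "test_function (laplacian \<psi>)"
proof (rule test_functionI)
  show "Cinf (laplacian \<psi>)"
    unfolding laplacian_def[abs_def]
    by (intro Cinf_sum test_function_Cinf test_function_partial assms)
  have "laplacian \<psi> x = 0" if "x \<notin> supp \<psi>" for x
  proof -
    have "partial b (\<lambda>y. partial b \<psi> y) x = 0" for b
      using partial_zero_outside[of x "\<lambda>y. partial b \<psi> y"] supp_partial[of \<psi> b] that by blast
    then show ?thesis by (simp add: laplacian_def)
  qed
  then have "{x. laplacian \<psi> x \<noteq> 0} \<subseteq> supp \<psi>" by blast
  then show "bounded {x. laplacian \<psi> x \<noteq> 0}"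
    by (rule bounded_subset[OF bounded_closure[OF test_function_bounded_support[OF assms]]])
qed

text \<open>
  Given \<open>g\<close>, choose \<open>h\<close> with \<open>4 s h'' + (6 + 4 d) h' + \<lambda> h = g\<close> where \<open>v\<close> can be non-zero.  Testing the
  Helmholtz equation with \<open>h(|x|\<^sup>2) (x\<cdot>\<xi>)\<^sup>d\<close> expresses the moment of \<open>v g(|x|\<^sup>2)\<close> of degree \<open>d\<close> by one of
  degree \<open>d - 2\<close>.
\<close>

lemma radial_moments_vanish:
  fixes v :: "real^3 \<Rightarrow> complex"
  assumes v: "L1_loc v"
    and eq: "\<And>\<psi>. test_function \<psi> \<Longrightarrow> supp \<psi> \<subseteq> ball x0 R \<Longrightarrow>
       (LINT x|lebesgue. v x * (laplacian \<psi> x + lam * \<psi> x)) = 0"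
    and zero: "AE x in lebesgue. x \<in> ball x0 \<delta> \<longrightarrow> v x = 0" and \<delta>: "\<delta> > 0"
    and S: "S > 0" "sqrt S < R"
    and g: "Cinf g" "\<And>s. s \<ge> S \<Longrightarrow> g s = 0"
  shows "(LINT x|lebesgue. v x * radial x0 \<xi> d g x) = 0"
  using g
proof (induction d arbitrary: g rule: less_induct)
  case (less d)
  define a where "a = min (\<delta>^2 / 2) S"
  have a: "0 < a" "a \<le> S" "a < \<delta>^2" using \<delta> S zero_less_power[OF \<delta>, of 2] by (auto simp: a_def min_def)
  obtain h h' h'' where h: "Cinf h" "Cinf h'" "Cinf h''" "\<And>s. (h has_vector_derivative h' s) (at s)"
    "\<And>s. (h' has_vector_derivative h'' s) (at s)" "\<And>s. s \<ge> S \<Longrightarrow> h s = 0"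
    "\<And>s. s > a \<Longrightarrow> complex_of_real (4 * s) * h'' s + complex_of_real (2 + 4 * real (d + 1)) * h' s + lam * h s = g s"
    \<comment> \<open>In dimension three the coefficient \<open>2 * 3 + 4 d\<close> is \<open>2 + 4 j\<close> with \<open>j = d + 1\<close>.\<close>
    using radial_ode[OF a(1,2) less.prems, of "d + 1" lam] by blast
  let ?\<psi> = "radial x0 \<xi> d h" and ?\<psi>2 = "radial x0 \<xi> (d - 2) h"
  define c where "c = complex_of_real (real d * real (d - 1) * (\<xi> \<bullet> \<xi>))"
  have t1: "test_function ?\<psi>" and t2: "test_function ?\<psi>2" and t3: "test_function (radial x0 \<xi> d g)"
    using test_function_radial h(1,6) S(1) less.prems by blast+
  have tl: "test_function (\<lambda>x. laplacian ?\<psi> x + lam * ?\<psi> x)"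
  proof (rule test_functionI)
    show "Cinf (\<lambda>x. laplacian ?\<psi> x + lam * ?\<psi> x)"
      by (intro Cinf_add Cinf_cmult test_function_Cinf test_function_laplacian t1)
    show "bounded {x. laplacian ?\<psi> x + lam * ?\<psi> x \<noteq> 0}"
      by (rule bounded_subset[OF bounded_Un[THEN iffD2, OF conjI[OF test_function_bounded_support[OF t1] test_function_bounded_support[OF test_function_laplacian[OF t1]]]]])
         auto
  qed
  have sub: "supp ?\<psi> \<subseteq> ball x0 R"
  proof -
    have "supp ?\<psi> \<subseteq> cball x0 (sqrt S)" by (rule radial_support(2)[OF h(6) S(1)])
    also have "\<dots> \<subseteq> ball x0 R" using S(2) by auto
    finally show ?thesis .
  qed
  have z2: "c * (LINT x|lebesgue. v x * ?\<psi>2 x) = 0"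
  proof (cases "d \<ge> 2")
    case True
    then have "d - 2 < d" by simp
    from less.IH[OF this h(1,6)] show ?thesis by simp
  next
    case False
    then have "d = 0 \<or> d = 1" by linarith
    then show ?thesis by (auto simp: c_def)
  qed
  have pt: "radial x0 \<xi> d g x = (laplacian ?\<psi> x + lam * ?\<psi> x) - c * ?\<psi>2 x" if "x \<notin> ball x0 \<delta>" for x
  proof -
    let ?N = "(x - x0) \<bullet> (x - x0)"
    have "norm (x - x0) \<ge> \<delta>" using that by (simp add: dist_norm norm_minus_commute)
    then have "?N \<ge> \<delta>^2" using \<delta> by (simp add: power2_norm_eq_inner[symmetric] power_mono)
    then have "?N > a" using a(3) by linarith
    then have g: "g ?N = complex_of_real (4 * ?N) * h'' ?N + complex_of_real (2 + 4 * real (d + 1)) * h' ?N + lam * h ?N"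
      using h(7) by simp
    show ?thesis
      unfolding laplacian_radial[OF h(4,5)] unfolding radial_def g c_def
      by (simp add: scaleR_conv_of_real algebra_simps)
  qed
  have "(LINT x|lebesgue. v x * radial x0 \<xi> d g x)
      = (LINT x|lebesgue. v x * (laplacian ?\<psi> x + lam * ?\<psi> x) - c * (v x * ?\<psi>2 x))"
  proof (rule integral_cong_AE)
    show "AE x in lebesgue. v x * radial x0 \<xi> d g x = v x * (laplacian ?\<psi> x + lam * ?\<psi> x) - c * (v x * ?\<psi>2 x)"
      using zero
    proof eventually_elim
      case (elim x)
      show ?case
      proof (cases "x \<in> ball x0 \<delta>")
        case False
        show ?thesis unfolding pt[OF False] by (simp add: algebra_simps)
      qed (use elim in simp)
    qed
    show "(\<lambda>x. v x * radial x0 \<xi> d g x) \<in> borel_measurable lebesgue"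
      by (rule borel_measurable_integrable[OF L1_loc_mult_test[OF v t3]])
    show "(\<lambda>x. v x * (laplacian ?\<psi> x + lam * ?\<psi> x) - c * (v x * ?\<psi>2 x)) \<in> borel_measurable lebesgue"
      by (rule borel_measurable_integrable[OF Bochner_Integration.integrable_diff[OF
           L1_loc_mult_test[OF v tl] integrable_mult_right[OF L1_loc_mult_test[OF v t2]]]])
  qed
  also have "\<dots> = (LINT x|lebesgue. v x * (laplacian ?\<psi> x + lam * ?\<psi> x)) - c * (LINT x|lebesgue. v x * ?\<psi>2 x)"
    by (subst Bochner_Integration.integral_diff[OF L1_loc_mult_test[OF v tl] integrable_mult_right[OF L1_loc_mult_test[OF v t2]]])
       simp
  also have "\<dots> = 0" using z2 eq[OF t1 sub] by simp
  finally show ?case .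
qed

lemma integrable_imp_L1_loc: "integrable lebesgue f \<Longrightarrow> L1_loc f"
  unfolding L1_loc_def set_integrable_def
  by (auto intro!: integrable_mult_indicator fmeasurableD lmeasurable_compact)

text \<open>
  Finite sums of real exponentials form an algebra of continuous functions that separates points.
\<close>

inductive exp_sum :: "'a::euclidean_space \<Rightarrow> ('a \<Rightarrow> real) \<Rightarrow> bool" for x0 where
  exp: "exp_sum x0 (\<lambda>x. c * exp ((x - x0) \<bullet> \<xi>))"
| add: "exp_sum x0 p \<Longrightarrow> exp_sum x0 q \<Longrightarrow> exp_sum x0 (\<lambda>x. p x + q x)"

lemma exp_sum_const: "exp_sum x0 (\<lambda>x. c)"
  using exp_sum.exp[of x0 c 0] by simp

lemma exp_sum_mult:
  assumes "exp_sum x0 p" "exp_sum x0 q" shows "exp_sum x0 (\<lambda>x. p x * q x)"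
  using assms(1)
proof induction
  case (exp c \<xi>)
  show ?case using assms(2)
  proof induction
    case (exp c' \<xi>')
    have "(\<lambda>x. c * exp ((x - x0) \<bullet> \<xi>) * (c' * exp ((x - x0) \<bullet> \<xi>'))) = (\<lambda>x. (c * c') * exp ((x - x0) \<bullet> (\<xi> + \<xi>')))"
      by (simp add: inner_add_right exp_add mult_ac)
    then show ?case by (simp only: exp_sum.exp)
  next
    case (add p q)
    then show ?case using exp_sum.add by (simp add: distrib_left)
  qed
next
  case (add p q)
  then show ?case using exp_sum.add by (simp add: distrib_right)
qed

lemma exp_sum_continuous: "exp_sum x0 p \<Longrightarrow> continuous_on S p"
  by (induction rule: exp_sum.induct) (auto intro!: continuous_intros)

text \<open>
  By Stone-Weierstrass the exponentials span a uniformly dense set of continuous functions on a ball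
  containing the support, so the function is orthogonal to all bumps.
\<close>

lemma exponential_moments_zero:
  fixes f :: "'a::euclidean_space \<Rightarrow> complex"
  assumes f: "integrable lebesgue f" and supp: "\<And>x. x \<notin> cball x0 r \<Longrightarrow> f x = 0"
    and mom: "\<And>\<xi>. (LINT x|lebesgue. f x * complex_of_real (exp ((x - x0) \<bullet> \<xi>))) = 0"
  shows "AE x in lebesgue. f x = 0"
proof -
  have fp: "integrable lebesgue (\<lambda>x. f x * complex_of_real (p x))" if p: "continuous_on UNIV p" for p
  proof -
    have "compact (p ` cball x0 r)" using p by (intro compact_continuous_image) (auto intro: continuous_on_subset)
    then obtain C where C: "\<forall>y\<in>p ` cball x0 r. norm y \<le> C" using compact_imp_bounded bounded_iff by blast
    have "integrable lebesgue (\<lambda>x. C *\<^sub>R f x)" using f by simp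
    then show ?thesis
    proof (rule Bochner_Integration.integrable_bound)
      have "(\<lambda>x. complex_of_real (p x)) \<in> borel_measurable lebesgue"
        using p by (intro continuous_lebesgue_measurable) (auto intro!: continuous_intros)
      then show "(\<lambda>x. f x * complex_of_real (p x)) \<in> borel_measurable lebesgue"
        using f by (intro borel_measurable_times) auto
      have "cmod (f x) * \<bar>p x\<bar> \<le> cmod (f x) * \<bar>C\<bar>" if "x \<in> cball x0 r" for x
        using C that by (intro mult_left_mono) (auto intro: order_trans[OF _ abs_ge_self])
      then show "AE x in lebesgue. norm (f x * complex_of_real (p x)) \<le> norm (C *\<^sub>R f x)"
        using supp by (intro AE_I2) (metis abs_mult mult.commute mult_zero_left norm_mult norm_of_real norm_scaleR norm_zero order_refl)
    qed
  qed
  have exps: "(LINT x|lebesgue. f x * complex_of_real (p x)) = 0" if "exp_sum x0 p" for p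
    using that
  proof induction
    case (exp c \<xi>)
    have "(LINT x|lebesgue. f x * complex_of_real (c * exp ((x - x0) \<bullet> \<xi>)))
       = (LINT x|lebesgue. complex_of_real c * (f x * complex_of_real (exp ((x - x0) \<bullet> \<xi>))))"
      by (intro Bochner_Integration.integral_cong) (simp_all add: mult_ac)
    then show ?case using mom[of \<xi>] by simp
  next
    case (add p q)
    have "(LINT x|lebesgue. f x * complex_of_real (p x + q x))
      = (LINT x|lebesgue. f x * complex_of_real (p x) + f x * complex_of_real (q x))"
      by (intro Bochner_Integration.integral_cong) (simp_all add: distrib_left)
    also have "\<dots> = 0"
      using Bochner_Integration.integral_add[OF fp[OF exp_sum_continuous[OF add.hyps(1)]] fp[OF exp_sum_continuous[OF add.hyps(2)]]]
      by (simp add: add.IH)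
    finally show ?case .
  qed
  have cont: "(LINT x|lebesgue. f x * complex_of_real (\<phi> x)) = 0" if \<phi>: "continuous_on UNIV \<phi>" for \<phi>
  proof -
    define I where "I = (LINT x|lebesgue. norm (f x))"
    have I: "I \<ge> 0" by (simp add: I_def)
    have bound: "norm (LINT x|lebesgue. f x * complex_of_real (\<phi> x)) \<le> e * I" if e: "e > 0" for e
    proof -
      obtain p where p: "exp_sum x0 p" "\<forall>x\<in>cball x0 r. \<bar>\<phi> x - p x\<bar> < e"
      proof (rule exE[OF Stone_Weierstrass_HOL[of "cball x0 r" "exp_sum x0" \<phi> e]])
        show "\<exists>p. exp_sum x0 p \<and> p x \<noteq> p y" if "x \<in> cball x0 r \<and> y \<in> cball x0 r \<and> x \<noteq> y" for x y
        proof (intro exI conjI)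
          show "exp_sum x0 (\<lambda>z. 1 * exp ((z - x0) \<bullet> (x - y)))" by (rule exp_sum.exp)
          have "(x - y) \<bullet> (x - y) \<noteq> 0" using that by simp
          then show "1 * exp ((x - x0) \<bullet> (x - y)) \<noteq> 1 * exp ((y - x0) \<bullet> (x - y))"
            by (simp add: inner_diff_left)
        qed
      qed (use e \<phi> exp_sum_const exp_sum_continuous exp_sum.add exp_sum_mult continuous_on_subset[OF \<phi>] in auto)
      have ip: "integrable lebesgue (\<lambda>x. f x * complex_of_real (p x))" by (rule fp[OF exp_sum_continuous[OF p(1)]])
      have ifp: "integrable lebesgue (\<lambda>x. f x * complex_of_real (\<phi> x))" by (rule fp[OF \<phi>])
      have "(LINT x|lebesgue. f x * complex_of_real (\<phi> x))
         = (LINT x|lebesgue. f x * complex_of_real (\<phi> x) - f x * complex_of_real (p x))"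
        by (subst Bochner_Integration.integral_diff[OF ifp ip]) (simp add: exps[OF p(1)])
      also have "norm \<dots> \<le> (LINT x|lebesgue. e * norm (f x))"
      proof (rule Bochner_Integration.integral_norm_bound_integral)
        show "integrable lebesgue (\<lambda>x. f x * complex_of_real (\<phi> x) - f x * complex_of_real (p x))"
          by (rule Bochner_Integration.integrable_diff[OF ifp ip])
        show "integrable lebesgue (\<lambda>x. e * norm (f x))" using f by simp
        fix x :: 'a
        show "norm (f x * complex_of_real (\<phi> x) - f x * complex_of_real (p x)) \<le> e * norm (f x)"
        proof (cases "x \<in> cball x0 r")
          case True
          have "norm (f x * complex_of_real (\<phi> x) - f x * complex_of_real (p x)) = norm (f x) * \<bar>\<phi> x - p x\<bar>"
            by (simp add: norm_mult flip: right_diff_distrib of_real_diff)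
          also have "\<dots> \<le> norm (f x) * e" using p(2) True by (intro mult_left_mono) (auto intro: less_imp_le)
          finally show ?thesis by (simp add: mult.commute)
        qed (simp add: supp)
      qed
      also have "\<dots> = e * I" by (simp add: I_def)
      finally show ?thesis .
    qed
    have "norm (LINT x|lebesgue. f x * complex_of_real (\<phi> x)) \<le> 0"
    proof (rule field_le_epsilon)
      fix e :: real assume "e > 0"
      then have "e / (I + 1) > 0" using I by simp
      from bound[OF this] have "norm (LINT x|lebesgue. f x * complex_of_real (\<phi> x)) \<le> e / (I + 1) * I" .
      also have "\<dots> \<le> e" using I \<open>e > 0\<close> by (simp add: field_simps)
      finally show "norm (LINT x|lebesgue. f x * complex_of_real (\<phi> x)) \<le> 0 + e" by simp
    qed
    then show ?thesis by simp
  qed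
  have "AE x in lebesgue. x \<in> UNIV \<longrightarrow> f x = 0"
    by (rule fundamental_lemma_bump[OF integrable_imp_L1_loc[OF f] open_UNIV])
       (intro cont Cinf_continuous Cinf_boxbump)
  then show ?thesis by simp
qed

text \<open>
  Expanding exponentials into power series, the vanishing of the moments \<open>(x\<cdot>\<xi>)\<^sup>d\<close> makes \<open>v g(|x|\<^sup>2)\<close>
  orthogonal to all exponentials, hence zero.  A profile \<open>g\<close> that is positive exactly for \<open>s < S\<close> gives
  \<open>v = 0\<close> on the ball of radius \<open>sqrt S\<close>, and these balls exhaust the given one.
\<close>

theorem unique_continuation_ball:
  fixes v :: "real^3 \<Rightarrow> complex"
  assumes v: "L1_loc v"
    and eq: "\<And>\<psi>. test_function \<psi> \<Longrightarrow> supp \<psi> \<subseteq> ball x0 R \<Longrightarrow>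
       (LINT x|lebesgue. v x * (laplacian \<psi> x + lam * \<psi> x)) = 0"
    and zero: "AE x in lebesgue. x \<in> ball x0 \<delta> \<longrightarrow> v x = 0" and \<delta>: "\<delta> > 0"
  shows "AE x in lebesgue. x \<in> ball x0 R \<longrightarrow> v x = 0"
proof -
  have main: "AE x in lebesgue. x \<in> ball x0 (sqrt S) \<longrightarrow> v x = 0" if S: "S > 0" "sqrt S < R" for S
  proof -
    define g where "g s = complex_of_real (flat (1 * S - 1 * s))" for s :: real
    have g: "Cinf g"
      unfolding g_def[abs_def]
      by (intro Cinf_of_real Cinf_compose[OF Cinf_flat] Cinf_diff Cinf_cmult Cinf_linear bounded_linear_ident Cinf_const)
    have gz: "g s = 0" if "s \<ge> S" for s using that by (simp add: g_def flat_bounds(4))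
    define f where "f x = v x * g ((x - x0) \<bullet> (x - x0))" for x
    have mom: "(LINT x|lebesgue. v x * radial x0 \<xi> d g x) = 0" for \<xi> d
      by (rule radial_moments_vanish[OF v eq zero \<delta> S g gz])
    have rad: "v x * radial x0 \<xi> d g x = f x * complex_of_real (((x - x0) \<bullet> \<xi>) ^ d)" for x \<xi> d
      by (simp add: radial_def f_def scaleR_conv_of_real mult_ac)
    have fi: "integrable lebesgue (\<lambda>x. f x * complex_of_real (((x - x0) \<bullet> \<xi>) ^ d))" for \<xi> d
      using L1_loc_mult_test[OF v test_function_radial[OF g gz S(1), of x0 \<xi> d]] unfolding rad .
    then have fint: "integrable lebesgue f" using fi[of 0 0] by simp
    have fsupp: "f x = 0" if "x \<notin> cball x0 (sqrt S)" for x
    proof -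
      have "{x. radial x0 0 0 g x \<noteq> 0} \<subseteq> cball x0 (sqrt S)" by (rule radial_support(1)[OF gz S(1)])
      then show ?thesis using that by (auto simp: f_def radial_def)
    qed
    have "AE x in lebesgue. f x = 0"
    proof (rule exponential_moments_zero[OF fint fsupp])
      fix \<xi> :: "real^3"
      let ?t = "\<lambda>x. (x - x0) \<bullet> \<xi>"
      let ?s = "\<lambda>n x. f x * complex_of_real (\<Sum>d<n. ?t x ^ d / fact d)"
      have sn: "(LINT x|lebesgue. ?s n x) = 0" and si: "integrable lebesgue (?s n)" for n
      proof -
        have e: "?s n = (\<lambda>x. \<Sum>d<n. complex_of_real (1 / fact d) * (f x * complex_of_real (?t x ^ d)))"
          by (simp add: sum_distrib_left field_simps)
        show "integrable lebesgue (?s n)" unfolding e by (intro Bochner_Integration.integrable_sum integrable_mult_right fi)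
        show "(LINT x|lebesgue. ?s n x) = 0"
          unfolding e using mom[unfolded rad] fi by (subst Bochner_Integration.integral_sum) (auto intro!: integrable_mult_right)
      qed
      have "(\<lambda>n. LINT x|lebesgue. ?s n x) \<longlonglongrightarrow> (LINT x|lebesgue. f x * complex_of_real (exp (?t x)))"
      proof (rule integral_dominated_convergence)
        show "?s n \<in> borel_measurable lebesgue" for n using si by auto
        have "(\<lambda>x. complex_of_real (exp (?t x))) \<in> borel_measurable lebesgue"
          by (intro continuous_lebesgue_measurable continuous_intros)
        then show "(\<lambda>x. f x * complex_of_real (exp (?t x))) \<in> borel_measurable lebesgue"
          using fint by (intro borel_measurable_times) auto
        show "integrable lebesgue (\<lambda>x. exp (sqrt S * norm \<xi>) * norm (f x))" using fint by simp
        have "(\<lambda>n. \<Sum>d<n. ?t x ^ d / fact d) \<longlonglongrightarrow> exp (?t x)" for x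
          using exp_converges[of "?t x"] unfolding sums_def by (simp add: divide_inverse mult.commute)
        then show "AE x in lebesgue. (\<lambda>n. ?s n x) \<longlonglongrightarrow> f x * complex_of_real (exp (?t x))"
          by (intro AE_I2 tendsto_mult tendsto_const tendsto_of_real)
        fix n show "AE x in lebesgue. norm (?s n x) \<le> exp (sqrt S * norm \<xi>) * norm (f x)"
        proof (intro AE_I2)
          fix x show "norm (?s n x) \<le> exp (sqrt S * norm \<xi>) * norm (f x)"
          proof (cases "x \<in> cball x0 (sqrt S)")
            case True
            have "\<bar>\<Sum>d<n. ?t x ^ d / fact d\<bar> \<le> (\<Sum>d<n. \<bar>?t x\<bar> ^ d / fact d)"
              by (rule order_trans[OF sum_abs]) (simp add: power_abs)
            also have "\<dots> \<le> exp \<bar>?t x\<bar>"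
            proof -
              have sm: "(\<lambda>d. \<bar>?t x\<bar> ^ d / fact d) sums exp \<bar>?t x\<bar>"
                using exp_converges[of "\<bar>?t x\<bar>"] by (simp add: divide_inverse mult.commute)
              show ?thesis using sum_le_suminf[OF sums_summable[OF sm], of "{..<n}"] sums_unique[OF sm] by simp
            qed
            also have "\<dots> \<le> exp (sqrt S * norm \<xi>)"
            proof -
              have "\<bar>?t x\<bar> \<le> norm (x - x0) * norm \<xi>" by (rule Cauchy_Schwarz_ineq2)
              also have "\<dots> \<le> sqrt S * norm \<xi>"
                using True by (intro mult_right_mono) (auto simp: dist_norm norm_minus_commute)
              finally show ?thesis by simp
            qed
            finally show ?thesis unfolding norm_mult norm_of_real by (metis mult.commute mult_right_mono norm_ge_zero)
          qed (simp add: fsupp)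
        qed
      qed
      then show "(LINT x|lebesgue. f x * complex_of_real (exp (?t x))) = 0"
        unfolding sn by (simp add: LIMSEQ_const_iff)
    qed
    then show ?thesis
    proof eventually_elim
      case (elim x)
      show ?case
      proof
        assume "x \<in> ball x0 (sqrt S)"
        then have "norm (x - x0) < sqrt S" by (simp add: dist_norm norm_minus_commute)
        then have "(norm (x - x0))^2 < S"
          using S(1) by (metis norm_ge_zero real_sqrt_less_iff real_sqrt_unique power2_eq_square real_sqrt_abs abs_of_nonneg)
        then have "g ((x - x0) \<bullet> (x - x0)) \<noteq> 0"
          using flat_bounds(3)[of "S - (x - x0) \<bullet> (x - x0)"] by (simp add: g_def power2_norm_eq_inner)
        then show "v x = 0" using elim by (simp add: f_def)
      qed
    qed
  qed
  have "AE x in lebesgue. \<forall>n::nat. x \<in> ball x0 (R - 1 / real (Suc n)) \<longrightarrow> v x = 0"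
  proof (subst AE_all_countable, intro allI)
    fix n :: nat
    define r where "r = R - 1 / real (Suc n)"
    show "AE x in lebesgue. x \<in> ball x0 (R - 1 / real (Suc n)) \<longrightarrow> v x = 0"
    proof (cases "r > 0")
      case True
      then have "sqrt (r^2) = r" "r < R" by (simp_all add: r_def)
      then show ?thesis using main[of "r^2"] True by (simp add: r_def)
    next
      case False
      then have "ball x0 (R - 1 / real (Suc n)) = {}" by (simp add: r_def)
      then show ?thesis by (simp only:) simp
    qed
  qed
  then show ?thesis
  proof eventually_elim
    case (elim x)
    show ?case
    proof
      assume "x \<in> ball x0 R"
      then have "R - dist x0 x > 0" by simp
      then obtain n :: nat where "1 / real (Suc n) < R - dist x0 x" using nat_approx_posE by blast
      then have "x \<in> ball x0 (R - 1 / real (Suc n))" by simp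
      then show "v x = 0" using elim by blast
    qed
  qed
qed

section \<open>Spreading of zeros through the resonators\<close>

text \<open>
  What the smoothness of the boundary is used for: near a boundary point the outside of the domain is
  connected and touches every boundary point, and the boundary is a null set.
\<close>

definition boundary_chart :: "(real^3) set \<Rightarrow> real^3 \<Rightarrow> (real^3) set \<Rightarrow> bool" where
  "boundary_chart A p W \<longleftrightarrow> open W \<and> p \<in> W \<and> connected (W - closure A) \<and>
     W \<inter> frontier A \<subseteq> closure (W - closure A) \<and> negligible (W \<inter> frontier A)"

text \<open>
  Straighten the graph by the homeomorphism \<open>(w, s) \<mapsto> (w, \<gamma>(w) + s)\<close>.  The image of a product of two balls
  is a neighbourhood in which the domain is \<open>s > 0\<close>, its boundary \<open>s = 0\<close> and its outside \<open>s < 0\<close>.  The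
  boundary is a null set as the differentiable image of a plane.
\<close>

lemma smooth_boundary_chart:
  assumes sb: "smooth_boundary D" and D: "open D" and p: "p \<in> frontier D" and e: "e > 0"
  obtains W where "W \<subseteq> ball p e" "boundary_chart D p W"
proof -
  obtain r T and \<gamma> :: "real^2 \<Rightarrow> real" where r: "r > 0" and T: "orthogonal_transformation (T :: real^3 \<Rightarrow> real^3)"
    and \<gamma>: "Cinf \<gamma>"
    and Dr: "D \<inter> ball p r = {x \<in> ball p r. \<gamma> (vector [T x $ 1, T x $ 2]) < T x $ 3}"
    using sb p unfolding smooth_boundary_def by blast
  define pr :: "real^3 \<Rightarrow> real^2" where "pr y = vector [y $ 1, y $ 2]" for y
  define em :: "real^2 \<Rightarrow> real \<Rightarrow> real^3" where "em w t = w $ 1 *\<^sub>R axis 1 1 + w $ 2 *\<^sub>R axis 2 1 + t *\<^sub>R axis 3 1" for w t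
  have pr_alt: "pr y = y $ 1 *\<^sub>R axis 1 1 + y $ 2 *\<^sub>R axis 2 1" for y
    by (simp add: pr_def vec_eq_iff forall_2 vector_2 axis_def)
  have em_nth: "em w t $ 1 = w $ 1" "em w t $ 2 = w $ 2" "em w t $ 3 = t" for w t
    by (simp_all add: em_def axis_def)
  have pr_em: "pr (em w t) = w" for w t by (simp add: pr_def em_nth vec_eq_iff forall_2 vector_2)
  have em_pr: "em (pr y) (y $ 3) = y" for y by (simp add: vec_eq_iff forall_3 em_nth) (simp add: pr_def vector_2)
  define Ti where "Ti = inv T"
  have bijT: "bij T" using T orthogonal_transformation_bij by blast
  have TTi: "T (Ti y) = y" and TiT: "Ti (T x) = x" for x y
    using bijT by (simp_all add: Ti_def bij_is_surj surj_f_inv_f bij_is_inj inv_f_f)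
  have lT: "bounded_linear T" and lTi: "bounded_linear Ti"
    using T orthogonal_transformation_inv[OF T] by (simp_all add: Ti_def orthogonal_transformation_linear linear_conv_bounded_linear[symmetric])
  have cT: "continuous_on S T" "continuous_on S Ti" for S using lT lTi linear_continuous_on by blast+
  have c\<gamma>: "continuous_on S \<gamma>" for S using \<gamma> Cinf_continuous by blast
  define \<Phi> where "\<Phi> z = Ti (em (fst z) (\<gamma> (fst z) + snd z))" for z
  define F where "F x = (pr (T x), T x $ 3 - \<gamma> (pr (T x)))" for x
  have F\<Phi>: "F (\<Phi> z) = z" for z by (simp add: F_def \<Phi>_def TTi pr_em em_nth)
  have \<Phi>F: "\<Phi> (F x) = x" for x by (simp add: F_def \<Phi>_def em_pr TiT)
  have c\<Phi>: "continuous_on S \<Phi>" for S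
    unfolding \<Phi>_def[abs_def] em_def
    by (intro continuous_on_compose2[OF cT(2)[of UNIV]] continuous_intros continuous_on_compose2[OF c\<gamma>[of UNIV]] subset_UNIV)
  have cpr: "continuous_on S (\<lambda>x. pr (T x))" for S
    unfolding pr_alt by (intro continuous_intros cT)
  have cF: "continuous_on S F" for S
    unfolding F_def[abs_def] by (intro continuous_intros cT cpr continuous_on_compose2[OF c\<gamma>[of UNIV] cpr] subset_UNIV)
  have DF: "x \<in> D \<longleftrightarrow> snd (F x) > 0" if "x \<in> ball p r" for x
  proof -
    have "x \<in> D \<inter> ball p r \<longleftrightarrow> x \<in> {x \<in> ball p r. \<gamma> (vector [T x $ 1, T x $ 2]) < T x $ 3}" by (simp only: Dr)
    then show ?thesis using that by (simp add: F_def pr_def)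
  qed
  have pD: "p \<notin> D" "p \<in> closure D" using p D by (auto simp: frontier_def interior_open)
  have oF: "open {x. snd (F x) < 0}"
    by (intro open_Collect_less continuous_intros cF)
  have neg_closure: "x \<notin> closure D" if "x \<in> ball p r" "snd (F x) < 0" for x
  proof -
    have "open (ball p r \<inter> {x. snd (F x) < 0})" by (intro open_Int open_ball oF)
    moreover have "ball p r \<inter> {x. snd (F x) < 0} \<inter> D = {}" using DF by auto
    ultimately have "ball p r \<inter> {x. snd (F x) < 0} \<inter> closure D = {}" by (simp add: open_Int_closure_eq_empty)
    then show ?thesis using that by blast
  qed
  have Fp: "snd (F p) = 0"
    using DF[of p] neg_closure[of p] pD r by force
  define q where "q = fst (F p)"
  have \<Phi>q: "\<Phi> (q, 0) = p" using \<Phi>F[of p] Fp by (metis prod.collapse q_def)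
  have "open (\<Phi> -` ball p (min r e))" using c\<Phi>[of UNIV] by (simp add: continuous_on_open_vimage)
  moreover have "(q, 0) \<in> \<Phi> -` ball p (min r e)" using \<Phi>q r e by simp
  ultimately obtain A B where AB: "open A" "open B" "(q, 0) \<in> A \<times> B" "A \<times> B \<subseteq> \<Phi> -` ball p (min r e)"
    by (rule open_prod_elim)
  obtain d1 where d1: "d1 > 0" "ball q d1 \<subseteq> A" using AB(1,3) openE by (metis mem_Sigma_iff)
  obtain d2 where d2: "d2 > 0" "ball 0 d2 \<subseteq> B" using AB(2,3) openE by (metis mem_Sigma_iff)
  define V where "V = ball q d1 \<times> ball (0::real) d2"
  define W where "W = F -` V"
  have W\<Phi>: "W = \<Phi> ` V" unfolding W_def using F\<Phi> \<Phi>F by (auto simp: image_iff) (metis)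
  have Wsub: "W \<subseteq> ball p (min r e)" using W\<Phi> V_def AB(4) d1(2) d2(2) by blast
  have oW: "open W" unfolding W_def V_def using cF[of UNIV]
    by (simp add: continuous_on_open_vimage open_Times)
  have pW: "p \<in> W" using d1 d2 Fp by (simp add: W_def V_def q_def mem_Times_iff)
  have Wr: "x \<in> ball p r" if "x \<in> W" for x using that Wsub by auto
  have inV: "(w, s) \<in> V \<longleftrightarrow> w \<in> ball q d1 \<and> -d2 < s \<and> s < d2" for w s
    by (auto simp: V_def dist_real_def)
  have path: "\<Phi> (w, 0) \<in> closure (\<Phi> ` ({w} \<times> J))" if "0 \<in> closure J" for w J
  proof -
    have "(\<lambda>s. \<Phi> (w, s)) ` closure J \<subseteq> closure (\<Phi> ` ({w} \<times> J))"
      by (rule image_closure_subset) (auto intro!: continuous_on_compose2[OF c\<Phi>[of UNIV]] continuous_intros closure_subset[THEN subsetD])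
    then show ?thesis using that by blast
  qed
  have zero_closure: "x \<in> closure D \<and> x \<in> closure (W \<inter> {x. snd (F x) < 0})" if x: "x \<in> W" "snd (F x) = 0" for x
  proof -
    obtain w where w: "x = \<Phi> (w, 0)" "w \<in> ball q d1"
      using x \<Phi>F[of x] unfolding W_def V_def by (metis SigmaE fst_conv prod.collapse snd_conv vimageD)
    have "0 \<in> closure {0<..<d2}" "0 \<in> closure {-d2<..<0}" using d2(1) by simp_all
    note path[OF this(1), of w] path[OF this(2), of w]
    moreover have "\<Phi> ` ({w} \<times> {0<..<d2}) \<subseteq> D"
    proof clarify
      fix s :: real assume "s \<in> {0<..<d2}"
      then have "\<Phi> (w, s) \<in> W" using w(2) by (auto simp: W\<Phi> inV)
      then show "\<Phi> (w, s) \<in> D" using DF Wr F\<Phi> \<open>s \<in> {0<..<d2}\<close> by auto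
    qed
    moreover have "\<Phi> ` ({w} \<times> {-d2<..<0}) \<subseteq> W \<inter> {x. snd (F x) < 0}"
      using w(2) F\<Phi> by (auto simp: W\<Phi> inV)
    ultimately show ?thesis using w(1) closure_mono by blast
  qed
  have WcD: "W - closure D = W \<inter> {x. snd (F x) < 0}"
  proof (intro equalityI subsetI)
    fix x assume x: "x \<in> W - closure D"
    then have "\<not> snd (F x) > 0" using DF Wr closure_subset by blast
    moreover have "snd (F x) \<noteq> 0" using zero_closure x by blast
    ultimately show "x \<in> W \<inter> {x. snd (F x) < 0}" using x by auto
  qed (use neg_closure Wr in blast)
  also have "\<dots> = \<Phi> ` (ball q d1 \<times> {-d2<..<0})"
  proof (intro equalityI subsetI)
    fix x assume "x \<in> W \<inter> {x. snd (F x) < 0}"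
    then have "F x \<in> ball q d1 \<times> {-d2<..<0}" by (auto simp: W_def V_def mem_Times_iff dist_real_def)
    then show "x \<in> \<Phi> ` (ball q d1 \<times> {-d2<..<0})" using \<Phi>F by (metis image_eqI)
  qed (use d2 in \<open>auto simp: W\<Phi> inV F\<Phi>\<close>)
  finally have "W - closure D = \<Phi> ` (ball q d1 \<times> {-d2<..<0})" .
  moreover have "connected (ball q d1 \<times> {-d2<..<0::real})"
    by (intro convex_connected convex_Times convex_ball) simp
  ultimately have conn: "connected (W - closure D)" using connected_continuous_image[OF c\<Phi>] by metis
  have Wfr: "W \<inter> frontier D \<subseteq> W \<inter> {x. snd (F x) = 0}"
  proof
    fix x assume x: "x \<in> W \<inter> frontier D"
    then have "x \<notin> D" "x \<in> closure D" using D by (auto simp: frontier_def interior_open)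
    then show "x \<in> W \<inter> {x. snd (F x) = 0}" using DF Wr neg_closure x by force
  qed
  have "W \<inter> frontier D \<subseteq> closure (W - closure D)" using Wfr zero_closure WcD by auto
  moreover have "negligible (W \<inter> frontier D)"
  proof (rule negligible_subset)
    show "negligible ((\<lambda>w. \<Phi> (w, 0)) ` UNIV)"
    proof (rule negligible_differentiable_image_lowdim)
      have vn: "(\<lambda>w::real^2. w $ i) differentiable (at w)" for i w
        by (rule bounded_linear_imp_differentiable[OF bounded_linear_vec_nth])
      have gd: "\<gamma> differentiable (at w)" for w using Cinf_has_derivative[OF \<gamma>] differentiable_def by blast
      have "(\<lambda>w. em w (\<gamma> w + 0)) differentiable (at w)" for w
        unfolding em_def by (intro differentiable_add differentiable_scaleR differentiable_const vn gd)
      then have "(\<lambda>w. \<Phi> (w, 0)) differentiable (at w)" for w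
        unfolding \<Phi>_def using differentiable_compose[of Ti "\<lambda>w. em w (\<gamma> w + 0)" w UNIV] bounded_linear_imp_differentiable[OF lTi]
        by auto
      then show "(\<lambda>w. \<Phi> (w, 0)) differentiable_on UNIV" by (simp add: differentiable_on_def)
    qed simp
    show "W \<inter> frontier D \<subseteq> (\<lambda>w. \<Phi> (w, 0)) ` UNIV"
    proof
      fix x assume "x \<in> W \<inter> frontier D"
      then have "snd (F x) = 0" using Wfr by blast
      then have "x = \<Phi> (fst (F x), 0)" using \<Phi>F[of x] by (metis prod.collapse)
      then show "x \<in> (\<lambda>w. \<Phi> (w, 0)) ` UNIV" by blast
    qed
  qed
  ultimately have "boundary_chart D p W" unfolding boundary_chart_def using oW pW conn by blast
  moreover have "W \<subseteq> ball p e" using Wsub by auto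
  ultimately show ?thesis using that by blast
qed

lemma boundary_chart_translation:
  assumes "boundary_chart A p W" shows "boundary_chart ((+) a ` A) (a + p) ((+) a ` W)"
proof -
  have fr: "frontier ((+) a ` A) = (+) a ` frontier A" by (rule frontier_translation)
  have cl: "closure ((+) a ` S) = (+) a ` closure S" for S by (rule closure_translation)
  have df: "(+) a ` W - (+) a ` closure A = (+) a ` (W - closure A)" by (simp add: translation_diff)
  have co: "connected ((+) a ` S)" if "connected S" for S
    using that by (intro connected_continuous_image continuous_intros)
  have it: "(+) a ` W \<inter> (+) a ` frontier A = (+) a ` (W \<inter> frontier A)" by (simp add: translation_Int)
  show ?thesis
    using assms unfolding boundary_chart_def fr cl df it
    by (auto intro: open_translation co negligible_translation)
qed

text \<open>
  \<open>Z\<close> stands for the interior of the zero set of \<open>v\<close>.  The last assumption is unique continuation in the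
  form in which it is available: \<open>Z\<close> spreads over a ball which, up to \<open>Z\<close> itself and a null set,
  consists of a single material, that is, of a member of the family or of the complement of all members.

  Suppose that \<open>Z\<close> has boundary points.  None of them lies in a member of the family.  Take a boundary
  point \<open>p\<close> that lies on the boundary of as few members as possible.  By minimality and local finiteness,
  near \<open>p\<close> the boundary of \<open>Z\<close> is contained in the boundary of each of these members.  Let \<open>A\<close> be one of them.
  Near \<open>p\<close> the two sides of the boundary of \<open>A\<close> are connected and disjoint from the boundary of \<open>Z\<close>, so
  exactly one of them is in \<open>Z\<close>.  If \<open>A\<close> is the only member at \<open>p\<close>, its outside near \<open>p\<close> is one material.
  If there is another one, \<open>B\<close>, then near \<open>p\<close> the boundary of \<open>A\<close>, which is now the boundary of \<open>Z\<close>, is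
  contained in that of \<open>B\<close>; therefore \<open>A\<close> fills the outside of \<open>B\<close> near \<open>p\<close>.  In all cases a
  neighbourhood of \<open>p\<close> consists of \<open>Z\<close>, one further material and a null set, and \<open>Z\<close> spreads across \<open>p\<close>.
\<close>

theorem zero_set_spreads:
  fixes Z :: "(real^3) set" and \<F> :: "(real^3) set set"
  assumes op: "\<And>A. A \<in> \<F> \<Longrightarrow> open A" and co: "\<And>A. A \<in> \<F> \<Longrightarrow> connected A"
    and dj: "\<And>A B. A \<in> \<F> \<Longrightarrow> B \<in> \<F> \<Longrightarrow> A \<noteq> B \<Longrightarrow> A \<inter> B = {}"
    and lf: "\<And>K. bounded K \<Longrightarrow> finite {A \<in> \<F>. A \<inter> K \<noteq> {}}"
    and ch: "\<And>A p e. A \<in> \<F> \<Longrightarrow> p \<in> frontier A \<Longrightarrow> e > 0 \<Longrightarrow> \<exists>W\<subseteq>ball p e. boundary_chart A p W"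
    and Z: "open Z" "Z \<noteq> {}"
    and spread: "\<And>M x R. M \<in> insert (- \<Union>\<F>) \<F> \<Longrightarrow> x \<in> Z \<Longrightarrow> negligible (ball x R - M - Z) \<Longrightarrow> ball x R \<subseteq> Z"
  shows "Z = UNIV"
proof (rule ccontr)
  assume "Z \<noteq> UNIV"
  then have F: "frontier Z \<noteq> {}" using Z(2) frontier_eq_empty by blast
  have not_in: "p \<notin> Z" if "p \<in> frontier Z" for p using that Z(1) by (auto simp: frontier_def interior_open)
  have prop': False if p: "p \<in> frontier Z" and W: "open W" "p \<in> W" and M: "M \<in> insert (- \<Union>\<F>) \<F>"
    and neg: "negligible (W - M - Z)" for p W M
  proof -
    obtain d where d: "d > 0" "ball p d \<subseteq> W" using W openE by blast
    have "p \<in> closure Z" using p by (simp add: frontier_def)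
    then obtain x where x: "x \<in> Z" "dist x p < d / 2" using d(1) closure_approachable[of p Z] half_gt_zero by blast
    have "ball x (d/2) \<subseteq> ball p d"
    proof
      fix y assume "y \<in> ball x (d/2)"
      then show "y \<in> ball p d" using x(2) dist_triangle[of p y x] by (simp add: dist_commute)
    qed
    then have "negligible (ball x (d/2) - M - Z)" using d(2) by (intro negligible_subset[OF neg]) blast
    then have "ball x (d/2) \<subseteq> Z" using spread M x(1) by blast
    then have "p \<in> Z" using x(2) by auto
    then show False using not_in p by blast
  qed
  define N where "N p = {A \<in> \<F>. p \<in> frontier A}" for p
  have nA: "A \<inter> frontier Z = {}" if "A \<in> \<F>" for A
    using prop'[of _ A A] op that by (auto simp: negligible_empty)
  have finB: "finite {A \<in> \<F>. A \<inter> ball p 1 \<noteq> {}}" for p by (rule lf) simp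
  have meets: "A \<inter> U \<noteq> {}" if "p \<in> closure A" "open U" "p \<in> U" for A U and p :: "real^3"
    using that open_Int_closure_eq_empty[of U A] by blast
  have Nsub: "N p \<subseteq> {A \<in> \<F>. A \<inter> ball p 1 \<noteq> {}}" for p
    unfolding N_def using meets[of p _ "ball p 1"] by (auto simp: frontier_def)
  have finN: "finite (N p)" for p by (rule finite_subset[OF Nsub finB])
  have nbhd: "\<exists>e>0. \<forall>A\<in>\<F>. A \<inter> ball p e \<noteq> {} \<longrightarrow> A \<in> N p" if p: "p \<in> frontier Z" for p
  proof -
    let ?B = "{A \<in> \<F>. A \<inter> ball p 1 \<noteq> {}} - N p"
    have "p \<notin> \<Union>(closure ` ?B)"
    proof
      assume "p \<in> \<Union>(closure ` ?B)"
      then obtain A where A: "A \<in> \<F>" "A \<notin> N p" "p \<in> closure A" by blast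
      then have "p \<in> A" using op by (auto simp: N_def frontier_def interior_open)
      then show False using nA A(1) p by blast
    qed
    moreover have "closed (\<Union>(closure ` ?B))" using finB by (intro closed_Union) auto
    ultimately have "open (- \<Union>(closure ` ?B))" "p \<in> - \<Union>(closure ` ?B)"
      using open_Compl by blast+
    then obtain e where e: "e > 0" "ball p e \<subseteq> - \<Union>(closure ` ?B)" using openE by blast
    have "A \<in> N p" if A: "A \<in> \<F>" "A \<inter> ball p (min e 1) \<noteq> {}" for A
    proof (rule ccontr)
      assume "A \<notin> N p"
      then have "A \<in> ?B" using A by auto
      then have "ball p e \<inter> A = {}" using e(2) closure_subset by blast
      then show False using A(2) by auto
    qed
    then show ?thesis using e(1) by (intro exI[of _ "min e 1"]) auto
  qed
  obtain p where p: "p \<in> frontier Z" and pmin: "\<And>q. q \<in> frontier Z \<Longrightarrow> card (N p) \<le> card (N q)"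
  proof -
    obtain p0 where "p0 \<in> frontier Z" using F by blast
    from ex_has_least_nat[of "\<lambda>p. p \<in> frontier Z", OF this, of "\<lambda>p. card (N p)"] show ?thesis using that by blast
  qed
  obtain e where e: "e > 0" "\<And>A. A \<in> \<F> \<Longrightarrow> A \<inter> ball p e \<noteq> {} \<Longrightarrow> A \<in> N p" using nbhd[OF p] by blast
  have FB: "frontier Z \<inter> ball p e \<subseteq> frontier A" if A: "A \<in> N p" for A
  proof
    fix q assume q: "q \<in> frontier Z \<inter> ball p e"
    have "N q \<subseteq> N p"
    proof
      fix A assume A: "A \<in> N q"
      then have "A \<inter> ball p e \<noteq> {}" using q meets[of q A "ball p e"] by (auto simp: N_def frontier_def)
      then show "A \<in> N p" using A e(2) by (auto simp: N_def)
    qed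
    then have "N q = N p" using pmin q finN by (intro card_seteq) auto
    then show "q \<in> frontier A" using A by (auto simp: N_def)
  qed
  have "N p \<noteq> {}"
  proof
    assume "N p = {}"
    then have "ball p e - (- \<Union>\<F>) - Z = {}" using e(2) by blast
    then show False using prop'[OF p, of "ball p e" "- \<Union>\<F>"] e(1) by (simp add: negligible_empty)
  qed
  then obtain A where A: "A \<in> N p" by blast
  then have A\<F>: "A \<in> \<F>" and pA: "p \<in> frontier A" by (auto simp: N_def)
  obtain W where Wb: "W \<subseteq> ball p e" and W: "boundary_chart A p W" using ch[OF A\<F> pA e(1)] by blast
  define O1 where "O1 = W - closure A"
  have oW: "open W" and pW: "p \<in> W" and cO: "connected O1" and frO: "W \<inter> frontier A \<subseteq> closure O1"
    and ng: "negligible (W \<inter> frontier A)"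
    using W by (auto simp: boundary_chart_def O1_def)
  have Wsplit: "W \<subseteq> A \<union> O1 \<union> (W \<inter> frontier A)"
    using op[OF A\<F>] by (auto simp: O1_def frontier_def interior_open)
  have dich: "S \<subseteq> Z \<or> S \<inter> Z = {}" if "connected S" "S \<inter> frontier Z = {}" for S
    using connected_Int_frontier[of S Z] that by blast
  have A_dich: "A \<subseteq> Z \<or> A \<inter> Z = {}" using dich co A\<F> nA by blast
  have "O1 \<inter> frontier Z = {}"
    using FB[OF A] Wb by (auto simp: O1_def frontier_def)
  then have O_dich: "O1 \<subseteq> Z \<or> O1 \<inter> Z = {}" using dich cO by blast
  have Amem: "A \<in> insert (- \<Union>\<F>) \<F>" using A\<F> by simp
  have not_both: "\<not> (A \<subseteq> Z \<and> O1 \<subseteq> Z)"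
  proof
    assume "A \<subseteq> Z \<and> O1 \<subseteq> Z"
    then have "W - A - Z \<subseteq> W \<inter> frontier A" using Wsplit by blast
    then show False using prop'[OF p oW pW Amem] ng negligible_subset by blast
  qed
  have not_neither: "A \<subseteq> Z \<or> O1 \<subseteq> Z"
  proof (rule ccontr)
    assume "\<not> (A \<subseteq> Z \<or> O1 \<subseteq> Z)"
    then have "A \<inter> Z = {}" "O1 \<inter> Z = {}" using A_dich O_dich by auto
    then have "W \<inter> Z \<subseteq> frontier A" using Wsplit by blast
    moreover obtain z where z: "z \<in> W \<inter> Z" using meets[of p Z W] oW pW p by (auto simp: frontier_def)
    ultimately have "z \<in> closure A" by (auto simp: frontier_def)
    then have "A \<inter> (W \<inter> Z) \<noteq> {}" using meets oW Z(1) z by blast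
    then show False using \<open>A \<inter> Z = {}\<close> by blast
  qed
  show False
  proof (cases "N p = {A}")
    case True
    have only: "W \<inter> B = {}" if "B \<in> \<F>" "B \<noteq> A" for B using e(2)[of B] that Wb True by blast
    show False
    proof (cases "A \<subseteq> Z")
      case True
      then have "W - (- \<Union>\<F>) - Z = {}" using only by blast
      then show False using prop'[OF p oW pW, of "- \<Union>\<F>"] by (simp add: negligible_empty)
    next
      case False
      then have "W - A - Z \<subseteq> W \<inter> frontier A" using Wsplit not_neither by blast
      then show False using prop'[OF p oW pW Amem] ng negligible_subset by blast
    qed
  next
    case False
    then obtain B where B: "B \<in> N p" "B \<noteq> A" using A by blast
    then have B\<F>: "B \<in> \<F>" and pB: "p \<in> frontier B" by (auto simp: N_def)
    have AB: "A \<inter> closure B = {}" "B \<inter> closure A = {}"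
      using dj[OF A\<F> B\<F>] B(2) op A\<F> B\<F> by (metis Int_commute open_Int_closure_eq_empty)+
    \<comment> \<open>One side of the boundary of \<open>A\<close> is in \<open>Z\<close> and the other is disjoint from \<open>Z\<close>.\<close>
    have WF: "W \<inter> frontier A \<subseteq> frontier Z"
    proof
      fix q assume q: "q \<in> W \<inter> frontier A"
      then have cl: "q \<in> closure A" "q \<in> closure O1" using frO by (auto simp: frontier_def)
      show "q \<in> frontier Z"
      proof (cases "A \<subseteq> Z")
        case True
        then have "O1 \<inter> Z = {}" using not_both O_dich by blast
        then have "q \<notin> Z" using meets[OF cl(2) Z(1)] by blast
        moreover have "q \<in> closure Z" using cl(1) True closure_mono by blast
        ultimately show ?thesis using Z(1) by (simp add: frontier_def interior_open)
      next
        case False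
        then have "A \<inter> Z = {}" "O1 \<subseteq> Z" using A_dich not_neither by auto
        then have "q \<notin> Z" using meets[OF cl(1) Z(1)] by blast
        moreover have "q \<in> closure Z" using cl(2) \<open>O1 \<subseteq> Z\<close> closure_mono by blast
        ultimately show ?thesis using Z(1) by (simp add: frontier_def interior_open)
      qed
    qed
    then have WB: "W \<inter> frontier A \<subseteq> frontier B" using FB[OF B(1)] Wb by blast
    obtain e' where e': "e' > 0" "ball p e' \<subseteq> W" using oW pW openE by blast
    obtain V where Vb: "V \<subseteq> ball p e'" and V: "boundary_chart B p V" using ch[OF B\<F> pB e'(1)] by blast
    have oV: "open V" and pV: "p \<in> V" and cV: "connected (V - closure B)" and ngV: "negligible (V \<inter> frontier B)"
      using V by (auto simp: boundary_chart_def)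
    have "A \<inter> V \<noteq> {}" using meets[of p A V] oV pV pA by (auto simp: frontier_def)
    then have "(V - closure B) \<inter> A \<noteq> {}" using AB(1) by blast
    moreover have "(V - closure B) \<inter> frontier A = {}" using WB Vb e'(2) by (auto simp: frontier_def)
    \<comment> \<open>The outside of \<open>B\<close> is connected, meets \<open>A\<close> and does not meet the boundary of \<open>A\<close>.\<close>
    ultimately have "V - closure B \<subseteq> A" using connected_Int_frontier[OF cV, of A] by blast
    then have Vsplit: "V \<subseteq> A \<union> B \<union> (V \<inter> frontier B)"
      using op[OF B\<F>] by (auto simp: frontier_def interior_open)
    have ngsub: "negligible S" if "S \<subseteq> V \<inter> frontier B" for S using ngV negligible_subset that by blast
    show False
    proof (cases "A \<subseteq> Z")
      case True
      then have "V - B - Z \<subseteq> V \<inter> frontier B" using Vsplit by blast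
      then show False using prop'[OF p oV pV, of B] B\<F> ngsub by blast
    next
      case False
      then have "O1 \<subseteq> Z" using not_neither by blast
      moreover have "B \<inter> V \<subseteq> O1" using AB(2) Vb e'(2) by (auto simp: O1_def)
      ultimately have "V - A - Z \<subseteq> V \<inter> frontier B" using Vsplit by blast
      then show False using prop'[OF p oV pV, of A] A\<F> ngsub by blast
    qed
  qed
qed

section \<open>Separation of the time variable\<close>

lemma times_null_lebesgue:
  assumes "N \<in> null_sets (lborel :: 'a::euclidean_space measure)"
  shows "N \<times> UNIV \<in> null_sets (lborel :: ('a \<times> 'b::euclidean_space) measure)"
    "UNIV \<times> N \<in> null_sets (lborel :: ('b \<times> 'a) measure)"
  using lborel.times_in_null_sets1[of N lborel "UNIV :: 'b set"] lborel.times_in_null_sets2[of "UNIV :: 'b set" lborel N] assms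
  by (simp_all add: lborel_prod)

lemma measurable_fst_lebesgue:
  "fst \<in> (lebesgue :: ('a::euclidean_space \<times> 'b::euclidean_space) measure) \<rightarrow>\<^sub>M (lebesgue :: 'a measure)"
proof (rule measurableI)
  fix A :: "'a set" assume "A \<in> sets lebesgue"
  then obtain S N N' where A: "A = S \<union> N" "N \<subseteq> N'" "N' \<in> null_sets lborel" "S \<in> sets lborel"
    by (elim sets_completionE)
  have "S \<times> UNIV \<in> sets (lborel :: ('a \<times> 'b) measure)"
    using A(4) by (metis lborel_prod pair_measureI sets_lborel space_borel sets.top)
  then have "A \<times> (UNIV :: 'b set) \<in> sets lebesgue"
    using A times_null_lebesgue(1)[OF A(3)]
    by (intro sets_completionI[of _ "S \<times> UNIV" "N \<times> UNIV" "N' \<times> UNIV"]) auto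
  moreover have "fst -` A \<inter> space (lebesgue :: ('a \<times> 'b) measure) = A \<times> UNIV" by auto
  ultimately show "fst -` A \<inter> space lebesgue \<in> sets (lebesgue :: ('a \<times> 'b) measure)" by simp
qed simp

lemma measurable_snd_lebesgue:
  "snd \<in> (lebesgue :: ('a::euclidean_space \<times> 'b::euclidean_space) measure) \<rightarrow>\<^sub>M (lebesgue :: 'b measure)"
proof (rule measurableI)
  fix A :: "'b set" assume "A \<in> sets lebesgue"
  then obtain S N N' where A: "A = S \<union> N" "N \<subseteq> N'" "N' \<in> null_sets lborel" "S \<in> sets lborel"
    by (elim sets_completionE)
  have "UNIV \<times> S \<in> sets (lborel :: ('a \<times> 'b) measure)"
    using A(4) by (metis lborel_prod pair_measureI sets_lborel space_borel sets.top)
  then have "(UNIV :: 'a set) \<times> A \<in> sets lebesgue"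
    using A times_null_lebesgue(2)[OF A(3)]
    by (intro sets_completionI[of _ "UNIV \<times> S" "UNIV \<times> N" "UNIV \<times> N'"]) auto
  moreover have "snd -` A \<inter> space (lebesgue :: ('a \<times> 'b) measure) = UNIV \<times> A" by auto
  ultimately show "snd -` A \<inter> space lebesgue \<in> sets (lebesgue :: ('a \<times> 'b) measure)" by simp
qed simp

lemma AE_fst_snd:
  shows "(AE x in lebesgue. P x) \<Longrightarrow> (AE z in (lebesgue :: ('a::euclidean_space \<times> 'b::euclidean_space) measure). P (fst z))"
    and "(AE t in lebesgue. Q t) \<Longrightarrow> (AE z in (lebesgue :: ('a::euclidean_space \<times> 'b::euclidean_space) measure). Q (snd z))"
proof -
  assume "AE x in lebesgue. P x"
  then obtain N0 where N0: "{x. \<not> P x} \<subseteq> N0" "N0 \<in> null_sets lebesgue"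
    unfolding eventually_ae_filter by auto
  then obtain N where N: "{x. \<not> P x} \<subseteq> N" "N \<in> null_sets lborel"
    using null_sets_completion_iff2[of N0 lborel] by blast
  then show "AE z in (lebesgue :: ('a \<times> 'b) measure). P (fst z)"
    by (intro AE_completion AE_I'[OF times_null_lebesgue(1)[OF N(2)]]) auto
next
  assume "AE t in lebesgue. Q t"
  then obtain N0 where N0: "{x. \<not> Q x} \<subseteq> N0" "N0 \<in> null_sets lebesgue"
    unfolding eventually_ae_filter by auto
  then obtain N where N: "{x. \<not> Q x} \<subseteq> N" "N \<in> null_sets lborel"
    using null_sets_completion_iff2[of N0 lborel] by blast
  then show "AE z in (lebesgue :: ('a \<times> 'b) measure). Q (snd z)"
    by (intro AE_completion AE_I'[OF times_null_lebesgue(2)[OF N(2)]]) auto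
qed

lemma ex_borel_complex:
  fixes f :: "'a::euclidean_space \<Rightarrow> complex"
  assumes "f \<in> borel_measurable lebesgue"
  obtains f' where "f' \<in> borel_measurable lborel" "AE x in lebesgue. f x = f' x"
proof -
  have "(\<lambda>x. Re (f x)) \<in> borel_measurable lebesgue" "(\<lambda>x. Im (f x)) \<in> borel_measurable lebesgue"
    using assms by (auto intro: borel_measurable_Re borel_measurable_Im measurable_compose)
  then have "\<exists>a\<in>borel_measurable lborel. AE x in lborel. Re (f x) = a x"
      "\<exists>b\<in>borel_measurable lborel. AE x in lborel. Im (f x) = b x"
    using completion_ex_borel_measurable_real by blast+
  then obtain a b where ab: "a \<in> borel_measurable lborel" "AE x in lborel. Re (f x) = a x"
     "b \<in> borel_measurable lborel" "AE x in lborel. Im (f x) = b x" by blast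
  show ?thesis
  proof (rule that[of "\<lambda>x. Complex (a x) (b x)"])
    have "(\<lambda>x. complex_of_real (a x) + \<i> * complex_of_real (b x)) \<in> borel_measurable lborel"
    proof -
      have "complex_of_real \<in> borel_measurable borel"
        by (intro borel_measurable_continuous_onI continuous_intros)
      then have "(\<lambda>x. complex_of_real (a x)) \<in> borel_measurable lborel" "(\<lambda>x. complex_of_real (b x)) \<in> borel_measurable lborel"
        using ab measurable_compose by blast+
      then show ?thesis by (intro borel_measurable_add borel_measurable_times borel_measurable_const)
    qed
    then show "(\<lambda>x. Complex (a x) (b x)) \<in> borel_measurable lborel" by (simp add: Complex_eq)
    have "AE x in lborel. f x = Complex (a x) (b x)" using ab(2,4) by eventually_elim (simp add: complex_eq_iff)
    then show "AE x in lebesgue. f x = Complex (a x) (b x)" by (rule AE_completion)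
  qed
qed

text \<open>
  Fubini for products of functions of one factor each.  Completion does not commute with products of
  measures, so both factors are first replaced by Borel functions equal to them almost everywhere.
\<close>

lemma product_integral:
  fixes f :: "'a::euclidean_space \<Rightarrow> complex" and g :: "'b::euclidean_space \<Rightarrow> complex"
  assumes f: "integrable lebesgue f" and g: "integrable lebesgue g"
  shows "integrable lebesgue (\<lambda>z. f (fst z) * g (snd z))"
    and "(LINT z|lebesgue. f (fst z) * g (snd z)) = (LINT x|lebesgue. f x) * (LINT t|lebesgue. g t)"
proof -
  have fm: "f \<in> borel_measurable lebesgue" and gm: "g \<in> borel_measurable lebesgue" using f g by auto
  obtain f' where f': "f' \<in> borel_measurable lborel" "AE x in lebesgue. f x = f' x" using ex_borel_complex[OF fm] .
  obtain g' where g': "g' \<in> borel_measurable lborel" "AE x in lebesgue. g x = g' x" using ex_borel_complex[OF gm] .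
  have m': "f' \<in> borel_measurable lebesgue" "g' \<in> borel_measurable lebesgue"
    using f'(1) g'(1) measurable_completion by blast+
  have "integrable lebesgue f'" by (rule integrable_cong_AE_imp[OF f m'(1)]) (use f'(2) in auto)
  then have fi: "integrable lborel f'" using integrable_completion[OF f'(1)[simplified]] f'(1) by (simp add: integrable_completion)
  have "integrable lebesgue g'" by (rule integrable_cong_AE_imp[OF g m'(2)]) (use g'(2) in auto)
  then have gi: "integrable lborel g'" using g'(1) by (simp add: integrable_completion)
  have pm: "(\<lambda>z. f' (fst z) * g' (snd z)) \<in> borel_measurable (lborel \<Otimes>\<^sub>M lborel)"
    using f'(1) g'(1) by (intro borel_measurable_times measurable_compose[OF measurable_fst] measurable_compose[OF measurable_snd])
  have pi: "integrable (lborel \<Otimes>\<^sub>M lborel) (\<lambda>z. f' (fst z) * g' (snd z))"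
  proof (rule lborel_pair.Fubini_integrable[OF pm])
    have "integrable lborel (\<lambda>x. norm (f' x) * (LINT y|lborel. norm (g' y)))"
      using fi by (intro integrable_mult_left integrable_norm)
    then show "integrable lborel (\<lambda>x. LINT y|lborel. norm (f' (fst (x, y)) * g' (snd (x, y))))"
      by (simp add: norm_mult)
    show "AE x in lborel. integrable lborel (\<lambda>y. f' (fst (x, y)) * g' (snd (x, y)))"
      using gi by (intro AE_I2) simp
  qed
  have "(LINT z|(lborel \<Otimes>\<^sub>M lborel). f' (fst z) * g' (snd z)) = (LINT x|lborel. LINT y|lborel. f' x * g' y)"
    using lborel_pair.integral_fst'[OF pi] by simp
  also have "\<dots> = (LINT x|lborel. f' x) * (LINT y|lborel. g' y)" by simp
  finally have pe: "(LINT z|lborel. f' (fst z) * g' (snd z)) = (LINT x|lborel. f' x) * (LINT y|lborel. g' y)"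
    by (simp add: lborel_prod)
  have pm': "(\<lambda>z. f' (fst z) * g' (snd z)) \<in> borel_measurable (lborel :: ('a \<times> 'b) measure)"
    using pm by (simp add: lborel_prod)
  have ae: "AE z in lebesgue. f' (fst z) * g' (snd z) = f (fst z) * g (snd z)"
    using AE_fst_snd(1)[OF f'(2), where 'b='b] AE_fst_snd(2)[OF g'(2), where 'a='a] by eventually_elim simp
  have mm: "(\<lambda>z. f (fst z) * g (snd z)) \<in> borel_measurable (lebesgue :: ('a \<times> 'b) measure)"
    by (intro borel_measurable_times measurable_compose[OF measurable_fst_lebesgue fm] measurable_compose[OF measurable_snd_lebesgue gm])
  have il: "integrable lebesgue (\<lambda>z. f' (fst z) * g' (snd z))"
    using pi pm' by (simp add: integrable_completion lborel_prod)
  show "integrable lebesgue (\<lambda>z. f (fst z) * g (snd z))"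
    by (rule integrable_cong_AE_imp[OF il mm ae])
  have "(LINT z|lebesgue. f (fst z) * g (snd z)) = (LINT z|lebesgue. f' (fst z) * g' (snd z))"
    by (rule integral_cong_AE[OF mm borel_measurable_integrable[OF il]]) (use ae in \<open>auto elim: eventually_mono\<close>)
  also have "\<dots> = (LINT x|lborel. f' x) * (LINT y|lborel. g' y)"
    using pe pm' by (simp add: integral_completion)
  also have "(LINT x|lborel. f' x) = (LINT x|lebesgue. f x)"
    using integral_completion[OF f'(1)] integral_cong_AE[OF fm m'(1) f'(2)] by simp
  also have "(LINT x|lborel. g' x) = (LINT x|lebesgue. g x)"
    using integral_completion[OF g'(1)] integral_cong_AE[OF gm m'(2) g'(2)] by simp
  finally show "(LINT z|lebesgue. f (fst z) * g (snd z)) = (LINT x|lebesgue. f x) * (LINT t|lebesgue. g t)" .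
qed

lemma L1_loc_product:
  fixes f :: "'a::euclidean_space \<Rightarrow> complex" and g :: "'b::euclidean_space \<Rightarrow> complex"
  assumes f: "L1_loc f" and g: "L1_loc g"
  shows "L1_loc (\<lambda>z. f (fst z) * g (snd z))"
  unfolding L1_loc_def
proof (intro conjI allI impI)
  have fm: "f \<in> borel_measurable lebesgue" and gm: "g \<in> borel_measurable lebesgue" using f g by (auto simp: L1_loc_def)
  show "(\<lambda>z. f (fst z) * g (snd z)) \<in> borel_measurable lebesgue"
    by (intro borel_measurable_times measurable_compose[OF measurable_fst_lebesgue fm] measurable_compose[OF measurable_snd_lebesgue gm])
  fix K :: "('a \<times> 'b) set" assume K: "compact K"
  have c: "compact (fst ` K)" "compact (snd ` K)"
    using K by (auto intro!: compact_continuous_image continuous_intros)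
  have "integrable lebesgue (\<lambda>z. (indicat_real (fst ` K) (fst z) *\<^sub>R f (fst z)) * (indicat_real (snd ` K) (snd z) *\<^sub>R g (snd z)))"
    using f g c by (intro product_integral) (auto simp: L1_loc_def set_integrable_def)
  moreover have "K \<in> sets lebesgue" using K by (intro fmeasurableD lmeasurable_compact)
  ultimately have "integrable lebesgue (\<lambda>z. indicat_real K z *\<^sub>R ((indicat_real (fst ` K) (fst z) *\<^sub>R f (fst z)) * (indicat_real (snd ` K) (snd z) *\<^sub>R g (snd z))))"
    by (intro integrable_mult_indicator)
  moreover have "(\<lambda>z. indicat_real K z *\<^sub>R ((indicat_real (fst ` K) (fst z) *\<^sub>R f (fst z)) * (indicat_real (snd ` K) (snd z) *\<^sub>R g (snd z))))
     = (\<lambda>z. indicat_real K z *\<^sub>R (f (fst z) * g (snd z)))"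
    by (rule ext) (auto simp: indicator_def)
  ultimately show "set_integrable lebesgue K (\<lambda>z. f (fst z) * g (snd z))" unfolding set_integrable_def by simp
qed

lemma L1_loc_diff: "L1_loc f \<Longrightarrow> L1_loc g \<Longrightarrow> L1_loc (\<lambda>x. f x - g x)"
  by (auto simp: L1_loc_def intro!: set_integral_diff)

lemma L1_loc_add: "L1_loc f \<Longrightarrow> L1_loc g \<Longrightarrow> L1_loc (\<lambda>x. f x + g x)"
  by (auto simp: L1_loc_def intro!: set_integral_add)

lemma L1_loc_cmult: "L1_loc f \<Longrightarrow> L1_loc (\<lambda>x. c * f x)"
  by (auto simp: L1_loc_def intro!: set_integrable_mult_right)

definition tensor :: "('a::euclidean_space \<Rightarrow> complex) \<Rightarrow> ('b::euclidean_space \<Rightarrow> complex) \<Rightarrow> 'a \<times> 'b \<Rightarrow> complex" where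
  "tensor \<psi> \<eta> z = \<psi> (fst z) * \<eta> (snd z)"

lemma Cinf_tensor:
  assumes "Cinf \<psi>" "Cinf \<eta>" shows "Cinf (tensor \<psi> \<eta>)"
proof -
  have 1: "Ck k (\<lambda>z. \<psi> (fst z))" for k
    by (rule Ck_precompose_Basis[OF bounded_linear_fst _ CinfD[OF assms(1)]]) (auto simp: Basis_prod_def)
  have 2: "Ck k (\<lambda>z. \<eta> (snd z))" for k
    by (rule Ck_precompose_Basis[OF bounded_linear_snd _ CinfD[OF assms(2)]]) (auto simp: Basis_prod_def)
  show ?thesis unfolding tensor_def[abs_def] by (rule Cinf_mult[OF CinfI[OF 1] CinfI[OF 2]])
qed

lemma test_function_tensor:
  assumes "test_function \<psi>" "test_function \<eta>" shows "test_function (tensor \<psi> \<eta>)"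
proof (rule test_functionI)
  show "Cinf (tensor \<psi> \<eta>)" by (intro Cinf_tensor test_function_Cinf assms)
  show "bounded {z. tensor \<psi> \<eta> z \<noteq> 0}"
    by (rule bounded_subset[OF bounded_Times[OF test_function_bounded_support[OF assms(1)] test_function_bounded_support[OF assms(2)]]])
       (auto simp: tensor_def)
qed

lemma partial_tensor:
  assumes "Cinf \<psi>" "Cinf \<eta>"
  shows "partial (b, 0) (tensor \<psi> \<eta>) z = tensor (partial b \<psi>) \<eta> z"
    and "partial (0, c) (tensor \<psi> \<eta>) z = tensor \<psi> (partial c \<eta>) z"
proof -
  have d: "(tensor \<psi> \<eta> has_derivative (\<lambda>k. \<psi> (fst z) * frechet_derivative \<eta> (at (snd z)) (snd k)
      + frechet_derivative \<psi> (at (fst z)) (fst k) * \<eta> (snd z))) (at z)" for z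
    unfolding tensor_def[abs_def]
    by (rule has_derivative_mult[OF
          has_derivative_compose[OF has_derivative_fst[OF has_derivative_ident] Cinf_has_derivative[OF assms(1)]]
          has_derivative_compose[OF has_derivative_snd[OF has_derivative_ident] Cinf_has_derivative[OF assms(2)]]])
  have z: "frechet_derivative f (at y) 0 = 0" if "Cinf f" for f :: "'x::euclidean_space \<Rightarrow> complex" and y
    using Cinf_has_derivative[OF that] by (meson has_derivative_bounded_linear bounded_linear.linear linear_0)
  show "partial (b, 0) (tensor \<psi> \<eta>) z = tensor (partial b \<psi>) \<eta> z"
    by (simp add: partialI[OF d] z assms tensor_def)
  show "partial (0, c) (tensor \<psi> \<eta>) z = tensor \<psi> (partial c \<eta>) z"
    by (simp add: partialI[OF d] z assms tensor_def)
qed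

lemma cboxbump_Pair: "cboxbump (a, a') (b, b') n = tensor (cboxbump a b n) (cboxbump a' b' n)"
proof
  fix z :: "'a \<times> 'b"
  have disj: "(\<lambda>u. (u, 0)) ` Basis \<inter> Pair 0 ` Basis = ({} :: ('a \<times> 'b) set)" by auto
  have i1: "inj_on (\<lambda>u::'a. (u, 0::'b)) Basis" and i2: "inj_on (Pair (0::'a)) (Basis :: 'b set)" by (auto intro: inj_onI)
  have "boxbump (a, a') (b, b') n z = boxbump a b n (fst z) * boxbump a' b' n (snd z)"
    unfolding boxbump_def Basis_prod_def
    by (subst prod.union_disjoint[OF _ _ disj])
       (simp_all add: prod.reindex[OF i1] prod.reindex[OF i2] inner_prod_def)
  then show "cboxbump (a, a') (b, b') n z = tensor (cboxbump a b n) (cboxbump a' b' n) z"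
    by (simp add: tensor_def)
qed

lemma fundamental_lemma_tensor:
  fixes f :: "'a::euclidean_space \<times> 'b::euclidean_space \<Rightarrow> complex"
  assumes f: "L1_loc f"
    and zero: "\<And>\<psi> \<eta>. test_function \<psi> \<Longrightarrow> test_function \<eta> \<Longrightarrow> (LINT z|lebesgue. f z * tensor \<psi> \<eta> z) = 0"
  shows "AE z in lebesgue. f z = 0"
proof -
  have "(LINT x|lebesgue. f x * cboxbump a b n x) = 0" for a b :: "'a \<times> 'b" and n
  proof (cases a; cases b)
    fix p q p' q' assume "a = (p, q)" "b = (p', q')"
    then show ?thesis by (simp only: fun_cong[OF cboxbump_Pair] zero[OF test_function_cboxbump test_function_cboxbump])
  qed
  then have "AE z in lebesgue. z \<in> UNIV \<longrightarrow> f z = 0" by (intro fundamental_lemma_bump[OF f open_UNIV])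
  then show ?thesis by simp
qed

text \<open>
  Cutting the line at the time of the change produces the boundary terms from which the transmission
  condition arises.
\<close>

lemma half_line_integrals:
  fixes F F' :: "real \<Rightarrow> complex"
  assumes F: "\<And>t. (F has_vector_derivative F' t) (at t)" and F': "continuous_on UNIV F'"
    and M: "M > 0" "\<And>t. \<bar>t\<bar> \<ge> M \<Longrightarrow> F t = 0" "\<And>t. \<bar>t\<bar> \<ge> M \<Longrightarrow> F' t = 0"
  shows "(LINT t|lebesgue. indicat_real {0..} t *\<^sub>R F' t) = - F 0"
    and "(LINT t|lebesgue. indicat_real {..<0} t *\<^sub>R F' t) = F 0"
proof -
  have m: "F' \<in> borel_measurable borel" using F' by (rule borel_measurable_continuous_onI)
  have ftc: "(LINT t|lebesgue. indicat_real {a..b} t *\<^sub>R F' t) = F b - F a"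
    and int: "integrable lebesgue (\<lambda>t. indicat_real {a..b} t *\<^sub>R F' t)" if "a \<le> b" for a b
  proof -
    have "(\<lambda>t. indicat_real {a..b} t *\<^sub>R F' t) \<in> borel_measurable lborel" using m by simp
    moreover have "(LINT t|lborel. indicat_real {a..b} t *\<^sub>R F' t) = F b - F a"
      by (intro integral_FTC_atLeastAtMost that has_vector_derivative_at_within[OF F] continuous_on_subset[OF F']) simp
    moreover have "integrable lborel (\<lambda>t. indicat_real {a..b} t *\<^sub>R F' t)"
      by (intro borel_integrable_compact continuous_on_subset[OF F']) auto
    ultimately show "(LINT t|lebesgue. indicat_real {a..b} t *\<^sub>R F' t) = F b - F a"
      "integrable lebesgue (\<lambda>t. indicat_real {a..b} t *\<^sub>R F' t)"
      by (simp_all add: integral_completion integrable_completion)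
  qed
  have e1: "(\<lambda>t. indicat_real {0..} t *\<^sub>R F' t) = (\<lambda>t. indicat_real {0..M} t *\<^sub>R F' t)"
    using M by (auto simp: indicator_def fun_eq_iff)
  have e2: "(\<lambda>t. indicat_real {..<0} t *\<^sub>R F' t) = (\<lambda>t. indicat_real {-M..M} t *\<^sub>R F' t - indicat_real {0..M} t *\<^sub>R F' t)"
    using M by (auto simp: indicator_def fun_eq_iff)
  show "(LINT t|lebesgue. indicat_real {0..} t *\<^sub>R F' t) = - F 0"
    unfolding e1 using ftc[of 0 M] M by simp
  show "(LINT t|lebesgue. indicat_real {..<0} t *\<^sub>R F' t) = F 0"
    unfolding e2 using ftc[of 0 M] ftc[of "-M" M] M int[of "-M" M] int[of 0 M]
    by (subst Bochner_Integration.integral_diff) auto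
qed

definition half_exp :: "real set \<Rightarrow> complex \<Rightarrow> real \<Rightarrow> complex" where
  "half_exp J c t = indicat_real J t *\<^sub>R exp (c * complex_of_real t)"

lemma L1_loc_half_exp:
  assumes "J \<in> sets lebesgue" shows "L1_loc (half_exp J c)"
  unfolding L1_loc_def
proof (intro conjI allI impI)
  have m: "(\<lambda>t::real. exp (c * complex_of_real t)) \<in> borel_measurable lebesgue"
    by (intro continuous_lebesgue_measurable Cinf_continuous Cinf_exp)
  then show "half_exp J c \<in> borel_measurable lebesgue"
    unfolding half_exp_def[abs_def] using assms by (intro borel_measurable_scaleR borel_measurable_indicator)
  fix K :: "real set" assume K: "compact K"
  have "integrable lborel (\<lambda>t. indicat_real K t *\<^sub>R exp (c * complex_of_real t))"
    by (intro borel_integrable_compact K Cinf_continuous Cinf_exp)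
  then have "integrable lebesgue (\<lambda>t. indicat_real K t *\<^sub>R exp (c * complex_of_real t))"
    using integrable_completion[OF borel_measurable_integrable] by blast
  from integrable_mult_indicator[OF assms this]
  show "set_integrable lebesgue K (half_exp J c)"
    unfolding set_integrable_def half_exp_def by (simp add: mult.commute)
qed

lemma half_exp_parts:
  assumes \<eta>: "test_function \<eta>"
  shows "(LINT t|lebesgue. half_exp {0..} c t * partial 1 \<eta> t) = - \<eta> 0 - c * (LINT t|lebesgue. half_exp {0..} c t * \<eta> t)"
    and "(LINT t|lebesgue. half_exp {..<0} c t * partial 1 \<eta> t) = \<eta> 0 - c * (LINT t|lebesgue. half_exp {..<0} c t * \<eta> t)"
proof -
  define F where "F t = exp (c * complex_of_real t) * \<eta> t" for t :: real
  define F' where "F' t = exp (c * complex_of_real t) * partial 1 \<eta> t + c * exp (c * complex_of_real t) * \<eta> t" for t :: real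
  obtain \<eta>' where \<eta>': "Cinf \<eta>'" "\<And>x. (\<eta> has_vector_derivative \<eta>' x) (at x)" using Cinf_real_deriv[OF test_function_Cinf[OF \<eta>]] by blast
  have p: "partial 1 \<eta> t = \<eta>' t" for t using partialI[OF \<eta>'(2)[unfolded has_vector_derivative_def], of t 1] by simp
  note e = exp_has_vector_derivative[of c]
  have D: "(F has_vector_derivative F' t) (at t)" for t
    unfolding F_def[abs_def] F'_def p by (rule has_vector_derivative_mult[OF e \<eta>'(2)])
  have C: "continuous_on UNIV F'"
    unfolding F'_def[abs_def] p
    by (intro continuous_intros Cinf_continuous[OF \<eta>'(1)] Cinf_continuous[OF test_function_Cinf[OF \<eta>]])
  have "bounded (supp \<eta>)" using \<eta> by (intro bounded_closure test_function_bounded_support)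
  then obtain B where B: "\<And>t. t \<in> supp \<eta> \<Longrightarrow> \<bar>t\<bar> \<le> B" unfolding bounded_iff by (auto simp: real_norm_def)
  define M where "M = \<bar>B\<bar> + 1"
  have out: "t \<notin> supp \<eta>" if "\<bar>t\<bar> \<ge> M" for t using B[of t] that by (auto simp: M_def)
  have M: "M > 0" "\<And>t. \<bar>t\<bar> \<ge> M \<Longrightarrow> F t = 0" "\<And>t. \<bar>t\<bar> \<ge> M \<Longrightarrow> F' t = 0"
  proof -
    show "M > 0" by (simp add: M_def)
    fix t assume "\<bar>t\<bar> \<ge> M"
    note o = out[OF this]
    show "F t = 0" "F' t = 0" using zero_outside_supp[OF o] partial_zero_outside[OF o] by (simp_all add: F_def F'_def)
  qed
  note H = half_line_integrals[OF D C M]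
  have i: "integrable lebesgue (\<lambda>t. half_exp J c t * partial 1 \<eta> t)" "integrable lebesgue (\<lambda>t. half_exp J c t * \<eta> t)"
    if "J \<in> sets lebesgue" for J
    using L1_loc_half_exp[OF that] by (auto intro!: L1_loc_mult_test \<eta> test_function_partial)
  have s: "(LINT t|lebesgue. indicat_real J t *\<^sub>R F' t) = (LINT t|lebesgue. half_exp J c t * partial 1 \<eta> t) + c * (LINT t|lebesgue. half_exp J c t * \<eta> t)"
    if "J \<in> sets lebesgue" for J
  proof -
    have "(\<lambda>t. indicat_real J t *\<^sub>R F' t) = (\<lambda>t. half_exp J c t * partial 1 \<eta> t + c * (half_exp J c t * \<eta> t))"
      by (simp add: fun_eq_iff half_exp_def F'_def indicator_def)
    then show ?thesis using i[OF that] by simp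
  qed
  show "(LINT t|lebesgue. half_exp {0..} c t * partial 1 \<eta> t) = - \<eta> 0 - c * (LINT t|lebesgue. half_exp {0..} c t * \<eta> t)"
    using H(1) s[of "{0..}"] by (simp add: F_def algebra_simps)
  show "(LINT t|lebesgue. half_exp {..<0} c t * partial 1 \<eta> t) = \<eta> 0 - c * (LINT t|lebesgue. half_exp {..<0} c t * \<eta> t)"
    using H(2) s[of "{..<0}"] by (simp add: F_def algebra_simps)
qed

definition locally_bounded_measurable :: "('a::euclidean_space \<Rightarrow> complex) \<Rightarrow> bool" where
  "locally_bounded_measurable c \<longleftrightarrow> c \<in> borel_measurable lebesgue \<and> (\<forall>K. bounded K \<longrightarrow> (\<exists>B. \<forall>x\<in>K. norm (c x) \<le> B))"

lemma L1_loc_mult_bounded: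
  assumes f: "L1_loc f" and c: "locally_bounded_measurable c" shows "L1_loc (\<lambda>x. c x * f x)"
  unfolding L1_loc_def
proof (intro conjI allI impI)
  have m: "f \<in> borel_measurable lebesgue" "c \<in> borel_measurable lebesgue" using assms by (auto simp: L1_loc_def locally_bounded_measurable_def)
  then show "(\<lambda>x. c x * f x) \<in> borel_measurable lebesgue" by (intro borel_measurable_times)
  fix K :: "'a set" assume K: "compact K"
  then obtain B where B: "\<forall>x\<in>K. norm (c x) \<le> B" using c compact_imp_bounded unfolding locally_bounded_measurable_def by blast
  have i: "indicat_real K \<in> borel_measurable lebesgue" using K by (intro borel_measurable_indicator fmeasurableD lmeasurable_compact)
  have "(\<lambda>x. indicat_real K x *\<^sub>R c x) \<in> borel_measurable lebesgue" by (intro borel_measurable_scaleR i m)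
  then have "integrable lebesgue (\<lambda>x. f x * (indicat_real K x *\<^sub>R c x))"
    by (rule L1_loc_mult_integrable[OF f _ compact_imp_bounded[OF K], of _ B]) (use B in \<open>auto simp: indicator_def\<close>)
  then show "set_integrable lebesgue K (\<lambda>x. c x * f x)"
    unfolding set_integrable_def by (simp add: mult_ac scaleR_conv_of_real)
qed

lemma spacetime_Basis:
  "(0, 1) \<in> (Basis :: spacetime set)" "(axis i 1, 0) \<in> (Basis :: spacetime set)"
  by (auto simp: Basis_prod_def Basis_vec_def)

lemma AE_equal_of_tensor:
  fixes G H :: "'a::euclidean_space \<times> 'b::euclidean_space \<Rightarrow> complex"
  assumes G: "L1_loc G" and H: "L1_loc H"
    and eq: "\<And>\<psi> \<eta>. test_function \<psi> \<Longrightarrow> test_function \<eta> \<Longrightarrow>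
      (LINT z|lebesgue. G z * tensor \<psi> \<eta> z) = (LINT z|lebesgue. H z * tensor \<psi> \<eta> z)"
  shows "AE z in lebesgue. G z = H z"
proof -
  have "(LINT z|lebesgue. (G z - H z) * tensor \<psi> \<eta> z) = 0" if "test_function \<psi>" "test_function \<eta>" for \<psi> \<eta>
    using L1_loc_mult_test[OF G test_function_tensor[OF that]] L1_loc_mult_test[OF H test_function_tensor[OF that]] eq[OF that]
    by (simp add: left_diff_distrib)
  then have "AE z in lebesgue. G z - H z = 0" by (intro fundamental_lemma_tensor[OF L1_loc_diff[OF G H]])
  then show ?thesis by simp
qed

lemma tensor_integral:
  assumes "L1_loc f" "L1_loc g" "test_function \<psi>" "test_function \<eta>"
  shows "(LINT z|lebesgue. (f (fst z) * g (snd z)) * tensor \<psi> \<eta> z) = (LINT x|lebesgue. f x * \<psi> x) * (LINT t|lebesgue. g t * \<eta> t)"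
    and "integrable lebesgue (\<lambda>z. (f (fst z) * g (snd z)) * tensor \<psi> \<eta> z)"
proof -
  have e: "(\<lambda>z. (f (fst z) * g (snd z)) * tensor \<psi> \<eta> z) = (\<lambda>z. (f (fst z) * \<psi> (fst z)) * (g (snd z) * \<eta> (snd z)))"
    by (simp add: tensor_def fun_eq_iff mult_ac)
  note p = product_integral[OF L1_loc_mult_test[OF assms(1,3)] L1_loc_mult_test[OF assms(2,4)]]
  show "(LINT z|lebesgue. (f (fst z) * g (snd z)) * tensor \<psi> \<eta> z) = (LINT x|lebesgue. f x * \<psi> x) * (LINT t|lebesgue. g t * \<eta> t)"
    unfolding e by (rule p(2))
  show "integrable lebesgue (\<lambda>z. (f (fst z) * g (snd z)) * tensor \<psi> \<eta> z)" unfolding e by (rule p(1))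
qed

lemma one_sided_test:
  assumes J: "J \<in> sets lebesgue" and W: "open W" "W \<noteq> {}" "W \<subseteq> J" "W \<inter> J' = {}" "0 \<notin> W"
  obtains \<eta> :: "real \<Rightarrow> complex" where "test_function \<eta>" "\<eta> 0 = 0"
    "(LINT t|lebesgue. half_exp J c t * \<eta> t) \<noteq> 0" "(LINT t|lebesgue. half_exp J' c' t * \<eta> t) = 0"
proof -
  have "\<exists>a b n. cbox a b \<subseteq> W \<and> (LINT t|lebesgue. half_exp J c t * cboxbump a b n t) \<noteq> 0"
  proof (rule ccontr)
    assume "\<not> ?thesis"
    then have "AE t in lebesgue. t \<in> W \<longrightarrow> half_exp J c t = 0"
      by (intro fundamental_lemma_bump[OF L1_loc_half_exp[OF J] W(1)]) blast
    then have "AE t in lebesgue. t \<notin> W"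
      by eventually_elim (use W(3) in \<open>auto simp: half_exp_def\<close>)
    then have "negligible W"
      using W(1) by (subst negligible_iff_null_sets) (auto simp: AE_iff_null_sets)
    then show False using open_not_negligible W(1,2) by blast
  qed
  then obtain a b n where ab: "cbox a b \<subseteq> W" "(LINT t|lebesgue. half_exp J c t * cboxbump a b n t) \<noteq> 0" by blast
  have out: "cboxbump a b n t = 0" if "t \<notin> W" for t
  proof (rule ccontr)
    assume "cboxbump a b n t \<noteq> 0"
    then have "t \<in> box a b" using boxbump_nonzero[of a b n t] by auto
    then show False using that ab(1) box_subset_cbox[of a b] by blast
  qed
  have zz: "half_exp J' c' t * cboxbump a b n t = 0" for t
    using out[of t] W(4) by (cases "t \<in> W") (auto simp: half_exp_def indicator_def)
  have "(LINT t|lebesgue. half_exp J' c' t * cboxbump a b n t) = 0" unfolding zz by simp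
  then show ?thesis by (rule that[OF test_function_cboxbump out[OF W(5)] ab(2)])
qed

text \<open>
  The gradient of \<open>u\<close> is unique, so it is given by the gradient of \<open>v\<close> and the piecewise derivative of
  the time factor, which is continuous at \<open>t = 0\<close>.  With these the equation tested against
  \<open>\<psi>(x) \<eta>(t)\<close> becomes a linear relation between \<open>\<eta>(0)\<close> and the integrals of \<open>\<eta>\<close> against the two half
  exponentials.  Choosing \<open>\<eta>\<close> such that only one of the two integrals is non-zero and \<open>\<eta>(0) = 0\<close>, and
  then \<open>\<eta>\<close> with \<open>\<eta>(0) \<noteq> 0\<close>, shows that the three coefficients vanish.
\<close>

theorem separated_equations:
  fixes v :: "real^3 \<Rightarrow> complex" and w :: "real^3 \<Rightarrow> real^3 \<Rightarrow> complex"
  assumes sol: "weak_wave_solution (instantly_changing \<rho>m \<rho>p) (instantly_changing \<kappa>m \<kappa>p) u"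
    and u: "\<And>x t. u (x, t) = v x * exp (- \<i> * \<omega> t * complex_of_real t)"
    and \<omega>: "\<And>t. t < 0 \<Longrightarrow> \<omega> t = \<omega>m" "\<And>t. t > 0 \<Longrightarrow> \<omega> t = \<omega>p"
    and v: "L2_loc v" and w: "\<And>b. b \<in> Basis \<Longrightarrow> L2_loc (w b)" and vw: "has_weak_gradient v w"
    and c: "locally_bounded_measurable (\<lambda>x. 1 / \<rho>m x)" "locally_bounded_measurable (\<lambda>x. 1 / \<rho>p x)"
      "locally_bounded_measurable (\<lambda>x. 1 / \<kappa>m x)" "locally_bounded_measurable (\<lambda>x. 1 / \<kappa>p x)"
    and \<psi>: "test_function \<psi>"
  defines "S \<equiv> \<lambda>\<rho>. \<Sum>i\<in>UNIV. LINT x|lebesgue. (1 / \<rho> x * w (axis i 1) x) * partial (axis i 1) \<psi> x"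
    and "K \<equiv> \<lambda>\<kappa>. LINT x|lebesgue. (1 / \<kappa> x * v x) * \<psi> x"
  shows "S \<rho>m = \<omega>m^2 * K \<kappa>m" "S \<rho>p = \<omega>p^2 * K \<kappa>p" "\<omega>m * K \<kappa>m = \<omega>p * K \<kappa>p"
proof -
  define em where "em = half_exp {..<0} (- \<i> * \<omega>m)"
  define ep where "ep = half_exp {0..} (- \<i> * \<omega>p)"
  have em: "L1_loc em" and ep: "L1_loc ep" by (simp_all add: em_def ep_def L1_loc_half_exp)
  have vl: "L1_loc v" and wl: "\<And>b. b \<in> Basis \<Longrightarrow> L1_loc (w b)" using v w L2_loc_imp_L1_loc by blast+
  have em0: "t \<ge> 0 \<Longrightarrow> em t = 0" and ep0: "t < 0 \<Longrightarrow> ep t = 0" for t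
    by (simp_all add: em_def ep_def half_exp_def)
  have ue: "u z = v (fst z) * (em (snd z) + ep (snd z))" for z
  proof -
    obtain x t where z: "z = (x, t)" by (cases z)
    consider "t < 0" | "t = 0" | "t > 0" by linarith
    then show ?thesis
      by cases (simp_all add: z u \<omega> em_def ep_def half_exp_def)
  qed
  obtain g where g: "\<And>b. b \<in> Basis \<Longrightarrow> L2_loc (g b)" "has_weak_gradient u g"
    and eq: "\<And>\<phi>. test_function \<phi> \<Longrightarrow> (LINT z|lebesgue.
              - (1 / instantly_changing \<kappa>m \<kappa>p z) * g (0, 1) z * partial (0, 1) \<phi> z
              + (\<Sum>i\<in>UNIV. (1 / instantly_changing \<rho>m \<rho>p z) * g (axis i 1, 0) z * partial (axis i 1, 0) \<phi> z)) = 0"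
    using sol unfolding weak_wave_solution_def by blast
  have gl: "L1_loc (g b)" if "b \<in> Basis" for b using g(1) that L2_loc_imp_L1_loc by blast
  have wg: "(LINT z|lebesgue. u z * partial b \<phi> z) = - (LINT z|lebesgue. g b z * \<phi> z)"
    if "b \<in> Basis" "test_function \<phi>" for b \<phi> using g(2) that unfolding has_weak_gradient_def by blast
  have wv: "(LINT x|lebesgue. v x * partial b \<phi> x) = - (LINT x|lebesgue. w b x * \<phi> x)"
    if "b \<in> Basis" "test_function \<phi>" for b \<phi> using vw that unfolding has_weak_gradient_def by blast
  let ?e = "\<lambda>t. em t + ep t" and ?e' = "\<lambda>t. (- \<i> * \<omega>m) * em t + (- \<i> * \<omega>p) * ep t"
  have el: "L1_loc ?e" by (intro L1_loc_add em ep)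
  have el': "L1_loc ?e'" by (intro L1_loc_add L1_loc_cmult em ep)
  have grad_x: "AE z in lebesgue. g (axis i 1, 0) z = w (axis i 1) (fst z) * ?e (snd z)" for i :: 3
  proof (rule AE_equal_of_tensor)
    have b: "axis i (1::real) \<in> Basis" by (auto simp: Basis_vec_def)
    show "L1_loc (g (axis i 1, 0))" by (rule gl[OF spacetime_Basis(2)])
    show "L1_loc (\<lambda>z. w (axis i 1) (fst z) * ?e (snd z))" by (rule L1_loc_product[OF wl[OF b] el])
    fix \<psi> :: "real^3 \<Rightarrow> complex" and \<eta> :: "real \<Rightarrow> complex" assume t: "test_function \<psi>" "test_function \<eta>"
    have "(LINT z|lebesgue. g (axis i 1, 0) z * tensor \<psi> \<eta> z) = - (LINT z|lebesgue. u z * partial (axis i 1, 0) (tensor \<psi> \<eta>) z)"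
      using wg[OF spacetime_Basis(2) test_function_tensor[OF t]] by simp
    also have "\<dots> = - (LINT z|lebesgue. v (fst z) * ?e (snd z) * tensor (partial (axis i 1) \<psi>) \<eta> z)"
      using t by (simp only: ue partial_tensor(1)[OF test_function_Cinf test_function_Cinf])
    also have "\<dots> = - ((LINT x|lebesgue. v x * partial (axis i 1) \<psi> x) * (LINT t|lebesgue. ?e t * \<eta> t))"
      by (simp only: tensor_integral(1)[OF vl el test_function_partial[OF t(1) b] t(2)])
    also have "\<dots> = (LINT z|lebesgue. w (axis i 1) (fst z) * ?e (snd z) * tensor \<psi> \<eta> z)"
      unfolding tensor_integral(1)[OF wl[OF b] el t] wv[OF b t(1)] by simp
    finally show "(LINT z|lebesgue. g (axis i 1, 0) z * tensor \<psi> \<eta> z) = (LINT z|lebesgue. w (axis i 1) (fst z) * ?e (snd z) * tensor \<psi> \<eta> z)" .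
  qed
  have half: "(LINT t|lebesgue. em t * partial 1 \<eta> t) = \<eta> 0 + \<i> * \<omega>m * (LINT t|lebesgue. em t * \<eta> t)"
    "(LINT t|lebesgue. ep t * partial 1 \<eta> t) = - \<eta> 0 + \<i> * \<omega>p * (LINT t|lebesgue. ep t * \<eta> t)" if "test_function \<eta>" for \<eta>
    using half_exp_parts[OF that] by (simp_all add: em_def ep_def)
  have one: "(1::real) \<in> Basis" by simp
  have grad_t: "AE z in lebesgue. g (0, 1) z = v (fst z) * ?e' (snd z)"
  proof (rule AE_equal_of_tensor)
    show "L1_loc (g (0, 1))" by (rule gl[OF spacetime_Basis(1)])
    show "L1_loc (\<lambda>z. v (fst z) * ?e' (snd z))" by (rule L1_loc_product[OF vl el'])
    fix \<psi> :: "real^3 \<Rightarrow> complex" and \<eta> :: "real \<Rightarrow> complex" assume t: "test_function \<psi>" "test_function \<eta>"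
    note t' = test_function_partial[OF t(2) one]
    have "(LINT z|lebesgue. g (0, 1) z * tensor \<psi> \<eta> z) = - (LINT z|lebesgue. u z * partial (0, 1) (tensor \<psi> \<eta>) z)"
      using wg[OF spacetime_Basis(1) test_function_tensor[OF t]] by simp
    also have "\<dots> = - (LINT z|lebesgue. v (fst z) * ?e (snd z) * tensor \<psi> (partial 1 \<eta>) z)"
      using t by (simp only: ue partial_tensor(2)[OF test_function_Cinf test_function_Cinf])
    also have "\<dots> = - ((LINT x|lebesgue. v x * \<psi> x) * (LINT t|lebesgue. ?e t * partial 1 \<eta> t))"
      by (simp only: tensor_integral(1)[OF vl el t(1) t'])
    also have "(LINT t|lebesgue. ?e t * partial 1 \<eta> t) = (LINT t|lebesgue. em t * partial 1 \<eta> t) + (LINT t|lebesgue. ep t * partial 1 \<eta> t)"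
      using L1_loc_mult_test[OF em t'] L1_loc_mult_test[OF ep t'] by (simp add: distrib_right)
    also have "\<dots> = - (LINT t|lebesgue. ?e' t * \<eta> t)"
    proof -
      have "(LINT t|lebesgue. ?e' t * \<eta> t) = (LINT t|lebesgue. (- \<i> * \<omega>m) * (em t * \<eta> t) + (- \<i> * \<omega>p) * (ep t * \<eta> t))"
        by (simp add: algebra_simps)
      also have "\<dots> = (- \<i> * \<omega>m) * (LINT t|lebesgue. em t * \<eta> t) + (- \<i> * \<omega>p) * (LINT t|lebesgue. ep t * \<eta> t)"
        using L1_loc_mult_test[OF em t(2)] L1_loc_mult_test[OF ep t(2)]
        by (subst Bochner_Integration.integral_add) (auto intro!: integrable_mult_right)
      finally show ?thesis unfolding half[OF t(2)] by simp
    qed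
    also have "- ((LINT x|lebesgue. v x * \<psi> x) * - (LINT t|lebesgue. ?e' t * \<eta> t)) = (LINT z|lebesgue. v (fst z) * ?e' (snd z) * tensor \<psi> \<eta> z)"
      by (simp only: tensor_integral(1)[OF vl el' t] mult_minus_right minus_minus)
    finally show "(LINT z|lebesgue. g (0, 1) z * tensor \<psi> \<eta> z) = (LINT z|lebesgue. v (fst z) * ?e' (snd z) * tensor \<psi> \<eta> z)" .
  qed
  define Em where "Em \<eta> = (LINT t|lebesgue. em t * \<eta> t)" for \<eta>
  define Ep where "Ep \<eta> = (LINT t|lebesgue. ep t * \<eta> t)" for \<eta>
  have key: "Em \<eta> * (S \<rho>m - \<omega>m^2 * K \<kappa>m) + Ep \<eta> * (S \<rho>p - \<omega>p^2 * K \<kappa>p)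
      + \<i> * \<eta> 0 * (\<omega>m * K \<kappa>m - \<omega>p * K \<kappa>p) = 0" if \<eta>: "test_function \<eta>" for \<eta>
  proof -
    note t' = test_function_partial[OF \<eta> one]
    have b: "axis i (1::real) \<in> Basis" for i :: 3 by (auto simp: Basis_vec_def)
    note ti = test_function_partial[OF \<psi> b]
    define A where "A \<kappa> = (\<lambda>x. 1 / \<kappa> x * v x)" for \<kappa> :: "real^3 \<Rightarrow> complex"
    define B where "B \<rho> i = (\<lambda>x. 1 / \<rho> x * w (axis i 1) x)" for \<rho> :: "real^3 \<Rightarrow> complex" and i
    have Al: "L1_loc (A \<kappa>m)" "L1_loc (A \<kappa>p)" unfolding A_def using c vl L1_loc_mult_bounded by blast+
    have Bl: "L1_loc (B \<rho>m i)" "L1_loc (B \<rho>p i)" for i unfolding B_def using c wl[OF b] L1_loc_mult_bounded by blast+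
    have em': "L1_loc (\<lambda>t. \<i> * \<omega>m * em t)" and ep': "L1_loc (\<lambda>t. \<i> * \<omega>p * ep t)" by (intro L1_loc_cmult em ep)+
    let ?T1 = "\<lambda>z. (A \<kappa>m (fst z) * (\<i> * \<omega>m * em (snd z))) * tensor \<psi> (partial 1 \<eta>) z"
    let ?T2 = "\<lambda>z. (A \<kappa>p (fst z) * (\<i> * \<omega>p * ep (snd z))) * tensor \<psi> (partial 1 \<eta>) z"
    let ?U1 = "\<lambda>i z. (B \<rho>m i (fst z) * em (snd z)) * tensor (partial (axis i 1) \<psi>) \<eta> z"
    let ?U2 = "\<lambda>i z. (B \<rho>p i (fst z) * ep (snd z)) * tensor (partial (axis i 1) \<psi>) \<eta> z"
    let ?I = "\<lambda>z. - (1 / instantly_changing \<kappa>m \<kappa>p z) * g (0, 1) z * partial (0, 1) (tensor \<psi> \<eta>) z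
              + (\<Sum>i\<in>UNIV. (1 / instantly_changing \<rho>m \<rho>p z) * g (axis i 1, 0) z * partial (axis i 1, 0) (tensor \<psi> \<eta>) z)"
    let ?R = "\<lambda>z. ?T1 z + ?T2 z + (\<Sum>i\<in>UNIV. ?U1 i z + ?U2 i z)"
    note p1 = tensor_integral[OF Al(1) em' \<psi> t'] and p2 = tensor_integral[OF Al(2) ep' \<psi> t']
    note q1 = tensor_integral[OF Bl(1) em ti \<eta>] and q2 = tensor_integral[OF Bl(2) ep ti \<eta>]
    have "AE z in lebesgue. \<forall>i. g (axis i 1, 0) z = w (axis i 1) (fst z) * ?e (snd z)"
      unfolding AE_all_countable using grad_x by blast
    then have ae: "AE z in lebesgue. ?I z = ?R z"
      using grad_t
    proof eventually_elim
      case (elim z)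
      obtain x t where z: "z = (x, t)" by (cases z)
      have pt: "partial (0, 1) (tensor \<psi> \<eta>) z = tensor \<psi> (partial 1 \<eta>) z"
        "partial (axis i 1, 0) (tensor \<psi> \<eta>) z = tensor (partial (axis i 1) \<psi>) \<eta> z" for i :: 3
        by (simp_all only: partial_tensor[OF test_function_Cinf[OF \<psi>] test_function_Cinf[OF \<eta>]])
      show ?case
        unfolding pt elim(2) elim(1)[rule_format] A_def B_def
        by (cases "t < 0") (simp_all add: z instantly_changing_def em0 ep0 mult_ac)
    qed
    have ri: "integrable lebesgue ?R"
      by (intro Bochner_Integration.integrable_add Bochner_Integration.integrable_sum p1(2) p2(2) q1(2) q2(2))
    have ae': "AE z in lebesgue. ?R z = ?I z" using ae by eventually_elim simp
    have "(LINT z|lebesgue. ?R z) = (LINT z|lebesgue. ?I z)"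
      by (rule integral_cong_AE[OF borel_measurable_integrable[OF ri]
            borel_measurable_AE[OF borel_measurable_integrable[OF ri] ae'] ae'])
    then have R0: "(LINT z|lebesgue. ?R z) = 0" using eq[OF test_function_tensor[OF \<psi> \<eta>]] by simp
    have "(LINT z|lebesgue. ?R z) = (LINT z|lebesgue. ?T1 z) + (LINT z|lebesgue. ?T2 z)
        + (\<Sum>i\<in>UNIV. (LINT z|lebesgue. ?U1 i z) + (LINT z|lebesgue. ?U2 i z))"
      by (simp only: Bochner_Integration.integral_add[OF Bochner_Integration.integrable_add[OF p1(2) p2(2)]
            Bochner_Integration.integrable_sum[OF Bochner_Integration.integrable_add[OF q1(2) q2(2)]]]
            Bochner_Integration.integral_add[OF p1(2) p2(2)] Bochner_Integration.integral_add[OF q1(2) q2(2)]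
            Bochner_Integration.integral_sum[OF Bochner_Integration.integrable_add[OF q1(2) q2(2)]])
    also have "(LINT z|lebesgue. ?T1 z) = K \<kappa>m * (\<i> * \<omega>m * (\<eta> 0 + \<i> * \<omega>m * Em \<eta>))"
      unfolding p1(1) by (simp add: mult.assoc half(1)[OF \<eta>, unfolded mult.assoc] A_def K_def Em_def)
    also have "(LINT z|lebesgue. ?T2 z) = K \<kappa>p * (\<i> * \<omega>p * (- \<eta> 0 + \<i> * \<omega>p * Ep \<eta>))"
      unfolding p2(1) by (simp add: mult.assoc half(2)[OF \<eta>, unfolded mult.assoc] A_def K_def Ep_def)
    also have "(\<Sum>i\<in>UNIV. (LINT z|lebesgue. ?U1 i z) + (LINT z|lebesgue. ?U2 i z)) = S \<rho>m * Em \<eta> + S \<rho>p * Ep \<eta>"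
      by (simp only: q1(1) q2(1)) (simp only: S_def B_def Em_def Ep_def sum.distrib sum_distrib_right)
    finally have "K \<kappa>m * (\<i> * \<omega>m * (\<eta> 0 + \<i> * \<omega>m * Em \<eta>)) + K \<kappa>p * (\<i> * \<omega>p * (- \<eta> 0 + \<i> * \<omega>p * Ep \<eta>))
        + (S \<rho>m * Em \<eta> + S \<rho>p * Ep \<eta>) = 0" using R0 by simp
    moreover have "K \<kappa>m * (\<i> * \<omega>m * (\<eta> 0 + \<i> * \<omega>m * Em \<eta>)) = \<i> * \<eta> 0 * \<omega>m * K \<kappa>m - \<omega>m^2 * K \<kappa>m * Em \<eta>"
      by (simp add: algebra_simps power2_eq_square)
    moreover have "K \<kappa>p * (\<i> * \<omega>p * (- \<eta> 0 + \<i> * \<omega>p * Ep \<eta>)) = - (\<i> * \<eta> 0 * \<omega>p * K \<kappa>p) - \<omega>p^2 * K \<kappa>p * Ep \<eta>"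
      by (simp add: algebra_simps power2_eq_square)
    ultimately show ?thesis by (simp add: algebra_simps power2_eq_square)
  qed
  obtain \<eta>1 where e1: "test_function \<eta>1" "\<eta>1 0 = 0" "Ep \<eta>1 \<noteq> 0" "Em \<eta>1 = 0"
    by (rule one_sided_test[of "{0..}" "{0<..}" "{..<0}" "- \<i> * \<omega>p" "- \<i> * \<omega>m"]) (auto simp: Em_def Ep_def em_def ep_def)
  show S2: "S \<rho>p = \<omega>p^2 * K \<kappa>p" using key[OF e1(1)] e1 by simp
  obtain \<eta>2 where e2: "test_function \<eta>2" "\<eta>2 0 = 0" "Em \<eta>2 \<noteq> 0" "Ep \<eta>2 = 0"
    by (rule one_sided_test[of "{..<0}" "{..<0}" "{0..}" "- \<i> * \<omega>m" "- \<i> * \<omega>p"]) (auto simp: Em_def Ep_def em_def ep_def)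
  show S1: "S \<rho>m = \<omega>m^2 * K \<kappa>m" using key[OF e2(1)] e2 by simp
  have "cboxbump (-1) (1::real) 1 0 \<noteq> 0" by (simp add: boxbump_def flat_def)
  then show "\<omega>m * K \<kappa>m = \<omega>p * K \<kappa>p" using key[OF test_function_cboxbump[of "-1" "1::real" 1]] S1 S2 by simp
qed

section \<open>The coefficients of the material\<close>

definition resonator_family :: "(real^3) set \<Rightarrow> (real^3) set \<Rightarrow> (real^3) set set" where
  "resonator_family D1 D2 = (\<Union>m. {translate m D1, translate m D2})"

lemma Union_resonator_family: "\<Union>(resonator_family D1 D2) = resonators D1 D2"
  by (auto simp: resonator_family_def resonators_def)

lemma resonator_familyE:
  assumes "A \<in> resonator_family D1 D2"
  obtains m D where "A = translate m D" "D = D1 \<or> D = D2"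
  using assms by (auto simp: resonator_family_def)

lemma translate_eq: "translate m D = (+) (vector [of_int m, 0, 0]) ` D"
  by (simp add: translate_def add.commute)

lemma translate_coord:
  assumes "x \<in> translate m D"
  obtains y where "y \<in> D" "x $ 1 = y $ 1 + of_int m" "x $ 2 = y $ 2" "x = y + vector [of_int m, 0, 0]"
  using assms by (auto simp: translate_def vector_3)

lemma resonators_locally_finite:
  assumes "D1 \<subseteq> {x. 0 \<le> x $ 1 \<and> x $ 1 < 1}" "D2 \<subseteq> {x. 0 \<le> x $ 1 \<and> x $ 1 < 1}" "bounded K"
  shows "finite {A \<in> resonator_family D1 D2. A \<inter> K \<noteq> {}}"
proof -
  obtain B where B: "\<And>x. x \<in> K \<Longrightarrow> norm x \<le> B" using assms(3) bounded_iff by blast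
  define N where "N = \<lceil>B\<rceil> + 2"
  have "{A \<in> resonator_family D1 D2. A \<inter> K \<noteq> {}} \<subseteq> (\<lambda>m. translate m D1) ` {-N..N} \<union> (\<lambda>m. translate m D2) ` {-N..N}"
  proof
    fix A assume "A \<in> {A \<in> resonator_family D1 D2. A \<inter> K \<noteq> {}}"
    then obtain m D x where A: "A = translate m D" "D = D1 \<or> D = D2" "x \<in> A" "x \<in> K"
      by (auto elim!: resonator_familyE)
    then obtain y where y: "y \<in> D" "x $ 1 = y $ 1 + of_int m" using translate_coord by metis
    then have "0 \<le> y $ 1" "y $ 1 < 1" using A(2) assms(1,2) by auto
    moreover have "\<bar>x $ 1\<bar> \<le> B" using component_le_norm_cart[of x 1] B[OF A(4)] by linarith
    ultimately have "m \<in> {-N..N}" using y(2) unfolding N_def by (simp add: abs_le_iff) linarith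
    then show "A \<in> (\<lambda>m. translate m D1) ` {-N..N} \<union> (\<lambda>m. translate m D2) ` {-N..N}" using A(1,2) by auto
  qed
  then show ?thesis by (rule finite_subset) simp
qed

lemma resonators_disjoint:
  assumes "D1 \<subseteq> {x. 0 \<le> x $ 1 \<and> x $ 1 < 1}" "D2 \<subseteq> {x. 0 \<le> x $ 1 \<and> x $ 1 < 1}" "D1 \<inter> D2 = {}"
    and AB: "A \<in> resonator_family D1 D2" "B \<in> resonator_family D1 D2" "A \<noteq> B"
  shows "A \<inter> B = {}"
proof (rule ccontr)
  assume "A \<inter> B \<noteq> {}"
  then obtain x where x: "x \<in> A" "x \<in> B" by blast
  obtain m D where A: "A = translate m D" "D = D1 \<or> D = D2" using resonator_familyE[OF AB(1)] .
  obtain n E where B: "B = translate n E" "E = D1 \<or> E = D2" using resonator_familyE[OF AB(2)] .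
  obtain y where y: "y \<in> D" "x $ 1 = y $ 1 + of_int m" "x = y + vector [of_int m, 0, 0]" using x(1) A translate_coord by metis
  obtain z where z: "z \<in> E" "x $ 1 = z $ 1 + of_int n" "x = z + vector [of_int n, 0, 0]" using x(2) B translate_coord by metis
  have "0 \<le> y $ 1" "y $ 1 < 1" "0 \<le> z $ 1" "z $ 1 < 1" using y z A(2) B(2) assms(1,2) by auto
  then have "m = n" using y(2) z(2) by linarith
  then have "y = z" using y(3) z(3) by simp
  then have "D = E" using y(1) z(1) A(2) B(2) assms(3) by auto
  then show False using \<open>m = n\<close> A(1) B(1) AB(3) by simp
qed

lemma resonator_chart:
  assumes "smooth_domain D1" "smooth_domain D2" "A \<in> resonator_family D1 D2" "p \<in> frontier A" "e > 0"
  shows "\<exists>W\<subseteq>ball p e. boundary_chart A p W"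
proof -
  obtain m D where A: "A = translate m D" "D = D1 \<or> D = D2" using resonator_familyE[OF assms(3)] .
  have D: "smooth_boundary D" "open D" using A(2) assms(1,2) by (auto simp: smooth_domain_def)
  define a :: "real^3" where "a = vector [of_int m, 0, 0]"
  have Aa: "A = (+) a ` D" by (simp add: A translate_eq a_def)
  have "p \<in> (+) a ` frontier D" using assms(4) unfolding Aa frontier_translation .
  then obtain q where q: "p = a + q" "q \<in> frontier D" by blast
  obtain W where W: "W \<subseteq> ball q e" "boundary_chart D q W" using smooth_boundary_chart[OF D q(2) assms(5)] .
  have "(+) a ` W \<subseteq> ball p e" using W(1) q(1) by (auto simp: dist_norm)
  moreover have "boundary_chart A p ((+) a ` W)" unfolding Aa q(1) by (rule boundary_chart_translation[OF W(2)])
  ultimately show ?thesis by blast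
qed

lemma resonator_open_connected:
  assumes "smooth_domain D1" "smooth_domain D2" "A \<in> resonator_family D1 D2"
  shows "open A" "connected A" "A \<noteq> {}"
proof -
  obtain m D where A: "A = translate m D" "D = D1 \<or> D = D2" using resonator_familyE[OF assms(3)] .
  have D: "open D" "connected D" "D \<noteq> {}" using A(2) assms(1,2) by (auto simp: smooth_domain_def)
  show "open A" unfolding A(1) translate_eq by (rule open_translation[OF D(1)])
  show "connected A" unfolding A(1) translate_eq by (intro connected_continuous_image D(2) continuous_intros)
  show "A \<noteq> {}" using D(3) by (simp add: A(1) translate_def)
qed

lemma countable_resonator_family: "countable (resonator_family D1 D2)"
  unfolding resonator_family_def by (intro countable_UN) auto

text \<open>
  A countable partition into Borel sets makes the coefficient measurable, and it takes only finitely
  many values on a bounded set, by local finiteness.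
\<close>

lemma piecewise_constant_locally_bounded_measurable:
  fixes c :: "real^3 \<Rightarrow> complex"
  assumes cn: "countable \<F>" and op: "\<And>A. A \<in> \<F> \<Longrightarrow> open A"
    and lf: "\<And>K. bounded K \<Longrightarrow> finite {A \<in> \<F>. A \<inter> K \<noteq> {}}"
    and cc: "\<And>M. M \<in> insert (- \<Union>\<F>) \<F> \<Longrightarrow> c constant_on M"
  shows "locally_bounded_measurable c"
  unfolding locally_bounded_measurable_def
proof (intro conjI allI impI)
  let ?P = "insert (- \<Union>\<F>) \<F>"
  have cov: "\<exists>M\<in>?P. x \<in> M" for x by (cases "x \<in> \<Union>\<F>") auto
  have meas: "M \<in> sets lebesgue" if "M \<in> ?P" for M
  proof -
    have "open (\<Union>\<F>)" by (rule open_Union) (use op in blast)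
    then have "open M \<or> closed M" using that op by (metis closed_Compl insertE)
    then show ?thesis by (metis borel_closed borel_open sets_completionI_sets sets_lborel)
  qed
  show "c \<in> borel_measurable lebesgue"
  proof (rule measurableI)
    fix S :: "complex set" assume "S \<in> sets borel"
    have e: "c -` S \<inter> space lebesgue = \<Union>{M \<in> ?P. \<exists>x\<in>M. c x \<in> S}"
    proof (intro equalityI subsetI)
      fix x assume "x \<in> \<Union>{M \<in> ?P. \<exists>x\<in>M. c x \<in> S}"
      then obtain M y where "M \<in> ?P" "x \<in> M" "y \<in> M" "c y \<in> S" by blast
      then show "x \<in> c -` S \<inter> space lebesgue" using cc[of M] by (auto simp: constant_on_def)
    next
      fix x assume x: "x \<in> c -` S \<inter> space lebesgue"
      obtain M where "M \<in> ?P" "x \<in> M" using cov by blast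
      then show "x \<in> \<Union>{M \<in> ?P. \<exists>x\<in>M. c x \<in> S}" using x by (intro UnionI[of M]) auto
    qed
    have "countable {M \<in> ?P. \<exists>x\<in>M. c x \<in> S}" by (rule countable_subset[of _ ?P]) (use cn in auto)
    then show "c -` S \<inter> space lebesgue \<in> sets lebesgue"
      unfolding e by (rule sets.countable_Union) (use meas in blast)
  qed simp
  fix K :: "(real^3) set" assume "bounded K"
  let ?Q = "insert (- \<Union>\<F>) {A \<in> \<F>. A \<inter> K \<noteq> {}}"
  have "finite ?Q" using lf[OF \<open>bounded K\<close>] by simp
  moreover have "finite (c ` M)" if "M \<in> ?Q" for M
  proof -
    have "c constant_on M" using cc that by blast
    then obtain y where "\<forall>x\<in>M. c x = y" by (auto simp: constant_on_def)
    then have "c ` M \<subseteq> {y}" by auto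
    then show ?thesis using finite_subset by blast
  qed
  ultimately have "finite (\<Union>M\<in>?Q. c ` M)" by blast
  moreover have "c ` K \<subseteq> (\<Union>M\<in>?Q. c ` M)" by blast
  ultimately have "bounded (c ` K)" using finite_imp_bounded bounded_subset by blast
  then show "\<exists>B. \<forall>x\<in>K. norm (c x) \<le> B" by (auto simp: bounded_iff)
qed

lemma integral_constant_coefficient:
  assumes f: "L1_loc f" and c: "locally_bounded_measurable c" and \<psi>: "test_function \<psi>"
    and ae: "AE x in lebesgue. x \<in> supp \<psi> \<longrightarrow> c x = y \<or> f x = 0"
  shows "(LINT x|lebesgue. (c x * f x) * \<psi> x) = y * (LINT x|lebesgue. f x * \<psi> x)"
proof -
  have "(LINT x|lebesgue. (c x * f x) * \<psi> x) = (LINT x|lebesgue. y * (f x * \<psi> x))"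
  proof (rule integral_cong_AE)
    show "(\<lambda>x. (c x * f x) * \<psi> x) \<in> borel_measurable lebesgue"
      by (rule borel_measurable_integrable[OF L1_loc_mult_test[OF L1_loc_mult_bounded[OF f c] \<psi>]])
    show "(\<lambda>x. y * (f x * \<psi> x)) \<in> borel_measurable lebesgue"
      by (rule borel_measurable_integrable[OF integrable_mult_right[OF L1_loc_mult_test[OF f \<psi>]]])
    show "AE x in lebesgue. (c x * f x) * \<psi> x = y * (f x * \<psi> x)"
      using ae
    proof eventually_elim
      case (elim x)
      then show ?case by (cases "x \<in> supp \<psi>") (auto simp: zero_outside_supp[of x \<psi>])
    qed
  qed
  then show ?thesis by simp
qed

lemma sum_axis_Basis: "(\<Sum>i\<in>UNIV. f (axis i (1::real))) = (\<Sum>b\<in>(Basis :: (real^3) set). f b)"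
proof -
  have B: "Basis = range (\<lambda>i. axis i (1::real) :: real^3)" by (auto simp: Basis_vec_def)
  have "inj (\<lambda>i. axis i (1::real) :: real^3)" by (auto simp: inj_on_def axis_eq_axis)
  from sum.reindex[OF this, of f] show ?thesis unfolding B by (simp add: o_def)
qed

text \<open>
  The coefficients only matter where \<open>v\<close> or its gradient is non-zero.  It is therefore enough that they
  are constant there; this is what allows crossing an interface with zeros on one side.
\<close>

lemma helmholtz_constant_coefficients:
  fixes v :: "real^3 \<Rightarrow> complex"
  assumes v: "L1_loc v" and w: "\<And>b. b \<in> Basis \<Longrightarrow> L1_loc (w b)" and vw: "has_weak_gradient v w"
    and c: "locally_bounded_measurable (\<lambda>x. 1 / \<rho> x)" "locally_bounded_measurable (\<lambda>x. 1 / \<kappa> x)"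
    and eq: "(\<Sum>i\<in>UNIV. LINT x|lebesgue. (1 / \<rho> x * w (axis i 1) x) * partial (axis i 1) \<psi> x)
        = \<omega>^2 * (LINT x|lebesgue. (1 / \<kappa> x * v x) * \<psi> x)"
    and \<psi>: "test_function \<psi>" and r: "r \<noteq> 0"
    and ae: "AE x in lebesgue. x \<in> supp \<psi> \<longrightarrow> (\<rho> x = r \<and> \<kappa> x = k) \<or> (v x = 0 \<and> (\<forall>b\<in>Basis. w b x = 0))"
  shows "(LINT x|lebesgue. v x * laplacian \<psi> x) = - (r * \<omega>^2 / k) * (LINT x|lebesgue. v x * \<psi> x)"
proof -
  have b: "axis i (1::real) \<in> Basis" for i :: 3 by (auto simp: Basis_vec_def)
  have "(LINT x|lebesgue. (1 / \<rho> x * w (axis i 1) x) * partial (axis i 1) \<psi> x)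
      = 1 / r * - (LINT x|lebesgue. v x * partial (axis i 1) (\<lambda>y. partial (axis i 1) \<psi> y) x)" for i :: 3
  proof -
    have t: "test_function (\<lambda>y. partial (axis i 1) \<psi> y)" by (rule test_function_partial[OF \<psi> b])
    have "(LINT x|lebesgue. (1 / \<rho> x * w (axis i 1) x) * partial (axis i 1) \<psi> x)
        = 1 / r * (LINT x|lebesgue. w (axis i 1) x * partial (axis i 1) \<psi> x)"
    proof (rule integral_constant_coefficient[OF w[OF b] c(1) t])
      show "AE x in lebesgue. x \<in> supp (\<lambda>y. partial (axis i 1) \<psi> y) \<longrightarrow> 1 / \<rho> x = 1 / r \<or> w (axis i 1) x = 0"
        using ae
      proof eventually_elim
        case (elim x)
        show ?case
        proof
          assume "x \<in> supp (\<lambda>y. partial (axis i 1) \<psi> y)"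
          then have "x \<in> supp \<psi>" by (rule subsetD[OF supp_partial])
          then show "1 / \<rho> x = 1 / r \<or> w (axis i 1) x = 0" using elim b[of i] by blast
        qed
      qed
    qed
    also have "(LINT x|lebesgue. w (axis i 1) x * partial (axis i 1) \<psi> x)
        = - (LINT x|lebesgue. v x * partial (axis i 1) (\<lambda>y. partial (axis i 1) \<psi> y) x)"
      using vw[unfolded has_weak_gradient_def, rule_format, OF b[of i] t] by simp
    finally show ?thesis .
  qed
  then have "(\<Sum>i\<in>UNIV. LINT x|lebesgue. (1 / \<rho> x * w (axis i 1) x) * partial (axis i 1) \<psi> x)
      = - (1 / r) * (\<Sum>i\<in>UNIV. LINT x|lebesgue. v x * partial (axis i 1) (\<lambda>y. partial (axis i 1) \<psi> y) x)"
    by (simp add: sum_distrib_left)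
  also have "(\<Sum>i\<in>UNIV. LINT x|lebesgue. v x * partial (axis i 1) (\<lambda>y. partial (axis i 1) \<psi> y) x)
      = (\<Sum>b\<in>Basis. LINT x|lebesgue. v x * partial b (\<lambda>y. partial b \<psi> y) x)"
    by (rule sum_axis_Basis)
  also have "\<dots> = (LINT x|lebesgue. (\<Sum>b\<in>Basis. v x * partial b (\<lambda>y. partial b \<psi> y) x))"
    by (rule Bochner_Integration.integral_sum[symmetric])
       (intro L1_loc_mult_test v test_function_partial \<psi>)
  also have "\<dots> = (LINT x|lebesgue. v x * laplacian \<psi> x)"
    by (simp add: laplacian_def sum_distrib_left)
  finally have 1: "- (1 / r) * (LINT x|lebesgue. v x * laplacian \<psi> x) = \<omega>^2 * (LINT x|lebesgue. (1 / \<kappa> x * v x) * \<psi> x)"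
    using eq by simp
  have "(LINT x|lebesgue. (1 / \<kappa> x * v x) * \<psi> x) = 1 / k * (LINT x|lebesgue. v x * \<psi> x)"
  proof (rule integral_constant_coefficient[OF v c(2) \<psi>])
    show "AE x in lebesgue. x \<in> supp \<psi> \<longrightarrow> 1 / \<kappa> x = 1 / k \<or> v x = 0" using ae by eventually_elim auto
  qed
  with 1 have "- (1 / r) * (LINT x|lebesgue. v x * laplacian \<psi> x) = \<omega>^2 * (1 / k * (LINT x|lebesgue. v x * \<psi> x))" by simp
  then have "r * (- (1 / r) * (LINT x|lebesgue. v x * laplacian \<psi> x)) = r * (\<omega>^2 * (1 / k * (LINT x|lebesgue. v x * \<psi> x)))" by simp
  then have "- (LINT x|lebesgue. v x * laplacian \<psi> x) = r * (\<omega>^2 * (1 / k * (LINT x|lebesgue. v x * \<psi> x)))"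
    using r by simp
  then have "(LINT x|lebesgue. v x * laplacian \<psi> x) = - (r * (\<omega>^2 * (1 / k * (LINT x|lebesgue. v x * \<psi> x))))"
    by (metis minus_minus)
  then show ?thesis by (simp add: divide_inverse mult_ac)
qed

definition zero_set :: "(real^3 \<Rightarrow> complex) \<Rightarrow> (real^3) set" where
  "zero_set v = \<Union>{W. open W \<and> (AE x in lebesgue. x \<in> W \<longrightarrow> v x = 0)}"

lemma open_zero_set: "open (zero_set v)" by (auto simp: zero_set_def)

lemma zero_setI: "open W \<Longrightarrow> AE x in lebesgue. x \<in> W \<longrightarrow> v x = 0 \<Longrightarrow> W \<subseteq> zero_set v"
  by (auto simp: zero_set_def)

lemma AE_zero_set: "AE x in lebesgue. x \<in> zero_set v \<longrightarrow> v x = 0"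
proof -
  let ?F = "{W. open W \<and> (AE x in lebesgue. x \<in> W \<longrightarrow> v x = 0)}"
  obtain D where D: "D \<subseteq> ?F" "countable D" "\<Union>D = \<Union>?F" by (rule Lindelof[of ?F]) auto
  have "AE x in lebesgue. \<forall>W\<in>D. x \<in> W \<longrightarrow> v x = 0"
    by (subst AE_ball_countable[OF D(2)]) (use D(1) in blast)
  then show ?thesis by (rule eventually_mono) (use D(3) in \<open>auto simp: zero_set_def\<close>)
qed

lemma AE_gradient_zero_set:
  assumes v: "L1_loc v" and w: "L1_loc (w b)" and vw: "has_weak_gradient v w" and b: "b \<in> Basis"
  shows "AE x in lebesgue. x \<in> zero_set v \<longrightarrow> w b x = 0"
proof (rule fundamental_lemma_bump[OF w open_zero_set])
  fix p q n assume pq: "cbox p q \<subseteq> zero_set v"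
  have "(LINT x|lebesgue. v x * partial b (cboxbump p q n) x) = 0"
  proof (rule integral_eq_zero_AE)
    show "AE x in lebesgue. v x * partial b (cboxbump p q n) x = 0"
      using AE_zero_set[of v]
    proof eventually_elim
      case (elim x)
      show ?case
      proof (cases "x \<in> supp (cboxbump p q n)")
        case True
        then have "x \<in> zero_set v" using supp_cboxbump pq by blast
        then show ?thesis using elim by simp
      qed (simp add: partial_zero_outside)
    qed
  qed
  then show "(LINT x|lebesgue. w b x * cboxbump p q n x) = 0"
    using vw[unfolded has_weak_gradient_def, rule_format, OF b test_function_cboxbump[of p q n]] by simp
qed

theorem proposition1:
  fixes D1 D2 :: "(real^3) set"
    and \<rho>m \<rho>p \<kappa>m \<kappa>p :: "real^3 \<Rightarrow> complex"
    and \<omega>m \<omega>p :: complex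
  assumes "smooth_domain D1" "bounded D1" "simply_connected D1"
    and "smooth_domain D2" "bounded D2" "simply_connected D2"
    and "D1 \<subseteq> {x. 0 \<le> x $ 1 \<and> x $ 1 < 1}" "D2 \<subseteq> {x. 0 \<le> x $ 1 \<and> x $ 1 < 1}"
    and "D1 \<inter> D2 = {}"
    and "material_coefficient D1 D2 \<rho>m" "material_coefficient D1 D2 \<rho>p"
    and "material_coefficient D1 D2 \<kappa>m" "material_coefficient D1 D2 \<kappa>p"
    and "\<omega>m \<noteq> 0" "\<omega>p \<noteq> 0"
    and "\<exists>u. quasi_harmonic_solution (instantly_changing \<rho>m \<rho>p) (instantly_changing \<kappa>m \<kappa>p) \<omega>m \<omega>p u"
  shows "\<forall>x. \<omega>p / \<omega>m = \<kappa>p x / \<kappa>m x \<and> \<kappa>p x / \<kappa>m x = \<rho>m x / \<rho>p x"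
proof -
  let ?\<F> = "resonator_family D1 D2"
  let ?P = "insert (- \<Union>?\<F>) ?\<F>"
  note strip = assms(7,8)
  note op = resonator_open_connected(1)[OF assms(1,4)]
  note lf = resonators_locally_finite[OF strip]
  have const: "c constant_on M" if "material_coefficient D1 D2 c" "M \<in> ?P" for c M
    using that by (auto simp: material_coefficient_def Union_resonator_family elim: resonator_familyE)
  have nz: "c x \<noteq> 0" if "material_coefficient D1 D2 c" for c x using that by (simp add: material_coefficient_def)
  have lb: "locally_bounded_measurable (\<lambda>x. 1 / c x)" if c: "material_coefficient D1 D2 c" for c
  proof (rule piecewise_constant_locally_bounded_measurable[OF countable_resonator_family op lf])
    fix M assume "M \<in> ?P"
    from const[OF c this] show "(\<lambda>x. 1 / c x) constant_on M" by (auto simp: constant_on_def)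
  qed
  note lbs = lb[OF assms(10)] lb[OF assms(11)] lb[OF assms(12)] lb[OF assms(13)]
  obtain u v \<omega> where sol: "weak_wave_solution (instantly_changing \<rho>m \<rho>p) (instantly_changing \<kappa>m \<kappa>p) u"
    and u0: "\<not> (AE z in lebesgue. u z = 0)" and "H1_loc v"
    and \<omega>: "\<And>t. t < 0 \<Longrightarrow> \<omega> t = \<omega>m" "\<And>t. t > 0 \<Longrightarrow> \<omega> t = \<omega>p"
    and u: "\<And>x t. u (x, t) = v x * exp (- \<i> * \<omega> t * complex_of_real t)"
    using assms(16) unfolding quasi_harmonic_solution_def by blast
  then obtain w where v2: "L2_loc v" and w2: "\<And>b. b \<in> Basis \<Longrightarrow> L2_loc (w b)" and vw: "has_weak_gradient v w"
    unfolding H1_loc_def by blast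
  have v: "L1_loc v" and w: "\<And>b. b \<in> Basis \<Longrightarrow> L1_loc (w b)" using v2 w2 L2_loc_imp_L1_loc by blast+
  let ?S = "\<lambda>\<rho> \<psi>. \<Sum>i\<in>UNIV. LINT x|lebesgue. (1 / \<rho> x * w (axis i 1) x) * partial (axis i 1) \<psi> x"
  let ?K = "\<lambda>\<kappa> \<psi>. LINT x|lebesgue. (1 / \<kappa> x * v x) * \<psi> x"
  have sep: "?S \<rho>m \<psi> = \<omega>m^2 * ?K \<kappa>m \<psi>" "?S \<rho>p \<psi> = \<omega>p^2 * ?K \<kappa>p \<psi>"
    "\<omega>m * ?K \<kappa>m \<psi> = \<omega>p * ?K \<kappa>p \<psi>" if \<psi>: "test_function \<psi>" for \<psi>
    using separated_equations[OF sol u \<omega> v2 w2 vw lbs \<psi>] by blast+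
  define Z where "Z = zero_set v"
  have Z: "open Z" by (simp add: Z_def open_zero_set)
  have "AE x in lebesgue. \<forall>b\<in>Basis. x \<in> Z \<longrightarrow> w b x = 0"
    unfolding Z_def by (subst AE_ball_countable) (use AE_gradient_zero_set[OF v w vw] in \<open>auto intro: countable_finite\<close>)
  then have vwZ: "AE x in lebesgue. x \<in> Z \<longrightarrow> v x = 0 \<and> (\<forall>b\<in>Basis. w b x = 0)"
    using AE_zero_set[of v] unfolding Z_def by eventually_elim blast
  have vals: "\<exists>y. y \<noteq> 0 \<and> (\<forall>x\<in>M. c x = y)" if mc: "material_coefficient D1 D2 c" "M \<in> ?P" for c M
  proof -
    obtain y where y: "\<forall>x\<in>M. c x = y" using const[OF mc] by (auto simp: constant_on_def)
    show ?thesis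
    proof (cases "M = {}")
      case True
      then show ?thesis by (intro exI[of _ 1]) simp
    next
      case False
      then have "y \<noteq> 0" using y nz[OF mc(1)] by blast
      then show ?thesis using y by blast
    qed
  qed
  have ae_M: "AE x in lebesgue. x \<in> supp \<psi> \<longrightarrow> (\<rho> x = r \<and> \<kappa> x = k) \<or> (v x = 0 \<and> (\<forall>b\<in>Basis. w b x = 0))"
    if "\<forall>x\<in>M. \<rho> x = r" "\<forall>x\<in>M. \<kappa> x = k" "supp \<psi> \<subseteq> W" "negligible (W - M - Z)" for \<rho> \<kappa> :: "real^3 \<Rightarrow> complex" and r k \<psi> M W
  proof -
    have "AE x in lebesgue. x \<notin> W - M - Z" by (rule AE_not_in[OF that(4)[unfolded negligible_iff_null_sets]])
    then show ?thesis using vwZ by eventually_elim (use that(1-3) in blast)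
  qed
  have spread: "ball x R \<subseteq> Z" if M: "M \<in> ?P" and x: "x \<in> Z" and ng: "negligible (ball x R - M - Z)" for M x R
  proof -
    obtain r k where r: "r \<noteq> 0" "\<forall>x\<in>M. \<rho>p x = r" and k: "k \<noteq> 0" "\<forall>x\<in>M. \<kappa>p x = k"
      using vals[OF assms(11) M] vals[OF assms(13) M] by blast
    obtain \<delta> where \<delta>: "\<delta> > 0" "ball x \<delta> \<subseteq> Z" using x Z openE by blast
    have "AE y in lebesgue. y \<in> ball x R \<longrightarrow> v y = 0"
    proof (rule unique_continuation_ball[OF v _ _ \<delta>(1)])
      fix \<psi> :: "real^3 \<Rightarrow> complex" assume \<psi>: "test_function \<psi>" "supp \<psi> \<subseteq> ball x R"
      have h: "(LINT x|lebesgue. v x * laplacian \<psi> x) = - (r * \<omega>p^2 / k) * (LINT x|lebesgue. v x * \<psi> x)"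
        by (rule helmholtz_constant_coefficients[OF v w vw lbs(2) lbs(4) sep(2)[OF \<psi>(1)] \<psi>(1) r(1) ae_M[OF r(2) k(2) \<psi>(2) ng]])
      have "(LINT y|lebesgue. v y * (laplacian \<psi> y + r * \<omega>p^2 / k * \<psi> y))
         = (LINT y|lebesgue. v y * laplacian \<psi> y + (r * \<omega>p^2 / k) * (v y * \<psi> y))"
        by (simp add: algebra_simps)
      also have "\<dots> = (LINT y|lebesgue. v y * laplacian \<psi> y) + (r * \<omega>p^2 / k) * (LINT y|lebesgue. v y * \<psi> y)"
        by (subst Bochner_Integration.integral_add)
           (auto intro!: integrable_mult_right L1_loc_mult_test v test_function_laplacian \<psi>(1))
      finally show "(LINT y|lebesgue. v y * (laplacian \<psi> y + r * \<omega>p^2 / k * \<psi> y)) = 0" using h by simp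
    next
      show "AE y in lebesgue. y \<in> ball x \<delta> \<longrightarrow> v y = 0" using vwZ by eventually_elim (use \<delta>(2) in blast)
    qed
    then show ?thesis unfolding Z_def by (intro zero_setI open_ball)
  qed
  have Zempty: "Z = {}"
  proof (rule ccontr)
    assume "Z \<noteq> {}"
    have "Z = UNIV"
      by (rule zero_set_spreads[OF op resonator_open_connected(2)[OF assms(1,4)] resonators_disjoint[OF strip assms(9)] lf
            resonator_chart[OF assms(1,4)] Z \<open>Z \<noteq> {}\<close> spread])
    then have "AE x in lebesgue. v x = 0" using vwZ by simp
    from AE_fst_snd(1)[OF this] have "AE z in lebesgue. u z = 0"
      by (rule eventually_mono) (auto simp: u)
    then show False using u0 by blast
  qed
  have core: "\<omega>p / \<omega>m = kp / km \<and> kp / km = rm / rp"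
    if M: "M \<in> ?P" and W: "open W" "W \<noteq> {}" "W \<subseteq> M"
      and c: "\<forall>x\<in>M. \<rho>m x = rm" "\<forall>x\<in>M. \<rho>p x = rp" "\<forall>x\<in>M. \<kappa>m x = km" "\<forall>x\<in>M. \<kappa>p x = kp"
      and n: "rm \<noteq> 0" "rp \<noteq> 0" "km \<noteq> 0" "kp \<noteq> 0" for M W rm rp km kp
  proof -
    have "\<exists>p q n. cbox p q \<subseteq> W \<and> (LINT x|lebesgue. v x * cboxbump p q n x) \<noteq> 0"
    proof (rule ccontr)
      assume "\<not> ?thesis"
      then have "AE x in lebesgue. x \<in> W \<longrightarrow> v x = 0"
        by (intro fundamental_lemma_bump[OF v W(1)]) blast
      then have "W \<subseteq> Z" unfolding Z_def by (intro zero_setI W(1))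
      then show False using Zempty W(2) by blast
    qed
    then obtain p q n where pq: "cbox p q \<subseteq> W" and I: "(LINT x|lebesgue. v x * cboxbump p q n x) \<noteq> 0" by blast
    define \<psi> where "\<psi> = (\<lambda>x. cboxbump p q n x)"
    define I where "I = (LINT x|lebesgue. v x * \<psi> x)"
    have I0: "I \<noteq> 0" using I by (simp add: I_def \<psi>_def)
    have \<psi>: "test_function \<psi>" unfolding \<psi>_def by (rule test_function_cboxbump)
    have sub: "supp \<psi> \<subseteq> W" using supp_cboxbump pq unfolding \<psi>_def by blast
    have ng: "negligible (W - M - Z)" using W(3) by (simp add: Diff_eq_empty_iff[THEN iffD2])
    have hm: "(LINT x|lebesgue. v x * laplacian \<psi> x) = - (rm * \<omega>m^2 / km) * I" unfolding I_def
      by (rule helmholtz_constant_coefficients[OF v w vw lbs(1) lbs(3) sep(1)[OF \<psi>] \<psi> n(1) ae_M[OF c(1,3) sub ng]])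
    have hp: "(LINT x|lebesgue. v x * laplacian \<psi> x) = - (rp * \<omega>p^2 / kp) * I" unfolding I_def
      by (rule helmholtz_constant_coefficients[OF v w vw lbs(2) lbs(4) sep(2)[OF \<psi>] \<psi> n(2) ae_M[OF c(2,4) sub ng]])
    have "- (rm * \<omega>m^2 / km) * I = - (rp * \<omega>p^2 / kp) * I" using hm hp by (rule trans[OF sym])
    then have e1: "rm * \<omega>m^2 / km = rp * \<omega>p^2 / kp" using I0 by (simp only: mult_right_cancel neg_equal_iff_equal simp_thms)
    have km: "(LINT x|lebesgue. (1 / \<kappa>m x * v x) * \<psi> x) = 1 / km * I" unfolding I_def
      by (rule integral_constant_coefficient[OF v lbs(3) \<psi>]) (use c(3) sub W(3) in \<open>auto intro!: AE_I2\<close>)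
    have kp: "(LINT x|lebesgue. (1 / \<kappa>p x * v x) * \<psi> x) = 1 / kp * I" unfolding I_def
      by (rule integral_constant_coefficient[OF v lbs(4) \<psi>]) (use c(4) sub W(3) in \<open>auto intro!: AE_I2\<close>)
    have "\<omega>m * (1 / km * I) = \<omega>p * (1 / kp * I)" using sep(3)[OF \<psi>] unfolding km kp .
    then have e2: "\<omega>m * kp = \<omega>p * km" using I0 n by (simp add: field_simps)
    have e3: "rm * \<omega>m = rp * \<omega>p"
    proof -
      have "rm * \<omega>m^2 * kp = rp * \<omega>p^2 * km" using e1 n by (simp add: field_simps)
      then have "(rm * \<omega>m) * (\<omega>m * kp) = (rp * \<omega>p) * (\<omega>p * km)" by (simp add: power2_eq_square mult_ac)
      then show ?thesis using e2 assms(14,15) n by simp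
    qed
    have "\<omega>p / \<omega>m = kp / km" using e2 assms(14) n by (simp add: field_simps)
    moreover have "\<omega>p / \<omega>m = rm / rp" using e3 assms(14) n by (simp add: field_simps)
    ultimately show ?thesis by simp
  qed
  have pieces: "\<exists>W. open W \<and> W \<noteq> {} \<and> W \<subseteq> M" if "M \<in> ?P" for M
  proof (cases "M \<in> ?\<F>")
    case True
    then show ?thesis using op resonator_open_connected(3)[OF assms(1,4)] by blast
  next
    case False
    then have M: "M = - \<Union>?\<F>" using that by blast
    have "bounded (D1 \<union> D2)" using assms(2,5) by simp
    then obtain B where "\<forall>x\<in>D1 \<union> D2. norm x \<le> B" unfolding bounded_iff ..
    then have B: "\<And>x. x \<in> D1 \<union> D2 \<Longrightarrow> norm x \<le> B" by blast
    \<comment> \<open>The resonators are lined up along the first axis, so they miss a half space.\<close>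
    let ?W = "{x :: real^3. B < x $ 2}"
    have "open ?W" by (rule open_halfspace_component_gt_cart)
    moreover have "(\<chi> i. B + 1) \<in> ?W" by simp
    moreover have "?W \<subseteq> M"
    proof
      fix x assume x: "x \<in> ?W"
      have "x \<notin> A" if A: "A \<in> ?\<F>" for A
      proof
        assume xA: "x \<in> A"
        obtain m D where D: "A = translate m D" "D = D1 \<or> D = D2" using resonator_familyE[OF A] .
        obtain y where "y \<in> D" "x $ 2 = y $ 2" using translate_coord xA D(1) by metis
        then show False using x D(2) B[of y] component_le_norm_cart[of y 2] by auto
      qed
      then show "x \<in> M" unfolding M by blast
    qed
    ultimately show ?thesis by blast
  qed
  show ?thesis
  proof
    fix x
    obtain M where M: "M \<in> ?P" "x \<in> M" by (cases "x \<in> \<Union>?\<F>") auto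
    obtain W where W: "open W" "W \<noteq> {}" "W \<subseteq> M" using pieces[OF M(1)] by blast
    have eqx: "\<forall>y\<in>M. c y = c x" if "material_coefficient D1 D2 c" for c
      using const[OF that M(1)] M(2) by (auto simp: constant_on_def)
    show "\<omega>p / \<omega>m = \<kappa>p x / \<kappa>m x \<and> \<kappa>p x / \<kappa>m x = \<rho>m x / \<rho>p x"
      by (rule core[OF M(1) W eqx[OF assms(10)] eqx[OF assms(11)] eqx[OF assms(12)] eqx[OF assms(13)]
            nz[OF assms(10)] nz[OF assms(11)] nz[OF assms(12)] nz[OF assms(13)]])
  qed
qed

end
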